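(* The Poisson algebra $D_n$ admits exactly $n$ algebraically independent central elements $c_1,\dots,c_n$. They are generated by $$\det\bigl[(\lambda-1)\hat{\mathcal R}+(\lambda+1)\hat{\mathcal S}+(\lambda^2-1)\hat{\mathcal A}-(\lambda-\lambda^{-1})\hat{\mathcal A}^T\bigr]=(\lambda-1)^{n-1}\Bigl[\lambda^{n+1}+\sum_{i=1}^n\lambda^ic_i+(-1)^{n+1}\sum_{i=1}^n\lambda^{1-i}c_i+(-1)^{n+1}\lambda^{-n}\Bigr].$$
   Context: $D_n$ ($n\ge2$) is a Poisson algebra on $n^2$ independent commuting variables $\hat G_{i,j}$, $1\le i,j\le n$ (geometrically: geodesic functions on an annulus with $n$ orbifold points of order two, with Goldman's bracket). Matrices: $\hat{\mathcal A}$ is upper triangular with $\hat{\mathcal A}_{i,j}=\hat G_{i,j}$ for $i<j$ and $1$ on the diagonal; $\hat{\mathcal S}_{i,j}=\hat G_{i,i}\hat G_{j,j}$ for all $i,j$; $\hat{\mathcal R}$ is skew-symmetric with $\hat{\mathcal R}_{i,j}=\hat G_{i,i}\hat G_{j,j}-\hat G_{j,i}-\hat G_{i,j}$ for $i<j$. Bracket of $D_n$: it is the unique Poisson bracket on the $\hat G_{i,j}$ for which the following reduction is a homomorphism of Poisson algebras $\mathfrak D_n\to D_n$ (with $e^{P_h}$, $\Pi=e^{P_h/2}+e^{-P_h/2}\neq0$, a constant; the bracket does not depend on it): $$\mathcal G(\lambda)\mapsto\frac{\lambda}{(\lambda-1)(e^{-P_h}\lambda-1)(e^{P_h}\lambda-1)}\bigl[(\lambda-1)\hat{\mathcal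 R}+(\lambda+1)\hat{\mathcal S}+(\lambda^2-1)\hat{\mathcal A}-(\lambda-\lambda^{-1})\hat{\mathcal A}^T\bigr]$$ (expanded in $\lambda^{-1}$). In particular $G^{(0)}_{i,j}\mapsto\hat G_{i,j}$ for $i<j$, $G^{(1)}_{i,j}\mapsto\hat G_{i,j}$ for $i>j$, $G^{(1)}_{i,i}\mapsto\hat G_{i,i}^2+\Pi^2-2$, which determines the bracket; for example $\{\hat G_{1,2},\hat G_{1,1}\}=2\hat G_{2,2}-\hat G_{1,2}\hat G_{1,1}$, $\{\hat G_{1,1},\hat G_{2,2}\}=\hat G_{1,2}-\hat G_{2,1}$, $\{\hat G_{i,j},\hat G_{j,i}\}=2\hat G_{j,j}^2-2\hat G_{i,i}^2$ for $i<j$. $\mathfrak D_n$ is the Poisson algebra on commuting generators $G^{(0)}_{i,j}$ ($i<j$), $G^{(k)}_{i,j}$ ($k\ge1$, all $i,j$); $\mathcal G_{i,j}(\lambda)=\mathcal A^{(0)}_{i,j}+\sum_{k\ge1}G^{(k)}_{i,j}\lambda^{-k}$ with $\mathcal A^{(0)}$ upper triangular, unit diagonal, entries $G^{(0)}_{i,j}$ for $i<j$; bracket ($\epsilon$ = sign function, $\epsilon(0)=0$) $$\begin{aligned}\{\mathcal G_{j,i}(\lambda),\mathcal G_{p,l}(\mu)\}={}&\Bigl(\epsilon(j-p)-\tfrac{\lambda+\mu}{\lambda-\mu}\Bigr)\mathcal G_{p,i}(\lambda)\mathcal G_{j,l}(\mu)+\Bigl(\epsilon(i-l)+\tfrac{\lambda+\mu}{\lambda-\mu}\Bigr)\mathcal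 G_{p,i}(\mu)\mathcal G_{j,l}(\lambda)\\&+\Bigl(\epsilon(i-p)-\tfrac{1+\lambda\mu}{1-\lambda\mu}\Bigr)\mathcal G_{j,p}(\lambda)\mathcal G_{i,l}(\mu)+\Bigl(\epsilon(j-l)+\tfrac{1+\lambda\mu}{1-\lambda\mu}\Bigr)\mathcal G_{l,i}(\lambda)\mathcal G_{p,j}(\mu).\end{aligned}$$ A central element is one whose bracket with every $\hat G_{i,j}$ vanishes; "exactly $n$" means that $n$ is the maximal number of algebraically independent central elements. *)

theory Defs
  imports
    "HOL-Analysis.Analysis"
    "HOL-Library.Poly_Mapping"
    "HOL-Computational_Algebra.Formal_Laurent_Series"
begin

section \<open>Polynomial algebras over the complex numbers\<close>

text \<open>The polynomial algebra on commuting variables indexed by \<^typ>\<open>'v\<close>: finitely supported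
  families of complex coefficients indexed by monomials, with the convolution product.\<close>

type_synonym 'v cpoly = "('v \<Rightarrow>\<^sub>0 nat) \<Rightarrow>\<^sub>0 complex"

definition Const :: "complex \<Rightarrow> 'v cpoly" where
  "Const a = Poly_Mapping.single 0 a"

definition Var :: "'v \<Rightarrow> 'v cpoly" where
  "Var v = Poly_Mapping.single (Poly_Mapping.single v 1) 1"

definition poly_subst :: "('v \<Rightarrow> 'w cpoly) \<Rightarrow> 'v cpoly \<Rightarrow> 'w cpoly" where
  "poly_subst f p = (\<Sum>m\<in>Poly_Mapping.keys p.
     Const (Poly_Mapping.lookup p m) * (\<Prod>v\<in>Poly_Mapping.keys m. f v ^ Poly_Mapping.lookup m v))"

definition alg_indep :: "'i set \<Rightarrow> ('i \<Rightarrow> 'v cpoly) \<Rightarrow> bool" where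
  "alg_indep I f \<longleftrightarrow>
    (\<forall>Q :: 'i cpoly. (\<forall>m\<in>Poly_Mapping.keys Q. Poly_Mapping.keys m \<subseteq> I) \<longrightarrow>
      poly_subst f Q = 0 \<longrightarrow> Q = 0)"


section \<open>Poisson brackets\<close>

definition is_poisson_bracket :: "('v cpoly \<Rightarrow> 'v cpoly \<Rightarrow> 'v cpoly) \<Rightarrow> bool" where
  "is_poisson_bracket B \<longleftrightarrow>
    (\<forall>f g h. B (f + g) h = B f h + B g h) \<and>
    (\<forall>a f g. B (Const a * f) g = Const a * B f g) \<and>
    (\<forall>f g. B f g = - B g f) \<and>
    (\<forall>f g h. B (f * g) h = f * B g h + B f h * g) \<and>
    (\<forall>f g h. B f (B g h) + B g (B h f) + B h (B f g) = 0)"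

definition is_poisson_hom ::
  "('v cpoly \<Rightarrow> 'v cpoly \<Rightarrow> 'v cpoly) \<Rightarrow> ('w cpoly \<Rightarrow> 'w cpoly \<Rightarrow> 'w cpoly) \<Rightarrow>
   ('v cpoly \<Rightarrow> 'w cpoly) \<Rightarrow> bool" where
  "is_poisson_hom P B \<phi> \<longleftrightarrow>
    (\<forall>a. \<phi> (Const a) = Const a) \<and>
    (\<forall>f g. \<phi> (f + g) = \<phi> f + \<phi> g) \<and>
    (\<forall>f g. \<phi> (f * g) = \<phi> f * \<phi> g) \<and>
    (\<forall>f g. \<phi> (P f g) = B (\<phi> f) (\<phi> g))"


section \<open>The Poisson algebra $\mathfrak D_n$\<close>

text \<open>The matrix indices form a finite linearly ordered type \<^typ>\<open>'n\<close>, so that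
  \<open>n = CARD('n)\<close>.  The triple \<open>(k, i, j)\<close> stands for the generator $G^{(k)}_{i,j}$.\<close>

typedef (overloaded) ('n :: linorder) frakD_gen = "{(k :: nat, i :: 'n, j :: 'n). k = 0 \<longrightarrow> i < j}"
  by (rule exI[of _ "(1, undefined, undefined)"]) simp

definition frakD_coeff :: "'n :: linorder \<Rightarrow> 'n \<Rightarrow> nat \<Rightarrow> 'n frakD_gen cpoly" where
  "frakD_coeff i j k =
    (if k = 0 \<and> \<not> i < j then (if i = j then 1 else 0) else Var (Abs_frakD_gen (k, i, j)))"

text \<open>Every series in this development is an expansion in inverse powers of the spectral
  parameters.  The variable \<^const>\<open>fls_X\<close> of a Laurent series is therefore $\lambda^{-1}$, and
  \<^const>\<open>fls_X_inv\<close> is $\lambda$.  Series in $\lambda$ and $\mu$ are Laurent series in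
  $\lambda^{-1}$ with coefficients that are Laurent series in $\mu^{-1}$.\<close>

abbreviation lam :: "'a :: {zero, one} fls" where
  "lam \<equiv> fls_X_inv"

abbreviation mu :: "'a :: {zero, one} fls fls" where
  "mu \<equiv> fls_const fls_X_inv"

definition series_lam :: "(nat \<Rightarrow> 'a :: zero) \<Rightarrow> 'a fls fls" where
  "series_lam g = fps_to_fls (Abs_fps (\<lambda>k. fls_const (g k)))"

definition series_mu :: "(nat \<Rightarrow> 'a :: zero) \<Rightarrow> 'a fls fls" where
  "series_mu g = fls_const (fps_to_fls (Abs_fps g))"

text \<open>$\sum_{k,m} h_{k,m}\lambda^{-k}\mu^{-m}$\<close>

definition series_lam_mu :: "(nat \<Rightarrow> nat \<Rightarrow> 'a :: zero) \<Rightarrow> 'a fls fls" where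
  "series_lam_mu h = fps_to_fls (Abs_fps (\<lambda>k. fps_to_fls (Abs_fps (h k))))"

text \<open>The sign of \<open>i - j\<close>.\<close>

definition eps :: "'n :: linorder \<Rightarrow> 'n \<Rightarrow> 'a :: ring_1" where
  "eps i j = (if i < j then - 1 else if i = j then 0 else 1)"

text \<open>The quadratic bracket of the generating series, multiplied by
  $(\lambda-\mu)(1-\lambda\mu)$.  Both factors are units among the Laurent series in
  $\lambda^{-1}$ with coefficients in the Laurent series in $\mu^{-1}$, so no information is lost.
  The bracket on the left has coefficients $\{G^{(k)}_{j,i}, G^{(m)}_{p,l}\}$.\<close>

definition is_frakD_bracket ::
  "(('n :: linorder) frakD_gen cpoly \<Rightarrow> 'n frakD_gen cpoly \<Rightarrow> 'n frakD_gen cpoly) \<Rightarrow> bool" where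
  "is_frakD_bracket P \<longleftrightarrow> is_poisson_bracket P \<and>
    (\<forall>j i p l.
      (let Gl = (\<lambda>a b. series_lam (frakD_coeff a b)); Gm = (\<lambda>a b. series_mu (frakD_coeff a b)) in
       (lam - mu) * (1 - lam * mu)
           * series_lam_mu (\<lambda>k m. P (frakD_coeff j i k) (frakD_coeff p l m))
       = (1 - lam * mu) * (eps j p * (lam - mu) - (lam + mu)) * Gl p i * Gm j l
       + (1 - lam * mu) * (eps i l * (lam - mu) + (lam + mu)) * Gm p i * Gl j l
       + (lam - mu) * (eps i p * (1 - lam * mu) - (1 + lam * mu)) * Gl j p * Gm i l
       + (lam - mu) * (eps j l * (1 - lam * mu) + (1 + lam * mu)) * Gl l i * Gm p j))"


section \<open>The Poisson algebra $D_n$\<close>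

definition Ghat :: "'n \<Rightarrow> 'n \<Rightarrow> ('n \<times> 'n) cpoly" where
  "Ghat i j = Var (i, j)"

definition Ahat :: "('n \<times> 'n) cpoly ^ ('n :: {finite, linorder}) ^ ('n :: {finite, linorder})" where
  "Ahat = (\<chi> i j. if i < j then Ghat i j else if i = j then 1 else 0)"

definition Shat :: "('n \<times> 'n) cpoly ^ ('n :: {finite, linorder}) ^ ('n :: {finite, linorder})" where
  "Shat = (\<chi> i j. Ghat i i * Ghat j j)"

definition Rhat :: "('n \<times> 'n) cpoly ^ ('n :: {finite, linorder}) ^ ('n :: {finite, linorder})" where
  "Rhat = (\<chi> i j.
     if i < j then Ghat i i * Ghat j j - Ghat j i - Ghat i j
     else if j < i then - (Ghat j j * Ghat i i - Ghat i j - Ghat j i)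
     else 0)"

text \<open>$(\lambda-1)\hat{\mathcal R}+(\lambda+1)\hat{\mathcal S}+(\lambda^2-1)\hat{\mathcal A}
  -(\lambda-\lambda^{-1})\hat{\mathcal A}^T$\<close>

definition Mhat :: "('n \<times> 'n) cpoly fls ^ ('n :: {finite, linorder}) ^ ('n :: {finite, linorder})" where
  "Mhat = (\<chi> i j.
     (lam - 1) * fls_const (Rhat $ i $ j) + (lam + 1) * fls_const (Shat $ i $ j)
     + (lam ^ 2 - 1) * fls_const (Ahat $ i $ j)
     - (lam - fls_X) * fls_const (transpose Ahat $ i $ j))"

text \<open>Division in the field of complex Laurent series expands the rational function in
  $\lambda^{-1}$.\<close>

definition prefactor :: "complex \<Rightarrow> complex fls" where
  "prefactor Ph =
     lam / ((lam - 1) * (fls_const (exp (- Ph)) * lam - 1) * (fls_const (exp Ph) * lam - 1))"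

definition fls_Const :: "complex fls \<Rightarrow> 'v cpoly fls" where
  "fls_Const f = Abs_fls (\<lambda>k. Const (fls_nth f k))"

text \<open>The generator $G^{(k)}_{i,j}$ is sent to the coefficient of $\lambda^{-k}$.\<close>

definition reduction ::
  "complex \<Rightarrow> ('n :: {finite, linorder}) frakD_gen cpoly \<Rightarrow> ('n \<times> 'n) cpoly" where
  "reduction Ph = poly_subst (\<lambda>x. case Rep_frakD_gen x of (k, i, j) \<Rightarrow>
     fls_nth (fls_Const (prefactor Ph) * Mhat $ i $ j) (int k))"

definition is_D_bracket ::
  "complex \<Rightarrow> (('n :: {finite, linorder} \<times> 'n) cpoly \<Rightarrow> ('n \<times> 'n) cpoly \<Rightarrow> ('n \<times> 'n) cpoly) \<Rightarrow> bool"
  where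
  "is_D_bracket Ph B \<longleftrightarrow> is_poisson_bracket B \<and>
     (\<exists>P. is_frakD_bracket P \<and> is_poisson_hom P B (reduction Ph))"

definition central :: "(('n \<times> 'n) cpoly \<Rightarrow> ('n \<times> 'n) cpoly \<Rightarrow> ('n \<times> 'n) cpoly) \<Rightarrow>
    ('n \<times> 'n) cpoly \<Rightarrow> bool" where
  "central B z \<longleftrightarrow> (\<forall>i j. B z (Ghat i j) = 0)"

end

theory Submission
  imports Defs "HOL-Computational_Algebra.Fundamental_Theorem_Algebra"
begin

text \<open>
Contracting the quadratic bracket of \<open>\<G>(z)\<close> with the cofactors of the evaluated matrix turns each
of its four terms into a multiple of the determinant, and these multiples cancel; so the
determinant is central for every \<open>z\<close>. Up to the symmetric rank one term
\<open>(z + 1) \<S>\<close> every entry of the matrix is divisible by \<open>z - 1\<close>, which gives the factor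
\<open>(z - 1)^(n - 1)\<close>, and replacing \<open>z\<close> by \<open>1 / z\<close> transposes the matrix up to a scalar,
which gives the symmetry of the coefficients.

Fix an involution \<open>\<sigma>\<close> of the indices with at most one fixed point. On the \<open>n\<close>-dimensional
coordinate subspace supported on the positions \<open>(i, \<sigma> i)\<close> the matrix splits into blocks of size at
most two, and the coefficients \<open>c\<^sub>i\<close> already take all values there; hence they are algebraically
independent. Conversely the linear part of the bracket at the origin is the Lie algebra
\<open>so(n) \<oplus> so(n + 1)\<close>, and that subspace plays the role of a Cartan subalgebra: at a regular
point of it, the brackets detect every transversal direction. So a central element that vanishes
on the subspace vanishes, and central elements are as algebraically dependent as
their restrictions to a space of dimension \<open>n\<close>.
\<close>

text \<open>The bracket is given only through the existence of a bracket on the generators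
  \<open>frakD_gen\<close> and of a homomorphism. The reduced series is M(\<lambda>) times a scalar
  series whose denominator is cubic; clearing it leaves Laurent polynomials, and only then may
  numbers be put for \<lambda> and \<mu>. Special values isolate the generators: M(1) = 2 S, M(-1) =
  -2 R, and other values give A. Conversely, an identity that holds at all but finitely many numbers
  holds for the coefficients. To first order at the origin, the \<open>Ghat i i\<close> and the
  differences \<open>Ghat i j - Ghat j i\<close> span so(n+1), with the \<open>Ghat i i\<close> as
  the rotations that involve one additional index, and the entries of \<open>Rhat\<close> span
  so(n). The ranks add up to n. For odd n the fixed index of the involution is paired with the
  additional index of so(n+1). Only the linear part of the bracket at the origin is controlled, so a
  central element is expanded along t p + t^2 x: the first order is frozen at the regular point p,
  and the variables x enter at second order.\<close>

no_notation fps_nth (infixl "$" 75)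

section \<open>Ring homomorphisms and cancellation in polynomial rings\<close>

locale ring_homo =
  fixes h :: "'a :: comm_ring_1 \<Rightarrow> 'b :: comm_ring_1"
  assumes hom_add: "h (x + y) = h x + h y"
    and hom_mult: "h (x * y) = h x * h y"
    and hom_one: "h 1 = 1"
begin

lemma hom_zero: "h 0 = 0"
  using hom_add[of 0 0] by simp

lemma hom_uminus: "h (- x) = - h x"
  using hom_add[of x "- x"] by (simp add: hom_zero eq_neg_iff_add_eq_0 add.commute)

lemma hom_diff: "h (x - y) = h x - h y"
  using hom_add[of x "- y"] by (simp add: hom_uminus)

lemma hom_sum: "h (sum f A) = (\<Sum>x\<in>A. h (f x))"
  by (induction A rule: infinite_finite_induct) (auto simp: hom_zero hom_add)

lemma hom_prod: "h (prod f A) = (\<Prod>x\<in>A. h (f x))"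
  by (induction A rule: infinite_finite_induct) (auto simp: hom_one hom_mult)

lemma hom_power: "h (x ^ k) = h x ^ k"
  by (induction k) (auto simp: hom_one hom_mult)

lemma hom_of_nat: "h (of_nat k) = of_nat k"
  by (induction k) (auto simp: hom_zero hom_add hom_one)

lemma hom_of_int: "h (of_int k) = of_int k"
  by (cases k) (auto simp: hom_of_nat hom_uminus hom_add hom_one hom_diff)

lemma hom_numeral: "h (numeral k) = numeral k"
  using hom_of_nat[of "numeral k"] by simp

lemma hom_det: "h (det A) = det (\<chi> i j. h (A $ i $ j))"
  by (simp add: det_def hom_sum hom_prod hom_mult hom_of_int)

end

lemma ring_homo_Const: "ring_homo Const"
  by unfold_locales (auto simp: Const_def single_add mult_single)

interpretation Const: ring_homo Const
  by (rule ring_homo_Const)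

lemma ring_homo_comp:
  assumes "ring_homo f" "ring_homo g" shows "ring_homo (\<lambda>x. f (g x))"
proof -
  interpret f: ring_homo f by fact
  interpret g: ring_homo g by fact
  show ?thesis
    by unfold_locales (simp_all add: f.hom_add g.hom_add f.hom_mult g.hom_mult f.hom_one g.hom_one)
qed

lemma cpoly_sum_singles:
  fixes p :: "'v cpoly"
  shows "p = (\<Sum>m\<in>Poly_Mapping.keys p. Poly_Mapping.single m (Poly_Mapping.lookup p m))"
proof (rule poly_mapping_eqI)
  fix k
  have "(\<Sum>m\<in>Poly_Mapping.keys p. Poly_Mapping.lookup (Poly_Mapping.single m (Poly_Mapping.lookup p m)) k)
      = (\<Sum>m\<in>Poly_Mapping.keys p. if k = m then Poly_Mapping.lookup p m else 0)"
    by (intro sum.cong) (auto simp: lookup_single when_def)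
  also have "\<dots> = Poly_Mapping.lookup p k"
    by (simp add: in_keys_iff)
  finally show "Poly_Mapping.lookup p k = Poly_Mapping.lookup (\<Sum>m\<in>Poly_Mapping.keys p. Poly_Mapping.single m (Poly_Mapping.lookup p m)) k"
    by (simp add: lookup_sum)
qed

text \<open>Multiplication by one monomial only shifts exponents and scales. This is the source of
  the cancellation of nonzero constants and of variables, by which denominators and factors
  \<open>Ghat p p\<close> are removed from bracket identities.\<close>

lemma lookup_single_mult:
  fixes f :: "'v cpoly"
  shows "Poly_Mapping.lookup (Poly_Mapping.single k a * f) (k + m) = a * Poly_Mapping.lookup f m"
proof -
  have "Poly_Mapping.single k a * f
      = (\<Sum>m'\<in>Poly_Mapping.keys f. Poly_Mapping.single (k + m') (a * Poly_Mapping.lookup f m'))"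
    by (subst cpoly_sum_singles[of f]) (simp only: sum_distrib_left mult_single)
  then have "Poly_Mapping.lookup (Poly_Mapping.single k a * f) (k + m)
      = (\<Sum>m'\<in>Poly_Mapping.keys f. if m = m' then a * Poly_Mapping.lookup f m' else 0)"
    by (simp add: lookup_sum lookup_single when_def eq_commute)
  then show ?thesis by (simp add: in_keys_iff)
qed

lemma lookup_Const_mult: "Poly_Mapping.lookup (Const a * f) m = a * Poly_Mapping.lookup f m"
  using lookup_single_mult[of 0 a f m] by (simp add: Const_def)

lemma Const_mult_eq_0_iff: "Const a * f = 0 \<longleftrightarrow> a = 0 \<or> f = 0"
  by (auto simp: poly_mapping_eq_iff fun_eq_iff lookup_Const_mult)

lemma Var_mult_eq_0_iff: "Var v * f = 0 \<longleftrightarrow> f = 0"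
proof
  assume "Var v * f = 0"
  then have "Poly_Mapping.lookup f m = 0" for m
    using lookup_single_mult[of "Poly_Mapping.single v 1" 1 f m] by (simp add: Var_def)
  then show "f = 0"
    by (simp add: poly_mapping_eq_iff fun_eq_iff)
qed auto

section \<open>Evaluation homomorphisms\<close>

definition mono_eval :: "('v \<Rightarrow> 'r :: comm_ring_1) \<Rightarrow> ('v \<Rightarrow>\<^sub>0 nat) \<Rightarrow> 'r" where
  "mono_eval f m = (\<Prod>v\<in>Poly_Mapping.keys m. f v ^ Poly_Mapping.lookup m v)"

text \<open>The map \<open>c\<close> on coefficients is a parameter because three targets occur:
  numbers (\<open>peval\<close>), polynomials (\<open>poly_subst\<close>) and polynomials in a curve
  parameter (\<open>expand\<close>).\<close>

definition eval_poly :: "(complex \<Rightarrow> 'r :: comm_ring_1) \<Rightarrow> ('v \<Rightarrow> 'r) \<Rightarrow> 'v cpoly \<Rightarrow> 'r" where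
  "eval_poly c f p = (\<Sum>m\<in>Poly_Mapping.keys p. c (Poly_Mapping.lookup p m) * mono_eval f m)"

lemma poly_subst_eq_eval: "poly_subst = eval_poly Const"
  by (intro ext) (simp add: poly_subst_def eval_poly_def mono_eval_def)

lemma mono_eval_superset:
  assumes "finite V" "Poly_Mapping.keys m \<subseteq> V"
  shows "mono_eval f m = (\<Prod>v\<in>V. f v ^ Poly_Mapping.lookup m v)"
  unfolding mono_eval_def
  by (rule prod.mono_neutral_left) (use assms in \<open>auto simp: in_keys_iff\<close>)

lemma mono_eval_add: "mono_eval f (m + m') = mono_eval f m * mono_eval f m'"
proof -
  let ?V = "Poly_Mapping.keys m \<union> Poly_Mapping.keys m'"
  have "finite ?V" "Poly_Mapping.keys (m + m') \<subseteq> ?V" "Poly_Mapping.keys m \<subseteq> ?V" "Poly_Mapping.keys m' \<subseteq> ?V"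
    using keys_add[of m m'] by auto
  then show ?thesis
    by (simp add: mono_eval_superset[of ?V] lookup_add power_add prod.distrib)
qed

lemma mono_eval_0 [simp]: "mono_eval f 0 = 1"
  by (simp add: mono_eval_def)

context
  fixes c :: "complex \<Rightarrow> 'r :: comm_ring_1" and f :: "'v \<Rightarrow> 'r"
  assumes c: "ring_homo c"
begin

interpretation c: ring_homo c by (rule c)

lemma eval_poly_superset:
  assumes "finite M" "Poly_Mapping.keys p \<subseteq> M"
  shows "eval_poly c f p = (\<Sum>m\<in>M. c (Poly_Mapping.lookup p m) * mono_eval f m)"
  unfolding eval_poly_def
  by (rule sum.mono_neutral_left) (use assms in \<open>auto simp: in_keys_iff c.hom_zero\<close>)

lemma eval_poly_add: "eval_poly c f (p + q) = eval_poly c f p + eval_poly c f q"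
proof -
  let ?M = "Poly_Mapping.keys p \<union> Poly_Mapping.keys q"
  have "finite ?M" "Poly_Mapping.keys (p + q) \<subseteq> ?M" "Poly_Mapping.keys p \<subseteq> ?M" "Poly_Mapping.keys q \<subseteq> ?M"
    using keys_add[of p q] by auto
  then show ?thesis
    by (simp add: eval_poly_superset[of ?M] lookup_add c.hom_add ring_distribs sum.distrib)
qed

lemma eval_poly_0: "eval_poly c f 0 = 0"
  by (simp add: eval_poly_def)

lemma eval_poly_sum: "eval_poly c f (sum g A) = (\<Sum>x\<in>A. eval_poly c f (g x))"
  by (induction A rule: infinite_finite_induct) (auto simp: eval_poly_0 eval_poly_add)

lemma eval_poly_single: "eval_poly c f (Poly_Mapping.single m a) = c a * mono_eval f m"
  by (cases "a = 0") (auto simp: eval_poly_def c.hom_zero)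

lemma eval_poly_mult: "eval_poly c f (p * q) = eval_poly c f p * eval_poly c f q"
proof -
  have "p * q = (\<Sum>m\<in>Poly_Mapping.keys p. \<Sum>m'\<in>Poly_Mapping.keys q.
      Poly_Mapping.single (m + m') (Poly_Mapping.lookup p m * Poly_Mapping.lookup q m'))"
    by (subst (1) cpoly_sum_singles[of p], subst (1) cpoly_sum_singles[of q])
      (simp add: sum_product mult_single)
  then have "eval_poly c f (p * q) = (\<Sum>m\<in>Poly_Mapping.keys p. \<Sum>m'\<in>Poly_Mapping.keys q.
      c (Poly_Mapping.lookup p m * Poly_Mapping.lookup q m') * mono_eval f (m + m'))"
    by (simp only: eval_poly_sum eval_poly_single)
  then show ?thesis
    by (simp add: c.hom_mult mono_eval_add eval_poly_def sum_product mult_ac)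
qed

lemma ring_homo_eval_poly: "ring_homo (eval_poly c f)"
  by unfold_locales
    (use eval_poly_single[of 0 1] in \<open>simp_all add: eval_poly_add eval_poly_mult c.hom_one\<close>)

lemma eval_poly_Const [simp]: "eval_poly c f (Const a) = c a"
  by (simp add: Const_def eval_poly_single)

lemma eval_poly_Var [simp]: "eval_poly c f (Var v) = f v"
  by (simp add: Var_def eval_poly_single c.hom_one mono_eval_def)

end

lemma mono_eval_Var: "mono_eval Var m = Poly_Mapping.single m 1"
proof -
  have V: "Var v ^ k = Poly_Mapping.single (Poly_Mapping.single v k) 1" for v :: 'a and k
    by (induction k) (auto simp: Var_def mult_single simp flip: single_add)
  have "(\<Prod>v\<in>A. Var v ^ Poly_Mapping.lookup m v)
      = Poly_Mapping.single (\<Sum>v\<in>A. Poly_Mapping.single v (Poly_Mapping.lookup m v)) 1" for A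
    by (induction A rule: infinite_finite_induct) (auto simp: V mult_single)
  moreover have "(\<Sum>v\<in>Poly_Mapping.keys m. Poly_Mapping.single v (Poly_Mapping.lookup m v)) = m"
    by (rule poly_mapping_eqI) (auto simp: lookup_sum lookup_single when_def in_keys_iff)
  ultimately show ?thesis
    by (simp add: mono_eval_def)
qed

text \<open>Every monomial is a constant times a product of powers of variables. Identities between
  homomorphisms or derivations thereby reduce to the generators.\<close>

lemma cpoly_induct [case_names Const Var add mult]:
  fixes p :: "'v cpoly"
  assumes "\<And>a. P (Const a)" "\<And>v. P (Var v)"
    and add: "\<And>p q. P p \<Longrightarrow> P q \<Longrightarrow> P (p + q)"
    and mult: "\<And>p q. P p \<Longrightarrow> P q \<Longrightarrow> P (p * q)"
  shows "P p"
proof -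
  have P01: "P 0" "P 1"
    using assms(1)[of 0] assms(1)[of 1] by (simp_all add: Const.hom_zero Const.hom_one)
  have "P (Var v ^ k)" for v k
    by (induction k) (auto intro: P01 assms)
  then have "P (\<Prod>v\<in>A. Var v ^ Poly_Mapping.lookup m v)" for A m
    by (induction A rule: infinite_finite_induct) (auto intro: P01 mult)
  then have "P (Const a * mono_eval Var m)" for a m
    unfolding mono_eval_def by (intro mult assms(1))
  moreover have "Poly_Mapping.single m a = Const a * mono_eval Var m" for m :: "'v \<Rightarrow>\<^sub>0 nat" and a
    by (simp add: mono_eval_Var Const_def mult_single)
  ultimately have "P (Poly_Mapping.single m a)" for m a
    by simp
  then have "P (\<Sum>m\<in>A. Poly_Mapping.single m (Poly_Mapping.lookup p m))" for A
    by (induction A rule: infinite_finite_induct) (auto intro: P01 add)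
  then show ?thesis
    by (subst cpoly_sum_singles)
qed

lemma hom_eq_eval_poly:
  fixes h :: "'v cpoly \<Rightarrow> 'r :: comm_ring_1"
  assumes "ring_homo c" "ring_homo h" "\<And>a. h (Const a) = c a"
  shows "h p = eval_poly c (\<lambda>v. h (Var v)) p"
proof -
  interpret h: ring_homo h by fact
  interpret e: ring_homo "eval_poly c (\<lambda>v. h (Var v))"
    by (rule ring_homo_eval_poly) fact
  show ?thesis
    by (induction p rule: cpoly_induct)
      (simp_all add: assms h.hom_add h.hom_mult e.hom_add e.hom_mult)
qed

lemma ring_homo_id: "ring_homo (\<lambda>x. x)"
  by unfold_locales auto

abbreviation peval :: "('v \<Rightarrow> complex) \<Rightarrow> 'v cpoly \<Rightarrow> complex" where
  "peval \<equiv> eval_poly (\<lambda>a. a)"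

interpretation peval: ring_homo "peval x"
  by (rule ring_homo_eval_poly[OF ring_homo_id])

text \<open>Setting one variable to t gives a polynomial in t that vanishes identically, so each
  group of monomials with the same exponent of that variable vanishes separately. Separation of
  monomials by \<open>V\<close> is assumed only within \<open>M\<close>, a form that survives when
  \<open>M\<close> shrinks to such a group and \<open>V\<close> loses the variable.\<close>

lemma monomials_independent:
  fixes a :: "('v \<Rightarrow>\<^sub>0 nat) \<Rightarrow> complex"
  assumes "finite V" "finite M"
    and "\<And>m m'. m \<in> M \<Longrightarrow> m' \<in> M \<Longrightarrow> (\<And>v. v \<in> V \<Longrightarrow> Poly_Mapping.lookup m v = Poly_Mapping.lookup m' v) \<Longrightarrow> m = m'"
    and "\<And>y. (\<Sum>m\<in>M. a m * (\<Prod>v\<in>V. y v ^ Poly_Mapping.lookup m v)) = 0"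
    and "m \<in> M"
  shows "a m = 0"
  using assms
proof (induction V arbitrary: M m rule: finite_induct)
  case empty
  then have "M = {m}" by auto
  then show ?case using empty(3)[of "\<lambda>_. 0"] by simp
next
  case (insert v V)
  let ?lk = "\<lambda>m. Poly_Mapping.lookup m v"
  define K where "K = ?lk m"
  define S where "S = {m\<in>M. ?lk m = K}"
  have "(\<Sum>m\<in>S. a m * (\<Prod>v\<in>V. y v ^ Poly_Mapping.lookup m v)) = 0" for y
  proof -
    define b where "b = (\<lambda>k. \<Sum>m\<in>{m\<in>M. ?lk m = k}. a m * (\<Prod>v\<in>V. y v ^ Poly_Mapping.lookup m v))"
    define N where "N = Max (?lk ` M)"
    have N: "?lk m \<in> {..N}" if "m \<in> M" for m
      using that insert.prems(1) by (simp add: N_def)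
    have "(\<Sum>k\<le>N. b k * t ^ k) = 0" for t
    proof -
      have "0 = (\<Sum>m\<in>M. a m * (\<Prod>u\<in>insert v V. (y(v := t)) u ^ Poly_Mapping.lookup m u))"
        using insert.prems(3) by simp
      also have "\<dots> = (\<Sum>m\<in>M. a m * (\<Prod>u\<in>V. y u ^ Poly_Mapping.lookup m u) * t ^ ?lk m)"
      proof (rule sum.cong)
        fix m assume "m \<in> M"
        have "(\<Prod>u\<in>V. (y(v := t)) u ^ Poly_Mapping.lookup m u) = (\<Prod>u\<in>V. y u ^ Poly_Mapping.lookup m u)"
          using insert.hyps by (intro prod.cong) auto
        then show "a m * (\<Prod>u\<in>insert v V. (y(v := t)) u ^ Poly_Mapping.lookup m u) = a m * (\<Prod>u\<in>V. y u ^ Poly_Mapping.lookup m u) * t ^ ?lk m"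
          using insert.hyps by simp
      qed simp
      also have "\<dots> = (\<Sum>k\<le>N. \<Sum>m\<in>{m\<in>M. ?lk m = k}. a m * (\<Prod>u\<in>V. y u ^ Poly_Mapping.lookup m u) * t ^ ?lk m)"
        using insert.prems(1) N by (intro sum.group[symmetric]) auto
      also have "\<dots> = (\<Sum>k\<le>N. b k * t ^ k)"
        unfolding b_def sum_distrib_right by (intro sum.cong) auto
      finally show ?thesis by simp
    qed
    then have "\<forall>k\<le>N. b k = 0"
      using polyfun_eq_0[of b N] by blast
    moreover have "K \<le> N" using N[OF insert.prems(4)] by (simp add: K_def)
    ultimately show ?thesis by (simp add: b_def S_def)
  qed
  then show ?case
    using insert.prems by (intro insert.IH[of S]) (auto simp: S_def K_def intro!: insert.prems(2))
qed

lemma peval_zero_imp_zero: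
  fixes p :: "'v cpoly"
  assumes "\<And>x. peval x p = 0"
  shows "p = 0"
proof -
  define V where "V = (\<Union>m\<in>Poly_Mapping.keys p. Poly_Mapping.keys m)"
  have V: "finite V" "\<And>m. m \<in> Poly_Mapping.keys p \<Longrightarrow> Poly_Mapping.keys m \<subseteq> V"
    by (auto simp: V_def)
  have "Poly_Mapping.lookup p m = 0" if "m \<in> Poly_Mapping.keys p" for m
  proof (rule monomials_independent[where V = V and M = "Poly_Mapping.keys p"])
    fix m m' assume *: "m \<in> Poly_Mapping.keys p" "m' \<in> Poly_Mapping.keys p"
      "\<And>v. v \<in> V \<Longrightarrow> Poly_Mapping.lookup m v = Poly_Mapping.lookup m' v"
    show "m = m'"
    proof (rule poly_mapping_eqI)
      fix v
      show "Poly_Mapping.lookup m v = Poly_Mapping.lookup m' v"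
        using * V(2)[of m] V(2)[of m'] by (cases "v \<in> V") (auto simp: subset_iff simp flip: not_in_keys_iff_lookup_eq_zero, metis not_in_keys_iff_lookup_eq_zero)
    qed
  next
    fix y
    have "peval y p = (\<Sum>m\<in>Poly_Mapping.keys p. Poly_Mapping.lookup p m * (\<Prod>v\<in>V. y v ^ Poly_Mapping.lookup m v))"
      unfolding eval_poly_def by (intro sum.cong) (auto simp: mono_eval_superset[OF V])
    then show "(\<Sum>m\<in>Poly_Mapping.keys p. Poly_Mapping.lookup p m * (\<Prod>v\<in>V. y v ^ Poly_Mapping.lookup m v)) = 0"
      using assms by simp
  qed (use V that in auto)
  then show ?thesis
    by (metis in_keys_iff keys_eq_empty ex_in_conv)
qed

section \<open>Determinants over commutative rings\<close>

locale derivation =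
  fixes D :: "'a :: comm_ring_1 \<Rightarrow> 'a"
  assumes der_add: "D (x + y) = D x + D y"
    and der_mult: "D (x * y) = x * D y + D x * y"
begin

lemma der_zero: "D 0 = 0"
  using der_add[of 0 0] by simp

lemma der_one: "D 1 = 0"
  using der_mult[of 1 1] by simp

lemma der_uminus: "D (- x) = - D x"
  using der_add[of x "- x"] by (simp add: der_zero eq_neg_iff_add_eq_0 add.commute)

lemma der_diff: "D (x - y) = D x - D y"
  using der_add[of x "- y"] by (simp add: der_uminus)

lemma der_sum: "D (sum f A) = (\<Sum>x\<in>A. D (f x))"
  by (induction A rule: infinite_finite_induct) (auto simp: der_zero der_add)

lemma der_of_nat: "D (of_nat k) = 0"
  by (induction k) (auto simp: der_zero der_add der_one)

lemma der_of_int: "D (of_int k) = 0"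
  by (cases k) (auto simp: der_of_nat der_uminus der_add der_one der_diff)

lemma der_prod:
  assumes "finite A"
  shows "D (prod f A) = (\<Sum>i\<in>A. D (f i) * (\<Prod>k\<in>A - {i}. f k))"
  using assms
proof (induction A rule: finite_induct)
  case (insert a A)
  have "(\<Prod>k\<in>insert a A - {i}. f k) = f a * (\<Prod>k\<in>A - {i}. f k)" if "i \<in> A" for i
  proof -
    have "insert a A - {i} = insert a (A - {i})" using that insert by auto
    then show ?thesis using insert by simp
  qed
  moreover have "insert a A - {a} = A" using insert by auto
  ultimately show ?case
    using insert by (simp add: der_mult sum_distrib_left mult_ac add.commute)
qed (simp add: der_one)

end

text \<open>The cofactor, written as a part of the Leibniz sum so that no smaller matrices occur.
  Row expansion and differentiation of \<open>det\<close> both follow by grouping the permutations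
  by their value at \<open>i\<close>.\<close>

definition cof :: "'a :: comm_ring_1 ^ 'n ^ 'n \<Rightarrow> 'n \<Rightarrow> 'n \<Rightarrow> 'a" where
  "cof A i j = (\<Sum>p | p permutes UNIV \<and> p i = j. of_int (sign p) * (\<Prod>k\<in>UNIV - {i}. A $ k $ p k))"

lemma det_row_expansion:
  fixes A :: "'a :: comm_ring_1 ^ 'n ^ 'n"
  shows "(\<Sum>j\<in>UNIV. v $ j * cof A i j) = det (\<chi> k. if k = i then v else A $ k)"
proof -
  let ?B = "\<chi> k. if k = i then v else A $ k"
  let ?t = "\<lambda>p. of_int (sign p) * (\<Prod>k\<in>UNIV. ?B $ k $ p k)"
  have t: "?t p = v $ p i * (of_int (sign p) * (\<Prod>k\<in>UNIV - {i}. A $ k $ p k))" for p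
    by (subst prod.remove[of _ i]) (auto simp: mult_ac intro!: prod.cong)
  have "det ?B = (\<Sum>p | p permutes UNIV. ?t p)"
    by (simp add: det_def)
  also have "\<dots> = (\<Sum>j\<in>UNIV. \<Sum>p\<in>{p\<in>{p. p permutes UNIV}. p i = j}. ?t p)"
    by (intro sum.group[symmetric] finite_permutations) auto
  also have "\<dots> = (\<Sum>j\<in>UNIV. v $ j * cof A i j)"
    unfolding t cof_def sum_distrib_left by (intro sum.cong) auto
  finally show ?thesis ..
qed

lemma cof_transpose: "cof (transpose A) j i = cof (A :: 'a :: comm_ring_1 ^ 'n ^ 'n) i j"
proof -
  have "(\<Sum>p | p permutes UNIV \<and> p j = i. of_int (sign p) * (\<Prod>k\<in>UNIV - {j}. transpose A $ k $ p k))
      = (\<Sum>p | p permutes UNIV \<and> p i = j. of_int (sign p) * (\<Prod>k\<in>UNIV - {i}. A $ k $ p k))"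
  proof (rule sum.reindex_bij_witness[where i = inv and j = inv])
    fix p :: "'n \<Rightarrow> 'n" assume "p \<in> {p. p permutes UNIV \<and> p j = i}"
    then have p: "p permutes UNIV" "p j = i" by auto
    note inv_p = permutes_inverses[OF p(1)]
    have j: "inv p i = j" using p(2) inv_p(2) by metis
    show "inv (inv p) = p" using p(1) by (rule permutes_inv_inv)
    show "inv p \<in> {p. p permutes UNIV \<and> p i = j}"
      using p j by (simp add: permutes_inv)
    have "(\<Prod>k\<in>UNIV - {j}. transpose A $ k $ p k) = (\<Prod>k\<in>UNIV - {i}. A $ k $ inv p k)"
    proof (rule prod.reindex_bij_witness[where i = "inv p" and j = p])
      fix k assume "k \<in> UNIV - {j}"
      then show "p k \<in> UNIV - {i}" using inv_p j by (metis DiffE DiffI UNIV_I singleton_iff)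
    next
      fix k assume "k \<in> UNIV - {i}"
      then show "inv p k \<in> UNIV - {j}" using inv_p p(2) by (metis DiffE DiffI UNIV_I singleton_iff)
    qed (simp_all add: inv_p Finite_Cartesian_Product.transpose_def)
    then show "of_int (sign (inv p)) * (\<Prod>k\<in>UNIV - {i}. A $ k $ inv p k)
        = of_int (sign p) * (\<Prod>k\<in>UNIV - {j}. transpose A $ k $ p k)"
      using p by (simp add: sign_inverse permutes_imp_permutation[OF finite_class.finite_UNIV])
  next
    fix p :: "'n \<Rightarrow> 'n" assume "p \<in> {p. p permutes UNIV \<and> p i = j}"
    then have p: "p permutes UNIV" "p i = j" by auto
    have "inv p j = i" using p(2) permutes_inverses[OF p(1)] by metis
    then show "inv (inv p) = p" "inv p \<in> {p. p permutes UNIV \<and> p j = i}"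
      using p by (simp_all add: permutes_inv permutes_inv_inv)
  qed
  then show ?thesis by (simp add: cof_def)
qed

lemma cof_row: "(\<Sum>j\<in>UNIV. A $ k $ j * cof A i j) = (if k = i then det A else 0)"
  for A :: "'a :: comm_ring_1 ^ 'n ^ 'n"
proof -
  have "det (\<chi> r. if r = i then A $ k else A $ r) = (if k = i then det A else 0)"
  proof (cases "k = i")
    case True
    then have "(\<chi> r. if r = i then A $ k else A $ r) = A" by (simp add: vec_eq_iff)
    then show ?thesis using True by simp
  next
    case False
    have "det (\<chi> r. if r = i then A $ k else A $ r) = 0"
      by (rule det_identical_rows[of i k]) (use False in \<open>auto simp: row_def vec_eq_iff\<close>)
    then show ?thesis using False by simp
  qed
  then show ?thesis by (simp add: det_row_expansion)
qed

lemma cof_column: "(\<Sum>i\<in>UNIV. A $ i $ k * cof A i j) = (if k = j then det A else 0)"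
  for A :: "'a :: comm_ring_1 ^ 'n ^ 'n"
  using cof_row[of "transpose A" k j]
  by (simp only: cof_transpose det_transpose) (simp add: Finite_Cartesian_Product.transpose_def)

text \<open>Jacobi's formula for an arbitrary derivation; it is applied to the bracket with a fixed
  second argument.\<close>

lemma (in derivation) der_det:
  "D (det A) = (\<Sum>i\<in>UNIV. \<Sum>j\<in>UNIV. cof A i j * D (A $ i $ j))"
proof -
  let ?c = "\<lambda>p i. of_int (sign p) * (\<Prod>k\<in>UNIV - {i}. A $ k $ p k)"
  have "D (det A) = (\<Sum>p | p permutes UNIV. \<Sum>i\<in>UNIV. ?c p i * D (A $ i $ p i))"
    by (simp add: det_def der_sum der_mult der_of_int der_prod sum_distrib_left mult_ac)
  also have "\<dots> = (\<Sum>i\<in>UNIV. \<Sum>p | p permutes UNIV. ?c p i * D (A $ i $ p i))"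
    by (rule sum.swap)
  also have "\<dots> = (\<Sum>i\<in>UNIV. \<Sum>j\<in>UNIV. cof A i j * D (A $ i $ j))"
  proof (rule sum.cong)
    fix i
    have "(\<Sum>p | p permutes UNIV. ?c p i * D (A $ i $ p i))
        = (\<Sum>j\<in>UNIV. \<Sum>p\<in>{p\<in>{p. p permutes UNIV}. p i = j}. ?c p i * D (A $ i $ p i))"
      by (intro sum.group[symmetric] finite_permutations) auto
    also have "\<dots> = (\<Sum>j\<in>UNIV. cof A i j * D (A $ i $ j))"
      unfolding cof_def sum_distrib_right by (intro sum.cong) auto
    finally show "(\<Sum>p | p permutes UNIV. ?c p i * D (A $ i $ p i)) = (\<Sum>j\<in>UNIV. cof A i j * D (A $ i $ j))" .
  qed simp
  finally show ?thesis .
qed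

text \<open>Split one row of \<open>T\<close> by linearity. The summand with row \<open>v\<close>
  repeats row \<open>k\<close> and vanishes; the other yields a factor \<open>x\<close> and leaves
  \<open>N i\<close> as an inert row. So each row of \<open>T\<close> contributes a factor.\<close>

lemma power_dvd_det_aux:
  fixes x :: "'a :: comm_ring_1" and N :: "'n :: finite \<Rightarrow> 'a ^ 'n"
  assumes "finite T" "k \<notin> T" "w k = v"
  shows "x ^ card T dvd det (\<chi> i. if i \<in> T then x *s N i + c i *s v else w i)"
  using assms
proof (induction T arbitrary: w rule: finite_induct)
  case (insert i T)
  let ?r = "\<lambda>u r. if r = i then u else if r \<in> T then x *s N r + c r *s v else w r"
  have "(\<chi> r. if r \<in> insert i T then x *s N r + c r *s v else w r) = (\<chi> r. ?r (x *s N i + c i *s v) r)"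
    by (auto simp: vec_eq_iff)
  then have "det (\<chi> r. if r \<in> insert i T then x *s N r + c r *s v else w r)
      = x * det (\<chi> r. ?r (N i) r) + c i * det (\<chi> r. ?r v r)"
    by (simp only: det_row_add[of i "\<lambda>_. x *s N i" "\<lambda>_. c i *s v"] det_row_mul[of i _ "\<lambda>_. N i"] det_row_mul[of i _ "\<lambda>_. v"])
  moreover have "det (\<chi> r. ?r v r) = 0"
    by (rule det_identical_rows[of i k]) (use insert in \<open>auto simp: row_def vec_eq_iff\<close>)
  moreover have "x ^ card T dvd det (\<chi> r. if r \<in> T then x *s N r + c r *s v else (w(i := N i)) r)"
    using insert by (intro insert.IH) auto
  moreover have "(\<chi> r. ?r (N i) r) = (\<chi> r. if r \<in> T then x *s N r + c r *s v else (w(i := N i)) r)"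
    using insert by (auto simp: vec_eq_iff)
  ultimately show ?case
    using insert by (simp add: mult_dvd_mono)
qed simp

text \<open>No row \<open>v\<close> is available at the start, which costs one factor: after
  splitting a row, either it has become \<open>v\<close> and \<open>power_dvd_det_aux\<close>
  handles all the others, or it has yielded a factor \<open>x\<close> and the induction goes
  on.\<close>

lemma power_dvd_det:
  fixes x :: "'a :: comm_ring_1" and N :: "'n :: finite \<Rightarrow> 'a ^ 'n"
  assumes "finite T"
  shows "x ^ (card T - 1) dvd det (\<chi> i. if i \<in> T then x *s N i + c i *s v else w i)"
  using assms
proof (induction T arbitrary: w rule: finite_induct)
  case (insert i T)
  let ?r = "\<lambda>u r. if r = i then u else if r \<in> T then x *s N r + c r *s v else w r"
  have "(\<chi> r. if r \<in> insert i T then x *s N r + c r *s v else w r) = (\<chi> r. ?r (x *s N i + c i *s v) r)"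
    by (auto simp: vec_eq_iff)
  then have eq: "det (\<chi> r. if r \<in> insert i T then x *s N r + c r *s v else w r)
      = x * det (\<chi> r. ?r (N i) r) + c i * det (\<chi> r. ?r v r)"
    by (simp only: det_row_add[of i "\<lambda>_. x *s N i" "\<lambda>_. c i *s v"] det_row_mul[of i _ "\<lambda>_. N i"] det_row_mul[of i _ "\<lambda>_. v"])
  have u: "(\<chi> r. ?r u r) = (\<chi> r. if r \<in> T then x *s N r + c r *s v else (w(i := u)) r)" for u
    using insert by (auto simp: vec_eq_iff)
  have "x ^ card T dvd det (\<chi> r. ?r v r)"
    unfolding u by (rule power_dvd_det_aux) (use insert in auto)
  moreover have "x ^ card T dvd x * det (\<chi> r. ?r (N i) r)"
  proof (cases "T = {}")
    case False
    then have "x ^ card T = x * x ^ (card T - 1)"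
      using insert.hyps by (simp add: power_eq_if)
    moreover have "x ^ (card T - 1) dvd det (\<chi> r. ?r (N i) r)"
      unfolding u by (rule insert.IH)
    ultimately show ?thesis
      by (simp add: mult_dvd_mono)
  qed simp
  ultimately show ?case
    using insert unfolding eq by (simp add: dvd_add)
qed simp

section \<open>Determinants of block and triangular matrices\<close>

lemma det_unit_row:
  fixes A :: "'a :: comm_ring_1 ^ 'n ^ 'n"
  assumes "\<And>k. k \<noteq> i \<Longrightarrow> A $ i $ k = 0"
  shows "det A = A $ i $ i * det (\<chi> k. if k = i then axis k 1 else A $ k)"
proof -
  have "A = (\<chi> k. if k = i then A $ i $ i *s axis i 1 else A $ k)"
    using assms by (auto simp: vec_eq_iff axis_def)
  then have "det A = det (\<chi> k. if k = i then A $ i $ i *s axis i 1 else A $ k)" by simp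
  also have "\<dots> = A $ i $ i * det (\<chi> k. if k = i then axis i 1 else A $ k)"
    by (rule det_row_mul)
  also have "(\<chi> k. if k = i then axis i 1 else A $ k) = (\<chi> k. if k = i then axis k 1 else A $ k)"
    by (auto simp: vec_eq_iff)
  finally show ?thesis .
qed

lemma det_two_rows:
  fixes A :: "'a :: comm_ring_1 ^ 'n ^ 'n"
  assumes "i \<noteq> j" "\<And>k. k \<noteq> i \<Longrightarrow> k \<noteq> j \<Longrightarrow> A $ i $ k = 0" "\<And>k. k \<noteq> i \<Longrightarrow> k \<noteq> j \<Longrightarrow> A $ j $ k = 0"
  shows "det A = (A $ i $ i * A $ j $ j - A $ i $ j * A $ j $ i)
    * det (\<chi> k. if k = i \<or> k = j then axis k 1 else A $ k)"
proof -
  define E where "E u w = (\<chi> k. if k = i then u else if k = j then w else A $ k)" for u w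
  have add_i: "det (E (a *s u + b *s u') w) = a * det (E u w) + b * det (E u' w)" for a b u u' w
    unfolding E_def
    by (simp only: det_row_add[of i "\<lambda>_. a *s u" "\<lambda>_. b *s u'"] det_row_mul[of i _ "\<lambda>_. u"] det_row_mul[of i _ "\<lambda>_. u'"])
  have swap: "det (E u w) = - det (E w u)" for u w
  proof -
    have "(\<chi> k. E w u $ (Transposition.transpose i j k)) = E u w"
      using assms(1) by (auto simp: E_def vec_eq_iff Transposition.transpose_def)
    then show ?thesis
      using det_permute_rows[of "Transposition.transpose i j" "E w u"] assms(1)
      by (simp add: sign_swap_id permutes_swap_id)
  qed
  have add_j: "det (E w (a *s u + b *s u')) = a * det (E w u) + b * det (E w u')" for a b u u' w
    unfolding swap[of w] add_i by simp
  have same: "det (E u u) = 0" for u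
    by (rule det_identical_rows[of i j]) (use assms(1) in \<open>auto simp: E_def row_def vec_eq_iff\<close>)
  let ?e = "\<lambda>k. axis k 1 :: 'a ^ 'n"
  have "A = E (A $ i $ i *s ?e i + A $ i $ j *s ?e j) (A $ j $ i *s ?e i + A $ j $ j *s ?e j)"
    using assms by (auto simp: vec_eq_iff axis_def E_def)
  then have "det A = det (E (A $ i $ i *s ?e i + A $ i $ j *s ?e j) (A $ j $ i *s ?e i + A $ j $ j *s ?e j))"
    by simp
  also have "\<dots> = (A $ i $ i * A $ j $ j - A $ i $ j * A $ j $ i) * det (E (?e i) (?e j))"
    unfolding add_i add_j same swap[of "?e j" "?e i"] by (simp add: algebra_simps)
  also have "E (?e i) (?e j) = (\<chi> k. if k = i \<or> k = j then axis k 1 else A $ k)"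
    by (auto simp: E_def vec_eq_iff)
  finally show ?thesis .
qed

text \<open>The determinant of the diagonal block on the orbit of \<open>i\<close> under
  \<open>s\<close>.\<close>

definition blk :: "('n \<Rightarrow> 'n) \<Rightarrow> 'a :: comm_ring_1 ^ 'n ^ 'n \<Rightarrow> 'n \<Rightarrow> 'a" where
  "blk s A i = (if s i = i then A $ i $ i else A $ i $ i * A $ s i $ s i - A $ i $ s i * A $ s i $ i)"

text \<open>One orbit at a time, the rows of \<open>i\<close> and \<open>s i\<close> are replaced by
  unit vectors and their block is split off, until the identity matrix is left. The condition
  \<open>i \<le> s i\<close> picks one representative per orbit.\<close>

lemma det_involution_blocks:
  fixes A :: "'a :: comm_ring_1 ^ ('n :: {finite, linorder}) ^ ('n :: {finite, linorder})"
  assumes s: "\<And>i. s (s i) = i" and A: "\<And>i j. j \<noteq> i \<Longrightarrow> j \<noteq> s i \<Longrightarrow> A $ i $ j = 0"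
  shows "det A = (\<Prod>i | i \<le> s i. blk s A i)"
proof -
  let ?E = "\<lambda>T. \<chi> k. if k \<in> T \<or> s k \<in> T then axis k 1 else A $ k"
  have "T \<subseteq> {i. i \<le> s i} \<Longrightarrow> det A = (\<Prod>i\<in>T. blk s A i) * det (?E T)" if "finite T" for T
    using that
  proof (induction T rule: finite_induct)
    case empty
    then show ?case by (simp add: vec_lambda_eta)
  next
    case (insert i T)
    have i: "i \<notin> T" "s i \<notin> T"
    proof -
      show "s i \<notin> T"
      proof
        assume "s i \<in> T"
        then have "s i \<le> s (s i)" "i \<le> s i" using insert by auto
        then have "s i = i" by (simp add: s)
        then show False using \<open>s i \<in> T\<close> insert by simp
      qed
    qed fact
    have s_inj: "s k = i \<longleftrightarrow> k = s i" for k using s by metis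
    have "det (?E T) = blk s A i * det (?E (insert i T))"
    proof (cases "s i = i")
      case True
      have "det (?E T) = ?E T $ i $ i * det (\<chi> k. if k = i then axis k 1 else ?E T $ k)"
        by (rule det_unit_row) (use A i True in auto)
      also have "(\<chi> k. if k = i then axis k 1 else ?E T $ k) = ?E (insert i T)"
        using i by (auto simp: vec_eq_iff s_inj True)
      finally show ?thesis using True i by (simp add: blk_def)
    next
      case False
      have "det (?E T) = (?E T $ i $ i * ?E T $ s i $ s i - ?E T $ i $ s i * ?E T $ s i $ i)
          * det (\<chi> k. if k = i \<or> k = s i then axis k 1 else ?E T $ k)"
        by (rule det_two_rows) (use A i False in \<open>auto simp: s\<close>)
      also have "(\<chi> k. if k = i \<or> k = s i then axis k 1 else ?E T $ k) = ?E (insert i T)"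
        using i by (auto simp: vec_eq_iff s_inj)
      finally show ?thesis using False i by (simp add: blk_def s)
    qed
    then show ?case using insert by simp
  qed
  from this[of "{i. i \<le> s i}"]
  have "det A = (\<Prod>i | i \<le> s i. blk s A i) * det (?E {i. i \<le> s i})" by simp
  moreover have "?E {i. i \<le> s i} = mat 1"
  proof -
    have "k \<le> s k \<or> s k \<le> s (s k)" for k
      using linear[of k "s k"] by (simp add: s)
    then show ?thesis by (auto simp: vec_eq_iff mat_def axis_def)
  qed
  ultimately show ?thesis by simp
qed

text \<open>Only the identity contributes to the Leibniz sum: a permutation with
  \<open>i \<le> p i\<close> throughout and one strict inequality would increase the sum of the
  ranks \<open>ix\<close>, which every permutation preserves.\<close>

lemma det_unitriangular:
  fixes A :: "'a :: comm_ring_1 ^ ('n :: {finite, linorder}) ^ ('n :: {finite, linorder})"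
  assumes "\<And>i j. j < i \<Longrightarrow> A $ i $ j = 0" "\<And>i. A $ i $ i = 1"
  shows "det A = 1"
proof -
  define ix where "ix k = card {j. j < k}" for k :: 'n
  have ix: "ix a < ix b" if "a < b" for a b
    unfolding ix_def by (rule psubset_card_mono) (use that in auto)
  have *: "p = id" if p: "p permutes UNIV" and ge: "\<And>i. i \<le> p i" for p :: "'n \<Rightarrow> 'n"
  proof (rule ccontr)
    assume "p \<noteq> id"
    then obtain i where i: "i < p i" using ge by (metis eq_id_iff order_le_less)
    have "ix k \<le> ix (p k)" for k
      using ge[of k] ix[of k "p k"] unfolding order_le_less[of k] order_le_less[of "ix k"] by metis
    moreover have "ix i < ix (p i)"
      using i by (rule ix)
    ultimately have "(\<Sum>i\<in>UNIV. ix i) < (\<Sum>i\<in>UNIV. ix (p i))"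
      by (intro sum_strict_mono_ex1) auto
    moreover have "(\<Sum>i\<in>UNIV. ix (p i)) = (\<Sum>i\<in>UNIV. ix i)"
      using sum.permute[OF p, of ix] by (simp add: comp_def)
    ultimately show False by simp
  qed
  have zero: "(\<Prod>i\<in>UNIV. A $ i $ p i) = 0" if p: "p permutes UNIV" "p \<noteq> id" for p
  proof -
    obtain i where "p i < i" using * p by (meson not_le)
    then have "A $ i $ p i = 0" by (rule assms(1))
    then show ?thesis by (intro prod_zero) auto
  qed
  have "det A = (\<Sum>p :: 'n \<Rightarrow> 'n | p permutes UNIV. if p = id then 1 else 0)"
    unfolding det_def by (rule sum.cong) (auto simp: assms zero sign_id)
  then show ?thesis
    by (simp add: finite_permutations permutes_id)
qed

section \<open>Coefficients of the quadratic bracket\<close>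

lemma Const_eps: "Const (eps i j) = eps i j"
  by (simp add: eps_def Const.hom_one Const.hom_zero Const.hom_uminus)

definition cf :: "'a :: zero fls fls \<Rightarrow> int \<Rightarrow> int \<Rightarrow> 'a" where
  "cf h k m = fls_nth (fls_nth h k) m"

lemma cf_simps:
  fixes f g :: "'a :: comm_ring_1 fls fls"
  shows "cf (f + g) k m = cf f k m + cf g k m"
    and "cf (f - g) k m = cf f k m - cf g k m"
    and "cf (lam * f) k m = cf f (k + 1) m"
    and "cf (mu * f) k m = cf f k (m + 1)"
  by (simp_all add: cf_def fls_X_inv_times_conv_shift)

lemma cf_eps: "cf (eps i j * f) k m = eps i j * cf (f :: 'a :: comm_ring_1 fls fls) k m"
  by (simp add: eps_def cf_def)

text \<open>With integer indices and zeros below 0, multiplication by \<open>lam\<close> or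
  \<open>mu\<close> is a plain index shift without boundary cases.\<close>

definition ext :: "(nat \<Rightarrow> 'a :: zero) \<Rightarrow> int \<Rightarrow> 'a" where
  "ext g k = (if k < 0 then 0 else g (nat k))"

lemma cf_series:
  "cf (series_lam f * series_mu g) k m = ext f k * ext (g :: nat \<Rightarrow> 'a :: comm_ring_1) m"
  "cf (series_lam_mu h) k m = (if k < 0 \<or> m < 0 then 0 else h (nat k) (nat m))"
  by (auto simp: cf_def series_lam_def series_mu_def series_lam_mu_def ext_def)

text \<open>The coefficients of $(\lambda-\mu)(1-\lambda\mu)h$, $(\lambda+\mu)(1-\lambda\mu)h$ and
  $(\lambda-\mu)(1+\lambda\mu)h$ in terms of those of $h$.\<close>

definition opU :: "(int \<Rightarrow> int \<Rightarrow> 'a :: comm_ring_1) \<Rightarrow> int \<Rightarrow> int \<Rightarrow> 'a" where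
  "opU q k m = q (k + 1) m - q k (m + 1) - q (k + 2) (m + 1) + q (k + 1) (m + 2)"

definition opV :: "(int \<Rightarrow> int \<Rightarrow> 'a :: comm_ring_1) \<Rightarrow> int \<Rightarrow> int \<Rightarrow> 'a" where
  "opV q k m = q (k + 1) m + q k (m + 1) - q (k + 2) (m + 1) - q (k + 1) (m + 2)"

definition opW :: "(int \<Rightarrow> int \<Rightarrow> 'a :: comm_ring_1) \<Rightarrow> int \<Rightarrow> int \<Rightarrow> 'a" where
  "opW q k m = q (k + 1) m - q k (m + 1) + q (k + 2) (m + 1) - q (k + 1) (m + 2)"

lemma cf_op:
  fixes h :: "'a :: comm_ring_1 fls fls"
  shows "cf ((lam - mu) * (1 - lam * mu) * h) k m = opU (cf h) k m"
    and "cf ((lam + mu) * (1 - lam * mu) * h) k m = opV (cf h) k m"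
    and "cf ((lam - mu) * (1 + lam * mu) * h) k m = opW (cf h) k m"
proof -
  have "(lam - mu) * (1 - lam * mu) * h = lam * h - mu * h - lam * (lam * (mu * h)) + lam * (mu * (mu * h))"
    and "(lam + mu) * (1 - lam * mu) * h = lam * h + mu * h - lam * (lam * (mu * h)) - lam * (mu * (mu * h))"
    and "(lam - mu) * (1 + lam * mu) * h = lam * h - mu * h + lam * (lam * (mu * h)) - lam * (mu * (mu * h))"
    by (simp_all add: algebra_simps)
  then show "cf ((lam - mu) * (1 - lam * mu) * h) k m = opU (cf h) k m"
    and "cf ((lam + mu) * (1 - lam * mu) * h) k m = opV (cf h) k m"
    and "cf ((lam - mu) * (1 + lam * mu) * h) k m = opW (cf h) k m"
    by (simp_all add: cf_simps opU_def opV_def opW_def add.assoc)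
qed

text \<open>Each coefficient of the quadratic bracket combines the three products behind
  \<open>opU\<close>, \<open>opV\<close> and \<open>opW\<close>. The second identity also exchanges
  \<open>G\<close> and \<open>G'\<close>, since there the series in \<mu> comes first, while
  \<open>cf_series\<close> expects the series in \<lambda> first.\<close>

lemma opUVW_factor:
  fixes L M e G G' :: "'a :: comm_ring_1"
  shows "(1 - L * M) * (e * (L - M) - (L + M)) * G * G'
      = e * ((L - M) * (1 - L * M) * (G * G')) - (L + M) * (1 - L * M) * (G * G')"
    and "(1 - L * M) * (e * (L - M) + (L + M)) * G * G'
      = e * ((L - M) * (1 - L * M) * (G' * G)) + (L + M) * (1 - L * M) * (G' * G)"
    and "(L - M) * (e * (1 - L * M) - (1 + L * M)) * G * G'
      = e * ((L - M) * (1 - L * M) * (G * G')) - (L - M) * (1 + L * M) * (G * G')"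
    and "(L - M) * (e * (1 - L * M) + (1 + L * M)) * G * G'
      = e * ((L - M) * (1 - L * M) * (G * G')) + (L - M) * (1 + L * M) * (G * G')"
  by (simp_all add: algebra_simps)

text \<open>The quadratic bracket on coefficients, for an arbitrary family \<open>g\<close> and
  bracket \<open>P\<close>, so that it can be carried from the generators of the first algebra to
  the series \<open>gco\<close> and on to the coefficients \<open>Mco\<close> of M.\<close>

definition quadratic_relation ::
  "('n :: linorder) \<Rightarrow> 'n \<Rightarrow> 'n \<Rightarrow> 'n \<Rightarrow> ('n \<Rightarrow> 'n \<Rightarrow> int \<Rightarrow> 'a :: comm_ring_1) \<Rightarrow> ('a \<Rightarrow> 'a \<Rightarrow> 'a) \<Rightarrow> bool" where
  "quadratic_relation j i p l g P \<longleftrightarrow> (\<forall>k m.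
    opU (\<lambda>k m. P (g j i k) (g p l m)) k m =
      eps j p * opU (\<lambda>k m. g p i k * g j l m) k m - opV (\<lambda>k m. g p i k * g j l m) k m
    + (eps i l * opU (\<lambda>k m. g j l k * g p i m) k m + opV (\<lambda>k m. g j l k * g p i m) k m)
    + (eps i p * opU (\<lambda>k m. g j p k * g i l m) k m - opW (\<lambda>k m. g j p k * g i l m) k m)
    + (eps j l * opU (\<lambda>k m. g l i k * g p j m) k m + opW (\<lambda>k m. g l i k * g p j m) k m))"

lemma is_poisson_bracket_0:
  assumes "is_poisson_bracket P"
  shows "P 0 f = 0" "P f 0 = 0"
proof -
  have "P 0 f = P 0 f + P 0 f" for f
    using assms unfolding is_poisson_bracket_def by (metis add_0)
  then show "P 0 f = 0" for f by simp
  then show "P f 0 = 0"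
    using assms unfolding is_poisson_bracket_def by (metis minus_zero)
qed

lemma frakD_quadratic_relation:
  assumes "is_frakD_bracket P"
  shows "quadratic_relation j i p l (\<lambda>a b. ext (frakD_coeff a b)) P"
  unfolding quadratic_relation_def
proof (intro allI)
  fix k m :: int
  let ?g = "\<lambda>a b. ext (frakD_coeff a b)"
  let ?b = "series_lam_mu (\<lambda>k m. P (frakD_coeff j i k) (frakD_coeff p l m))"
  let ?Gl = "\<lambda>a b :: 'a. series_lam (frakD_coeff a b)" and ?Gm = "\<lambda>a b :: 'a. series_mu (frakD_coeff a b)"
  let ?u = "\<lambda>h. (lam - mu) * (1 - lam * mu) * h" and ?v = "\<lambda>h. (lam + mu) * (1 - lam * mu) * h"
    and ?w = "\<lambda>h. (lam - mu) * (1 + lam * mu) * h"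
  have P: "is_poisson_bracket P"
    using assms by (simp add: is_frakD_bracket_def)
  have b: "cf ?b = (\<lambda>k m. P (?g j i k) (?g p l m))"
    by (intro ext) (simp add: cf_series ext_def is_poisson_bracket_0[OF P])
  have q: "cf (?Gl a b * ?Gm c d) = (\<lambda>k m. ?g a b k * ?g c d m)" for a b c d
    by (intro ext) (simp add: cf_series)
  have "?u ?b
       = (1 - lam * mu) * (eps j p * (lam - mu) - (lam + mu)) * ?Gl p i * ?Gm j l
       + (1 - lam * mu) * (eps i l * (lam - mu) + (lam + mu)) * ?Gm p i * ?Gl j l
       + (lam - mu) * (eps i p * (1 - lam * mu) - (1 + lam * mu)) * ?Gl j p * ?Gm i l
       + (lam - mu) * (eps j l * (1 - lam * mu) + (1 + lam * mu)) * ?Gl l i * ?Gm p j"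
    using assms by (simp add: is_frakD_bracket_def Let_def)
  also have "\<dots> = eps j p * ?u (?Gl p i * ?Gm j l) - ?v (?Gl p i * ?Gm j l)
      + (eps i l * ?u (?Gl j l * ?Gm p i) + ?v (?Gl j l * ?Gm p i))
      + (eps i p * ?u (?Gl j p * ?Gm i l) - ?w (?Gl j p * ?Gm i l))
      + (eps j l * ?u (?Gl l i * ?Gm p j) + ?w (?Gl l i * ?Gm p j))"
    by (simp only: opUVW_factor)
  finally have "cf (?u ?b) k m = cf \<dots> k m" by simp
  then show "opU (\<lambda>k m. P (?g j i k) (?g p l m)) k m =
      eps j p * opU (\<lambda>k m. ?g p i k * ?g j l m) k m - opV (\<lambda>k m. ?g p i k * ?g j l m) k m
    + (eps i l * opU (\<lambda>k m. ?g j l k * ?g p i m) k m + opV (\<lambda>k m. ?g j l k * ?g p i m) k m)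
    + (eps i p * opU (\<lambda>k m. ?g j p k * ?g i l m) k m - opW (\<lambda>k m. ?g j p k * ?g i l m) k m)
    + (eps j l * opU (\<lambda>k m. ?g l i k * ?g p j m) k m + opW (\<lambda>k m. ?g l i k * ?g p j m) k m)"
    by (simp only: cf_simps cf_eps cf_op b q)
qed

lemma quadratic_relation_hom:
  assumes "ring_homo h" and "\<And>x y. h (P x y) = B (h x) (h y)"
    and "quadratic_relation j i p l g P"
  shows "quadratic_relation j i p l (\<lambda>a b k. h (g a b k)) B"
proof -
  interpret h: ring_homo h by fact
  have eps: "h (eps a b) = eps a b" for a b :: 'c
    by (simp add: eps_def h.hom_one h.hom_zero h.hom_uminus)
  have h: "h (opU q k m) = opU (\<lambda>k m. h (q k m)) k m"
    "h (opV q k m) = opV (\<lambda>k m. h (q k m)) k m" "h (opW q k m) = opW (\<lambda>k m. h (q k m)) k m" for q k m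
    by (simp_all add: opU_def opV_def opW_def h.hom_add h.hom_diff)
  show ?thesis
    unfolding quadratic_relation_def
  proof (intro allI)
    fix k m
    have "h (opU (\<lambda>k m. P (g j i k) (g p l m)) k m) = h (
      eps j p * opU (\<lambda>k m. g p i k * g j l m) k m - opV (\<lambda>k m. g p i k * g j l m) k m
    + (eps i l * opU (\<lambda>k m. g j l k * g p i m) k m + opV (\<lambda>k m. g j l k * g p i m) k m)
    + (eps i p * opU (\<lambda>k m. g j p k * g i l m) k m - opW (\<lambda>k m. g j p k * g i l m) k m)
    + (eps j l * opU (\<lambda>k m. g l i k * g p j m) k m + opW (\<lambda>k m. g l i k * g p j m) k m))"
      using assms(3) by (simp add: quadratic_relation_def)
    then show "opU (\<lambda>k m. B (h (g j i k)) (h (g p l m))) k m =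
      eps j p * opU (\<lambda>k m. h (g p i k) * h (g j l m)) k m - opV (\<lambda>k m. h (g p i k) * h (g j l m)) k m
    + (eps i l * opU (\<lambda>k m. h (g j l k) * h (g p i m)) k m + opV (\<lambda>k m. h (g j l k) * h (g p i m)) k m)
    + (eps i p * opU (\<lambda>k m. h (g j p k) * h (g i l m)) k m - opW (\<lambda>k m. h (g j p k) * h (g i l m)) k m)
    + (eps j l * opU (\<lambda>k m. h (g l i k) * h (g p j m)) k m + opW (\<lambda>k m. h (g l i k) * h (g p j m)) k m)"
      by (simp only: h h.hom_add h.hom_diff h.hom_mult eps assms(2))
  qed
qed

section \<open>The reduction\<close>

lemma Const_eq_0_iff: "Const a = 0 \<longleftrightarrow> a = 0"
  by (metis Const_mult_eq_0_iff mult_1_right zero_neq_one)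

lemma nth_fls_Const [simp]: "fls_nth (fls_Const f) k = Const (fls_nth f k)"
  unfolding fls_Const_def
  by (rule nth_Abs_fls_lower_bound[of "fls_subdegree f"]) (auto simp: Const.hom_zero)

lemma fls_subdegree_fls_Const: "fls_subdegree (fls_Const f :: 'v cpoly fls) = fls_subdegree f"
proof (cases "f = 0")
  case True
  have "(fls_Const f :: 'v cpoly fls) = 0" by (rule fls_zero_eqI) (simp add: True Const.hom_zero)
  then show ?thesis using True by simp
next
  case False
  then show ?thesis
    by (intro fls_subdegree_eqI) (auto simp: Const_eq_0_iff)
qed

lemma fls_Const_mult: "fls_Const (f * g) = fls_Const f * fls_Const g"
  by (rule fls_eqI) (simp add: fls_times_nth(2) fls_subdegree_fls_Const Const.hom_sum Const.hom_mult)

definition Mco :: "'n \<Rightarrow> 'n \<Rightarrow> int \<Rightarrow> ('n :: {finite, linorder} \<times> 'n) cpoly" where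
  "Mco i j k = fls_nth (Mhat $ i $ j) k"

lemma fls_X_inv_times_nth:
  fixes f :: "'a :: comm_ring_1 fls"
  shows "fls_nth (lam * f) k = fls_nth f (k + 1)" "fls_nth (fls_X * f) k = fls_nth f (k - 1)"
    "fls_nth (lam ^ m * f) k = fls_nth f (k + int m)"
  by (simp_all add: fls_X_inv_times_conv_shift fls_X_times_conv_shift fls_X_inv_power_times_conv_shift)

lemma Mco_eq:
  "Mco i j k = (if k = - 2 then Ahat $ i $ j
    else if k = - 1 then Rhat $ i $ j + Shat $ i $ j - Ahat $ j $ i
    else if k = 0 then Shat $ i $ j - Rhat $ i $ j - Ahat $ i $ j
    else if k = 1 then Ahat $ j $ i else 0)"
proof -
  have "Mhat $ i $ j = (lam * fls_const (Rhat $ i $ j) - fls_const (Rhat $ i $ j))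
      + (lam * fls_const (Shat $ i $ j) + fls_const (Shat $ i $ j))
      + (lam ^ 2 * fls_const (Ahat $ i $ j) - fls_const (Ahat $ i $ j))
      - (lam * fls_const (Ahat $ j $ i) - fls_X * fls_const (Ahat $ j $ i))"
    by (simp only: Mhat_def vec_lambda_beta Finite_Cartesian_Product.transpose_def ring_distribs mult_1)
  then show ?thesis
    by (simp add: Mco_def fls_X_inv_times_nth del: fls_mult_const_nth)
qed

definition gco :: "complex \<Rightarrow> 'n \<Rightarrow> 'n \<Rightarrow> int \<Rightarrow> ('n :: {finite, linorder} \<times> 'n) cpoly" where
  "gco Ph i j k = fls_nth (fls_Const (prefactor Ph) * Mhat $ i $ j) k"

text \<open>The denominator of the prefactor is
  $\lambda^3-(1+\varrho)\lambda^2+(1+\varrho)\lambda-1$ with $\varrho=e^{P_h}+e^{-P_h}$.\<close>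

definition kap :: "complex \<Rightarrow> nat \<Rightarrow> complex" where
  "kap Ph a = (let r = exp Ph + exp (- Ph) in
     if a = 0 then - 1 else if a = 1 then 1 + r else if a = 2 then - (1 + r) else 1)"

lemma prefactor_mult:
  "prefactor Ph * (lam ^ 3 - fls_const (1 + (exp Ph + exp (- Ph))) * lam ^ 2
     + fls_const (1 + (exp Ph + exp (- Ph))) * lam - 1) = lam"
proof -
  let ?e = "fls_const (exp Ph)" and ?f = "fls_const (exp (- Ph))"
  let ?K = "(lam - 1) * (?f * lam - 1) * (?e * lam - 1) :: complex fls"
  have ef: "?e * ?f = 1"
    by (simp add: exp_minus)
  have "?K = ?e * ?f * lam ^ 3 - (?e * ?f + ?e + ?f) * lam ^ 2 + (1 + ?e + ?f) * lam - 1"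
    by (simp add: algebra_simps power2_eq_square power3_eq_cube)
  then have K: "?K = lam ^ 3 - fls_const (1 + (exp Ph + exp (- Ph))) * lam ^ 2
     + fls_const (1 + (exp Ph + exp (- Ph))) * lam - 1"
    unfolding ef by (simp flip: fls_plus_const add: algebra_simps)
  have "fls_nth ?K (- 3) = 1"
    unfolding K by (simp add: fls_X_inv_power_times_conv_shift)
  then have "?K \<noteq> 0" by (metis fls_zero_nth zero_neq_one)
  then show ?thesis
    unfolding K[symmetric] prefactor_def by simp
qed

text \<open>Clearing the denominator expresses the finitely many coefficients of M through the
  infinite series. The shift \<open>k + 1\<close> is due to the numerator \<lambda> of the
  prefactor.\<close>

lemma Mco_gco: "Mco i j (k + 1) = (\<Sum>a<4. Const (kap Ph a) * gco Ph i j (k + int a))"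
proof -
  let ?r = "1 + (exp Ph + exp (- Ph))"
  let ?K = "lam ^ 3 - fls_const ?r * lam ^ 2 + fls_const ?r * lam - 1 :: complex fls"
  let ?g = "fls_Const (prefactor Ph) * Mhat $ i $ j"
  have K: "fls_Const ?K = lam ^ 3 - fls_const (Const ?r) * lam ^ 2 + fls_const (Const ?r) * lam - 1"
    by (rule fls_eqI) (simp add: Const.hom_diff Const.hom_add Const.hom_one Const.hom_zero)
  have "fls_Const ?K * ?g = fls_Const (prefactor Ph * ?K) * Mhat $ i $ j"
    by (simp only: fls_Const_mult mult_ac)
  also have "fls_Const (prefactor Ph * ?K) = fls_Const lam"
    by (simp only: prefactor_mult)
  also have "fls_Const lam = lam"
    by (rule fls_eqI) (simp add: Const.hom_one Const.hom_zero)
  finally have "fls_nth (lam * Mhat $ i $ j) k = fls_nth (fls_Const ?K * ?g) k" by simp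
  also have "\<dots> = fls_nth ?g (k + 3) - Const ?r * fls_nth ?g (k + 2) + Const ?r * fls_nth ?g (k + 1) - fls_nth ?g k"
    unfolding K by (simp add: left_diff_distrib distrib_right mult.assoc fls_X_inv_times_nth)
  finally show ?thesis
    by (simp add: Mco_def gco_def fls_X_inv_times_nth numeral_eq_Suc kap_def Const.hom_one Const.hom_uminus
        Const.hom_add Const.hom_diff algebra_simps)
qed

text \<open>The leading coefficient \<open>kap Ph 3\<close> is 1, so \<open>Mco_gco\<close> is a
  recursion upwards from the subdegree, and it starts with A at index 0. Hence the reduction
  respects the conventions built into \<open>frakD_coeff\<close> at \<open>k = 0\<close> and into
  \<open>ext\<close> below 0.\<close>

lemma gco_below: 
  assumes "k \<le> 0"
  shows "gco Ph i j k = (if k = 0 then Ahat $ i $ j else 0)"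
proof -
  define N where "N = fls_subdegree (fls_Const (prefactor Ph) * Mhat $ i $ j)"
  have rec: "gco Ph i j k = Mco i j (k - 2)" if "\<And>l. l < k \<Longrightarrow> gco Ph i j l = 0" for k
    using Mco_gco[of i j "k - 3" Ph] that[of "k - 1"] that[of "k - 2"] that[of "k - 3"]
    by (simp add: numeral_eq_Suc kap_def Const.hom_one)
  have below: "gco Ph i j k = 0" if "k < 0" for k
  proof -
    have "k < 0 \<longrightarrow> gco Ph i j k = 0" for k
    proof (induction "nat (k - N)" arbitrary: k rule: less_induct)
      case less
      show ?case
      proof (cases "k < N")
        case True
        then show ?thesis by (simp add: gco_def N_def)
      next
        case False
        have "gco Ph i j l = 0" if "l < k" "k < 0" for l
        proof -
          have "nat (l - N) < nat (k - N) \<or> l < N" using that False by linarith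
          then show ?thesis using less[of l] that by (auto simp: gco_def N_def)
        qed
        then show ?thesis using rec[of k] by (auto simp: Mco_eq)
      qed
    qed
    then show ?thesis using that by blast
  qed
  show ?thesis
    using assms below[of k] rec[of 0] below by (cases "k = 0") (auto simp: Mco_eq)
qed

lemma reduction_frakD_coeff: "reduction Ph (frakD_coeff i j k) = gco Ph i j (int k)"
proof -
  interpret r: ring_homo "reduction Ph :: 'a frakD_gen cpoly \<Rightarrow> _"
    unfolding reduction_def poly_subst_eq_eval by (rule ring_homo_eval_poly[OF ring_homo_Const])
  show ?thesis
  proof (cases "k = 0 \<and> \<not> i < j")
    case True
    then show ?thesis
      by (auto simp: frakD_coeff_def r.hom_one r.hom_zero gco_below Ahat_def)
  next
    case False
    then have "Rep_frakD_gen (Abs_frakD_gen (k, i, j)) = (k, i, j)"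
      by (intro Abs_frakD_gen_inverse) auto
    then show ?thesis
      using False by (auto simp: frakD_coeff_def reduction_def poly_subst_eq_eval ring_homo_Const gco_def)
  qed
qed

lemma reduction_ext: "reduction Ph (ext (frakD_coeff i j) k) = gco Ph i j k"
proof -
  interpret r: ring_homo "reduction Ph :: 'a frakD_gen cpoly \<Rightarrow> _"
    unfolding reduction_def poly_subst_eq_eval by (rule ring_homo_eval_poly[OF ring_homo_Const])
  show ?thesis
    by (simp add: ext_def reduction_frakD_coeff gco_below r.hom_zero)
qed

lemma gco_quadratic_relation:
  assumes "is_D_bracket Ph B"
  shows "quadratic_relation j i p l (gco Ph) B"
proof -
  obtain P where P: "is_frakD_bracket P" "is_poisson_hom P B (reduction Ph)"
    using assms by (auto simp: is_D_bracket_def)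
  have "quadratic_relation j i p l (\<lambda>a b k. reduction Ph (ext (frakD_coeff a b) k)) B"
  proof (rule quadratic_relation_hom[OF _ _ frakD_quadratic_relation[OF P(1)]])
    show "ring_homo (reduction Ph :: 'a frakD_gen cpoly \<Rightarrow> _)"
      unfolding reduction_def poly_subst_eq_eval by (rule ring_homo_eval_poly[OF ring_homo_Const])
  qed (use P(2) in \<open>auto simp: is_poisson_hom_def\<close>)
  then show ?thesis by (simp add: reduction_ext)
qed

section \<open>The bracket of the evaluated matrix\<close>

locale poisson_algebra =
  fixes B :: "'v cpoly \<Rightarrow> 'v cpoly \<Rightarrow> 'v cpoly"
  assumes poisson: "is_poisson_bracket B"
begin

lemma add_left: "B (f + g) h = B f h + B g h"
  and Const_left: "B (Const a * f) g = Const a * B f g"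
  and skew: "B f g = - B g f"
  and mult_left: "B (f * g) h = f * B g h + B f h * g"
  and jacobi: "B f (B g h) + B g (B h f) + B h (B f g) = 0"
  using poisson unfolding is_poisson_bracket_def by blast+

lemma derivation_left: "derivation (\<lambda>f. B f h)"
  by unfold_locales (simp_all add: add_left mult_left)

lemma derivation_right: "derivation (\<lambda>f. B h f)"
proof unfold_locales
  fix x y
  show "B h (x + y) = B h x + B h y"
    unfolding skew[of h x] skew[of h y] skew[of h "x + y"] by (simp add: add_left)
  show "B h (x * y) = x * B h y + B h x * y"
    unfolding skew[of h x] skew[of h y] skew[of h "x * y"] by (simp add: mult_left)
qed

sublocale L: derivation "\<lambda>f. B f h" for h
  by (rule derivation_left)

sublocale R: derivation "\<lambda>f. B h f" for h
  by (rule derivation_right)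

lemma Const_zero: "B (Const a) f = 0" "B f (Const a) = 0"
proof -
  show "B (Const a) f = 0" for f
    using Const_left[of a 1 f] by (simp add: L.der_one)
  then show "B f (Const a) = 0"
    using skew[of f "Const a"] by simp
qed

lemma Const_right: "B f (Const a * g) = Const a * B f g"
  by (simp add: R.der_mult Const_zero)

end

text \<open>\<open>A\<close> is instantiated both by the bracket and by the product, so the two
  sides of the quadratic relation are treated alike. The bound 4 counts the coefficients of the
  cubic denominator.\<close>

lemma conv_bilinear:
  fixes A :: "'a :: comm_ring_1 \<Rightarrow> 'a \<Rightarrow> 'a"
  assumes "\<And>f g h. A (f + g) h = A f h + A g h" "\<And>f g h. A h (f + g) = A h f + A h g"
    and "\<And>a f g. A (c a * f) g = c a * A f g" "\<And>a f g. A f (c a * g) = c a * A f g"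
  shows "A (\<Sum>a<4::nat. c a * f a) (\<Sum>b<4::nat. c b * g b) = (\<Sum>a<4. \<Sum>b<4. c a * c b * A (f a) (g b))"
  by (simp add: numeral_eq_Suc assms algebra_simps)

definition conv :: "(nat \<Rightarrow> 'a) \<Rightarrow> (int \<Rightarrow> int \<Rightarrow> 'a :: comm_ring_1) \<Rightarrow> int \<Rightarrow> int \<Rightarrow> 'a" where
  "conv c q k m = (\<Sum>a<4. \<Sum>b<4. c a * c b * q (k + int a) (m + int b))"

lemma conv_linear:
  "conv c (\<lambda>k m. f k m + g k m) k m = conv c f k m + conv c g k m"
  "conv c (\<lambda>k m. f k m - g k m) k m = conv c f k m - conv c g k m"
  "conv c (\<lambda>k m. e * f k m) k m = e * conv c f k m"
  by (simp_all add: conv_def ring_distribs sum.distrib sum_subtractf sum_distrib_left mult_ac)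

text \<open>All operators involved are combinations of index shifts with constant coefficients, and
  shifts commute.\<close>

lemma conv_op:
  "conv c (opU f) k m = opU (conv c f) k m"
  "conv c (opV f) k m = opV (conv c f) k m"
  "conv c (opW f) k m = opW (conv c f) k m"
proof -
  have shift: "conv c (\<lambda>k m. f (k + x) (m + y)) k m = conv c f (k + x) (m + y)" for x y
    by (simp add: conv_def add_ac)
  have "conv c (opU f) k m = conv c (\<lambda>k m. f (k + 1) (m + 0) - f (k + 0) (m + 1) - f (k + 2) (m + 1) + f (k + 1) (m + 2)) k m"
    "conv c (opV f) k m = conv c (\<lambda>k m. f (k + 1) (m + 0) + f (k + 0) (m + 1) - f (k + 2) (m + 1) - f (k + 1) (m + 2)) k m"
    "conv c (opW f) k m = conv c (\<lambda>k m. f (k + 1) (m + 0) - f (k + 0) (m + 1) + f (k + 2) (m + 1) - f (k + 1) (m + 2)) k m"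
    by (simp_all add: opU_def[abs_def] opV_def[abs_def] opW_def[abs_def])
  then show "conv c (opU f) k m = opU (conv c f) k m"
    "conv c (opV f) k m = opV (conv c f) k m"
    "conv c (opW f) k m = opW (conv c f) k m"
    by (simp_all only: conv_linear shift) (simp_all add: opU_def opV_def opW_def)
qed

text \<open>The left side is bilinear and each product on the right has one factor in \<lambda> and
  one in \<mu>. Multiplying every series by a scalar function of its own variable, here the
  denominator, therefore preserves the relation.\<close>

lemma Mco_quadratic_relation:
  assumes D: "is_D_bracket Ph B"
  shows "quadratic_relation j i p l Mco B"
  unfolding quadratic_relation_def
proof (intro allI)
  fix k m :: int
  interpret poisson_algebra B
    using D by unfold_locales (simp add: is_D_bracket_def)
  let ?c = "\<lambda>a. Const (kap Ph a)" and ?g = "gco Ph"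
  have B: "B (Mco a b (k + 1)) (Mco c d (m + 1)) = conv ?c (\<lambda>k m. B (?g a b k) (?g c d m)) k m" for a b c d k m
    unfolding Mco_gco[of _ _ _ Ph] conv_def
    by (rule conv_bilinear) (simp_all add: L.der_add R.der_add Const_left Const_right)
  have q: "Mco a b (k + 1) * Mco c d (m + 1) = conv ?c (\<lambda>k m. ?g a b k * ?g c d m) k m" for a b c d k m
    unfolding Mco_gco[of _ _ _ Ph] conv_def
    by (rule conv_bilinear) (simp_all add: algebra_simps)
  have op: "opU X (k + 1) (m + 1) = opU (conv ?c x) k m"
    "opV X (k + 1) (m + 1) = opV (conv ?c x) k m" "opW X (k + 1) (m + 1) = opW (conv ?c x) k m"
    if X: "\<And>k m. X (k + 1) (m + 1) = conv ?c x k m" for X x k m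
    using X[of "k + 1" m] X[of k "m + 1"] X[of "k + 2" "m + 1"] X[of "k + 1" "m + 2"]
    by (simp_all add: opU_def opV_def opW_def add_ac)
  define k' m' where "k' = k - 1" and "m' = m - 1"
  have km: "k = k' + 1" "m = m' + 1" by (simp_all add: k'_def m'_def)
  note gco = gco_quadratic_relation[OF D, of j i p l, unfolded quadratic_relation_def]
  have "conv ?c (opU (\<lambda>k m. B (?g j i k) (?g p l m))) k' m' = conv ?c (\<lambda>k m.
      eps j p * opU (\<lambda>k m. ?g p i k * ?g j l m) k m - opV (\<lambda>k m. ?g p i k * ?g j l m) k m
    + (eps i l * opU (\<lambda>k m. ?g j l k * ?g p i m) k m + opV (\<lambda>k m. ?g j l k * ?g p i m) k m)
    + (eps i p * opU (\<lambda>k m. ?g j p k * ?g i l m) k m - opW (\<lambda>k m. ?g j p k * ?g i l m) k m)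
    + (eps j l * opU (\<lambda>k m. ?g l i k * ?g p j m) k m + opW (\<lambda>k m. ?g l i k * ?g p j m) k m)) k' m'"
    unfolding conv_def using gco by simp
  then show "opU (\<lambda>k m. B (Mco j i k) (Mco p l m)) k m =
      eps j p * opU (\<lambda>k m. Mco p i k * Mco j l m) k m - opV (\<lambda>k m. Mco p i k * Mco j l m) k m
    + (eps i l * opU (\<lambda>k m. Mco j l k * Mco p i m) k m + opV (\<lambda>k m. Mco j l k * Mco p i m) k m)
    + (eps i p * opU (\<lambda>k m. Mco j p k * Mco i l m) k m - opW (\<lambda>k m. Mco j p k * Mco i l m) k m)
    + (eps j l * opU (\<lambda>k m. Mco l i k * Mco p j m) k m + opW (\<lambda>k m. Mco l i k * Mco p j m) k m)"
    unfolding conv_linear conv_op km by (simp only: op[OF B] op[OF q])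
qed

definition Mev :: "complex \<Rightarrow> 'n \<Rightarrow> 'n \<Rightarrow> ('n :: {finite, linorder} \<times> 'n) cpoly" where
  "Mev z i j = Const (z - 1) * Rhat $ i $ j + Const (z + 1) * Shat $ i $ j
     + Const (z ^ 2 - 1) * Ahat $ i $ j - Const (z - inverse z) * Ahat $ j $ i"

section \<open>Evaluation of the spectral parameters at complex numbers\<close>

lemma interval_4: "{- 2 .. 1 :: int} = {- 2, - 1, 0, 1}"
  by auto

lemma Mev_eq_sum:
  assumes "z \<noteq> 0"
  shows "Mev z i j = (\<Sum>k\<in>{-2..1}. Const (z powi (- k)) * Mco i j k)"
  unfolding interval_4 Mev_def Mco_eq
  by (simp add: power_int_minus Const.hom_diff Const.hom_add Const.hom_one algebra_simps)

text \<open>The value at \<lambda> = z, \<mu> = w. The coefficients of M live at indices -2 to 1 and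
  the operators shift by at most 2, so the support stays within -4 to 1; the window from -9 to 9 is
  simply wide enough.\<close>

definition ev2 :: "complex \<Rightarrow> complex \<Rightarrow> (int \<Rightarrow> int \<Rightarrow> 'v cpoly) \<Rightarrow> 'v cpoly" where
  "ev2 z w q = (\<Sum>k\<in>{-9..9}. \<Sum>m\<in>{-9..9}. Const (z powi (- k)) * (Const (w powi (- m)) * q k m))"

lemma ev2_linear:
  "ev2 z w (\<lambda>k m. f k m + g k m) = ev2 z w f + ev2 z w g"
  "ev2 z w (\<lambda>k m. f k m - g k m) = ev2 z w f - ev2 z w g"
  "ev2 z w (\<lambda>k m. e * f k m) = e * ev2 z w f"
  by (simp_all add: ev2_def ring_distribs sum.distrib sum_subtractf sum_distrib_left mult_ac)

lemma sum_shift: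
  fixes Y :: "int \<Rightarrow> 'v cpoly"
  assumes "z \<noteq> 0" "0 \<le> x" "x \<le> 2" "\<And>k. k \<notin> {-2..1} \<Longrightarrow> Y k = 0"
  shows "(\<Sum>k\<in>{-9..9}. Const (z powi (- k)) * Y (k + x)) = Const (z powi x) * (\<Sum>k\<in>{-2..1}. Const (z powi (- k)) * Y k)"
proof -
  have c: "Const (z powi (- k)) = Const (z powi x) * Const (z powi (- (k + x)))" for k
    using assms(1) by (simp flip: Const.hom_mult power_int_add)
  have "(\<Sum>k\<in>{-9..9}. Const (z powi (- k)) * Y (k + x)) = (\<Sum>k\<in>{-9+x..9+x}. Const (z powi x) * (Const (z powi (- k)) * Y k))"
    by (rule sum.reindex_bij_witness[where i = "\<lambda>k. k - x" and j = "\<lambda>k. k + x"])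
      (auto simp: c mult.assoc)
  also have "\<dots> = (\<Sum>k\<in>{-2..1}. Const (z powi x) * (Const (z powi (- k)) * Y k))"
    by (rule sum.mono_neutral_right) (use assms in auto)
  finally show ?thesis by (simp add: sum_distrib_left)
qed

lemma ev2_shift:
  assumes "z \<noteq> 0" "w \<noteq> 0" "0 \<le> x" "x \<le> 2" "0 \<le> y" "y \<le> 2"
    and "\<And>k m. k \<notin> {-2..1} \<or> m \<notin> {-2..1} \<Longrightarrow> q k m = 0"
  shows "ev2 z w (\<lambda>k m. q (k + x) (m + y)) = Const (z powi x * w powi y)
    * (\<Sum>k\<in>{-2..1}. \<Sum>m\<in>{-2..1}. Const (z powi (- k)) * (Const (w powi (- m)) * q k m))"
proof -
  have "ev2 z w (\<lambda>k m. q (k + x) (m + y))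
      = (\<Sum>k\<in>{-9..9}. Const (z powi (- k)) * (\<Sum>m\<in>{-9..9}. Const (w powi (- m)) * q (k + x) (m + y)))"
    by (simp add: ev2_def sum_distrib_left)
  also have "\<dots> = (\<Sum>k\<in>{-9..9}. Const (z powi (- k)) * (Const (w powi y) * (\<Sum>m\<in>{-2..1}. Const (w powi (- m)) * q (k + x) m)))"
    by (subst sum_shift[of w y]) (use assms in auto)
  also have "\<dots> = Const (z powi x) * (\<Sum>k\<in>{-2..1}. Const (z powi (- k)) * (Const (w powi y) * (\<Sum>m\<in>{-2..1}. Const (w powi (- m)) * q k m)))"
    by (rule sum_shift[of z x "\<lambda>k. Const (w powi y) * (\<Sum>m\<in>{-2..1}. Const (w powi (- m)) * q k m)"])
      (use assms in auto)
  finally show ?thesis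
    by (simp add: sum_distrib_left Const.hom_mult mult_ac)
qed

definition ev0 :: "complex \<Rightarrow> complex \<Rightarrow> (int \<Rightarrow> int \<Rightarrow> 'v cpoly) \<Rightarrow> 'v cpoly" where
  "ev0 z w q = (\<Sum>k\<in>{-2..1}. \<Sum>m\<in>{-2..1}. Const (z powi (- k)) * (Const (w powi (- m)) * q k m))"

lemma ev2_op:
  assumes "z \<noteq> 0" "w \<noteq> 0" and q: "\<And>k m. k \<notin> {-2..1} \<or> m \<notin> {-2..1} \<Longrightarrow> q k m = 0"
  shows "ev2 z w (opU q) = Const ((z - w) * (1 - z * w)) * ev0 z w q"
    and "ev2 z w (opV q) = Const ((z + w) * (1 - z * w)) * ev0 z w q"
    and "ev2 z w (opW q) = Const ((z - w) * (1 + z * w)) * ev0 z w q"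
proof -
  have s: "ev2 z w (\<lambda>k m. q (k + x) (m + y)) = Const (z powi x * w powi y) * ev0 z w q"
    if "0 \<le> x" "x \<le> 2" "0 \<le> y" "y \<le> 2" for x y
    unfolding ev0_def by (rule ev2_shift) (use assms that in auto)
  have "opU q = (\<lambda>k m. q (k + 1) (m + 0) - q (k + 0) (m + 1) - q (k + 2) (m + 1) + q (k + 1) (m + 2))"
    "opV q = (\<lambda>k m. q (k + 1) (m + 0) + q (k + 0) (m + 1) - q (k + 2) (m + 1) - q (k + 1) (m + 2))"
    "opW q = (\<lambda>k m. q (k + 1) (m + 0) - q (k + 0) (m + 1) + q (k + 2) (m + 1) - q (k + 1) (m + 2))"
    by (simp_all add: opU_def[abs_def] opV_def[abs_def] opW_def[abs_def])
  then show "ev2 z w (opU q) = Const ((z - w) * (1 - z * w)) * ev0 z w q"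
    "ev2 z w (opV q) = Const ((z + w) * (1 - z * w)) * ev0 z w q"
    "ev2 z w (opW q) = Const ((z - w) * (1 + z * w)) * ev0 z w q"
    by (simp_all only: ev2_linear, simp_all add: s s[of 1 0, simplified] s[of 0 1, simplified] Const.hom_mult Const.hom_diff Const.hom_add Const.hom_one algebra_simps power2_eq_square)
qed

text \<open>Under evaluation the shift operators become numerical factors. The denominator is kept
  as a factor on the left, so the formula may be used at all nonzero values, in particular at 1 and
  -1.\<close>

lemma Mev_bracket:
  fixes B :: "('n :: {finite, linorder} \<times> 'n) cpoly \<Rightarrow> ('n \<times> 'n) cpoly \<Rightarrow> ('n \<times> 'n) cpoly"
  assumes D: "is_D_bracket Ph B" and zw: "z \<noteq> 0" "w \<noteq> 0"
  shows "Const ((z - w) * (1 - z * w)) * B (Mev z j i) (Mev w p l) =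
      Const ((1 - z * w) * (eps j p * (z - w) - (z + w))) * (Mev z p i * Mev w j l)
    + Const ((1 - z * w) * (eps i l * (z - w) + (z + w))) * (Mev z j l * Mev w p i)
    + Const ((z - w) * (eps i p * (1 - z * w) - (1 + z * w))) * (Mev z j p * Mev w i l)
    + Const ((z - w) * (eps j l * (1 - z * w) + (1 + z * w))) * (Mev z l i * Mev w p j)"
proof -
  interpret poisson_algebra B
    using D by unfold_locales (simp add: is_D_bracket_def)
  have z: "Mco a b k = 0" if "k \<notin> {-2..1}" for a b :: 'n and k
    using that by (auto simp: Mco_eq)
  have B: "ev0 z w (\<lambda>k m. B (Mco a b k) (Mco c d m)) = B (Mev z a b) (Mev w c d)" for a b c d :: 'n
    unfolding Mev_eq_sum[OF zw(1)] Mev_eq_sum[OF zw(2)] ev0_def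
    by (simp only: L.der_sum Const_left)
      (simp only: R.der_sum Const_right sum_distrib_left mult.left_commute)
  have q: "ev0 z w (\<lambda>k m. Mco a b k * Mco c d m) = Mev z a b * Mev w c d" for a b c d :: 'n
    unfolding Mev_eq_sum[OF zw(1)] Mev_eq_sum[OF zw(2)] ev0_def sum_product
    by (simp only: mult_ac)
  have ops: "ev2 z w (opU (\<lambda>k m. Mco a b k * Mco c d m)) = Const ((z - w) * (1 - z * w)) * (Mev z a b * Mev w c d)"
    "ev2 z w (opV (\<lambda>k m. Mco a b k * Mco c d m)) = Const ((z + w) * (1 - z * w)) * (Mev z a b * Mev w c d)"
    "ev2 z w (opW (\<lambda>k m. Mco a b k * Mco c d m)) = Const ((z - w) * (1 + z * w)) * (Mev z a b * Mev w c d)"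
    for a b c d :: 'n
    by (subst ev2_op[OF zw]; auto simp: z q)+
  note rel = Mco_quadratic_relation[OF D, of j i p l, unfolded quadratic_relation_def]
  have "ev2 z w (opU (\<lambda>k m. B (Mco j i k) (Mco p l m))) = ev2 z w (\<lambda>k m.
      eps j p * opU (\<lambda>k m. Mco p i k * Mco j l m) k m - opV (\<lambda>k m. Mco p i k * Mco j l m) k m
    + (eps i l * opU (\<lambda>k m. Mco j l k * Mco p i m) k m + opV (\<lambda>k m. Mco j l k * Mco p i m) k m)
    + (eps i p * opU (\<lambda>k m. Mco j p k * Mco i l m) k m - opW (\<lambda>k m. Mco j p k * Mco i l m) k m)
    + (eps j l * opU (\<lambda>k m. Mco l i k * Mco p j m) k m + opW (\<lambda>k m. Mco l i k * Mco p j m) k m))"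
    unfolding ev2_def using rel by simp
  also have "ev2 z w (opU (\<lambda>k m. B (Mco j i k) (Mco p l m))) = Const ((z - w) * (1 - z * w)) * B (Mev z j i) (Mev w p l)"
    by (subst ev2_op(1)[OF zw]) (auto simp: z B L.der_zero R.der_zero)
  finally show ?thesis
    unfolding ev2_linear ops
    by (simp add: Const.hom_mult Const.hom_add Const.hom_diff Const_eps Const.hom_one algebra_simps)
qed

type_synonym ('a, 'n) sqmat = "(('a, 'n) vec, 'n) vec"

definition Mmat :: "complex \<Rightarrow> (('n :: {finite, linorder} \<times> 'n) cpoly, 'n) sqmat" where
  "Mmat z = (\<chi> i j. Mev z i j)"

text \<open>Contracting the bracket with the cofactors of \<open>M(z)\<close> turns each of the four terms into a
  multiple of \<open>det M(z) M(w)\<close>, because the signs occur only with equal indices; the multiples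
  cancel in pairs.\<close>

lemma bracket_det_Mev:
  fixes B :: "('n :: {finite, linorder} \<times> 'n) cpoly \<Rightarrow> ('n \<times> 'n) cpoly \<Rightarrow> ('n \<times> 'n) cpoly"
  assumes D: "is_D_bracket Ph B" and zw: "z \<noteq> 0" "w \<noteq> 0" "z \<noteq> w" "z * w \<noteq> 1"
  shows "B (det (Mmat z)) (Mev w p l) = 0"
proof -
  interpret poisson_algebra B
    using D by unfold_locales (simp add: is_D_bracket_def)
  let ?A = "Mmat z" and ?N = "Mev w"
  define c1 :: "'n \<Rightarrow> ('n \<times> 'n) cpoly" where "c1 j = Const ((1 - z * w) * (eps j p * (z - w) - (z + w)))" for j
  define c2 :: "'n \<Rightarrow> ('n \<times> 'n) cpoly" where "c2 i = Const ((1 - z * w) * (eps i l * (z - w) + (z + w)))" for i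
  define c3 :: "'n \<Rightarrow> ('n \<times> 'n) cpoly" where "c3 i = Const ((z - w) * (eps i p * (1 - z * w) - (1 + z * w)))" for i
  define c4 :: "'n \<Rightarrow> ('n \<times> 'n) cpoly" where "c4 j = Const ((z - w) * (eps j l * (1 - z * w) + (1 + z * w)))" for j
  have "Const ((z - w) * (1 - z * w)) * B (det ?A) (?N p l)
      = (\<Sum>j\<in>UNIV. \<Sum>i\<in>UNIV. cof ?A j i * (Const ((z - w) * (1 - z * w)) * B (Mev z j i) (?N p l)))"
    unfolding L.der_det by (simp add: sum_distrib_left mult_ac Mmat_def)
  also have "\<dots> = (\<Sum>j\<in>UNIV. \<Sum>i\<in>UNIV. cof ?A j i * (c1 j * (?A $ p $ i * ?N j l)
      + c2 i * (?A $ j $ l * ?N p i) + c3 i * (?A $ j $ p * ?N i l) + c4 j * (?A $ l $ i * ?N p j)))"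
    unfolding Mev_bracket[OF D zw(1,2)] by (simp add: c1_def c2_def c3_def c4_def Mmat_def)
  also have "\<dots> = (\<Sum>j\<in>UNIV. c1 j * ?N j l * (\<Sum>i\<in>UNIV. ?A $ p $ i * cof ?A j i))
      + (\<Sum>i\<in>UNIV. c2 i * ?N p i * (\<Sum>j\<in>UNIV. ?A $ j $ l * cof ?A j i))
      + (\<Sum>i\<in>UNIV. c3 i * ?N i l * (\<Sum>j\<in>UNIV. ?A $ j $ p * cof ?A j i))
      + (\<Sum>j\<in>UNIV. c4 j * ?N p j * (\<Sum>i\<in>UNIV. ?A $ l $ i * cof ?A j i))"
    unfolding ring_distribs sum.distrib sum_distrib_left
    \<comment> \<open>The terms with \<open>c2\<close> and \<open>c3\<close> contract columns of the
      matrix, so their two summations are exchanged.\<close>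
    by (subst (6 7) sum.swap) (simp only: mult_ac)
  also have "\<dots> = (c1 p + c2 l + c3 p + c4 l) * (?N p l * det ?A)"
    unfolding cof_row cof_column by (simp add: if_distrib cong: if_cong) (simp add: algebra_simps)
  also have "c1 p + c2 l + c3 p + c4 l = 0"
    unfolding c1_def c2_def c3_def c4_def
    by (simp add: eps_def Const.hom_zero flip: Const.hom_add) (simp add: algebra_simps Const.hom_zero)
  finally show ?thesis
    using zw by (simp add: Const_mult_eq_0_iff)
qed

section \<open>Brackets obtained from special values of the spectral parameter\<close>

lemma Shat_nth: "Shat $ i $ j = Ghat i i * Ghat j j"
  by (simp add: Shat_def)

lemma Rhat_skew: "Rhat $ j $ i = - Rhat $ i $ j"
  by (auto simp: Rhat_def)

lemma Mev_1: "Mev 1 i j = Const 2 * (Ghat i i * Ghat j j)"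
  by (simp add: Mev_def Shat_nth Const.hom_zero)

text \<open>Take w = 1, where M(1) = 2 S. By the Leibniz rule the bracket with the entry
  \<open>(p, p)\<close> is a multiple of \<open>Ghat p p\<close>, and so is each of the four terms
  on the right, which then collapse into two. Cancelling \<open>Ghat p p\<close> leaves an exact
  formula.\<close>

lemma bracket_Mev_diag:
  fixes B :: "('n :: {finite, linorder} \<times> 'n) cpoly \<Rightarrow> ('n \<times> 'n) cpoly \<Rightarrow> ('n \<times> 'n) cpoly"
  assumes D: "is_D_bracket Ph B" and z: "z \<noteq> 0" "z \<noteq> 1"
  shows "Const (z - 1) * B (Mev z j i) (Ghat p p) =
      Const (eps j p * (z - 1) - (z + 1)) * (Mev z p i * Ghat j j)
    + Const (eps i p * (z - 1) + (z + 1)) * (Mev z j p * Ghat i i)"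
proof -
  interpret poisson_algebra B
    using D by unfold_locales (simp add: is_D_bracket_def)
  define X where "X = Mev z p i * Ghat j j"
  define Y where "Y = Mev z j p * Ghat i i"
  define a where "a = eps j p * (z - 1) - (z + 1)"
  define b where "b = eps i p * (z - 1) + (z + 1)"
  have "B (Mev z j i) (Mev 1 p p) = Const 4 * (Ghat p p * B (Mev z j i) (Ghat p p))"
    unfolding Mev_1 unfolding Const_right unfolding R.der_mult by (simp add: algebra_simps Const.hom_numeral)
  moreover have "Const ((z - 1) * (1 - z)) * B (Mev z j i) (Mev 1 p p) =
      Const ((1 - z) * a) * (Mev z p i * Mev 1 j p) + Const ((1 - z) * b) * (Mev z j p * Mev 1 p i)
    + Const ((z - 1) * - b) * (Mev z j p * Mev 1 i p) + Const ((z - 1) * - a) * (Mev z p i * Mev 1 p j)"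
    using Mev_bracket[OF D z(1), of 1 j i p p] by (simp add: a_def b_def algebra_simps)
  ultimately have "Const ((z - 1) * (1 - z)) * (Const 4 * (Ghat p p * B (Mev z j i) (Ghat p p)))
      = Const (1 - z) * (Const 4 * (Ghat p p * (Const a * X + Const b * Y)))"
    by (simp add: Mev_1 X_def Y_def Const.hom_mult Const.hom_diff Const.hom_one Const.hom_numeral
        Const.hom_uminus algebra_simps)
  then have "Const (1 - z) * (Const 4 * (Ghat p p * (Const (z - 1) * B (Mev z j i) (Ghat p p) - (Const a * X + Const b * Y)))) = 0"
    unfolding Const.hom_mult by (simp add: algebra_simps)
  then have "Const (z - 1) * B (Mev z j i) (Ghat p p) - (Const a * X + Const b * Y) = 0"
    unfolding Const_mult_eq_0_iff Ghat_def Var_mult_eq_0_iff using z by simp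
  then show ?thesis
    by (simp add: X_def Y_def a_def b_def)
qed

text \<open>The values 1 and -1 isolate S and R, hence the diagonal generators and R. At 2 only the
  entries of A above the diagonal remain, with coefficient 2^2 - 1 = 3, and R then yields those
  below.\<close>

lemma central_if_Mev:
  fixes B :: "('n :: {finite, linorder} \<times> 'n) cpoly \<Rightarrow> ('n \<times> 'n) cpoly \<Rightarrow> ('n \<times> 'n) cpoly"
  assumes "is_poisson_bracket B" and M: "\<And>w p l. w \<noteq> 0 \<Longrightarrow> B h (Mev w p l) = 0"
  shows "central B h"
proof -
  interpret poisson_algebra B by unfold_locales fact
  have "Const 4 * (Ghat i i * B h (Ghat i i)) = 0" for i
    using M[of 1 i i] unfolding Mev_1 unfolding Const_right unfolding R.der_mult
    by (simp add: algebra_simps Const.hom_numeral)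
  then have g: "B h (Ghat i i) = 0" for i
    unfolding Const_mult_eq_0_iff Ghat_def Var_mult_eq_0_iff by simp
  have "Const (- 2) * B h (Rhat $ i $ j) = 0" for i j
    using M[of "- 1" i j] by (simp add: Mev_def Const.hom_zero Const_right)
  then have R: "B h (Rhat $ i $ j) = 0" for i j
    unfolding Const_mult_eq_0_iff by simp
  have up: "B h (Ghat i j) = 0" if "i < j" for i j
  proof -
    have "Const 3 * B h (Ghat i j) = 0"
      using M[of 2 i j] that
      by (simp add: Mev_def R.der_add R.der_diff R.der_mult R Const_right Const_zero Shat_nth g Ahat_def
          L.der_zero R.der_zero less_not_sym)
    then show ?thesis unfolding Const_mult_eq_0_iff by simp
  qed
  have "B h (Ghat j i) = 0" if "i < j" for i j
    using R[of i j] that up[OF that] by (simp add: Rhat_def R.der_diff R.der_mult g)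
  then have "B h (Ghat i j) = 0" for i j
    using up g by (metis linorder_less_linear)
  then show ?thesis by (simp add: central_def)
qed

section \<open>The generating polynomial\<close>

text \<open>For each fixed monomial, its coefficients in \<open>p\<close> form a complex polynomial
  with infinitely many zeros.\<close>

lemma poly_Const_eq_0:
  fixes p :: "'v cpoly poly"
  assumes "finite F" "\<And>y. y \<notin> F \<Longrightarrow> poly p (Const y) = 0"
  shows "p = 0"
proof -
  have "Poly_Mapping.lookup (coeff p k) m = 0" for k m
  proof -
    define q where "q = (\<Sum>k\<le>degree p. monom (Poly_Mapping.lookup (coeff p k) m) k)"
    have lk: "Poly_Mapping.lookup (f * Const a) m = Poly_Mapping.lookup f m * a" for f :: "'v cpoly" and a
      using lookup_Const_mult[of a f m] by (simp add: mult.commute)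
    have "poly q y = Poly_Mapping.lookup (poly p (Const y)) m" for y
      by (simp add: q_def poly_sum poly_monom poly_altdef[of p] lookup_sum lk flip: Const.hom_power)
    then have "UNIV - F \<subseteq> {y. poly q y = 0}"
      using assms(2) by auto
    moreover have "infinite (UNIV - F)"
      using assms(1) infinite_UNIV_char_0 by (rule Diff_infinite_finite)
    ultimately have "q = 0"
      using finite_subset poly_roots_finite by blast
    then have "coeff q k = 0" by simp
    then show ?thesis
      by (cases "k \<le> degree p") (simp_all add: q_def coeff_sum coeff_eq_0)
  qed
  then show ?thesis
    by (simp add: poly_eq_iff poly_mapping_eq_iff fun_eq_iff)
qed

text \<open>\<lambda>^(-2) M(\<lambda>) as a matrix of genuine polynomials in y = \<lambda>^(-1),
  which makes divisibility and comparison of coefficients available.\<close>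

definition Pmat :: "(('n :: {finite, linorder} \<times> 'n) cpoly poly, 'n) sqmat" where
  "Pmat = (\<chi> i j. [:Ahat $ i $ j, Rhat $ i $ j + Shat $ i $ j - Ahat $ j $ i,
     Shat $ i $ j - Rhat $ i $ j - Ahat $ i $ j, Ahat $ j $ i:])"

lemma poly_Pmat:
  assumes "y \<noteq> 0"
  shows "poly (Pmat $ i $ j) (Const y) = Const (y ^ 2) * Mev (inverse y) i j"
proof -
  have c: "y ^ 2 * (inverse y - 1) = y - y ^ 2" "y ^ 2 * (inverse y + 1) = y + y ^ 2"
    "y ^ 2 * (inverse y ^ 2 - 1) = 1 - y ^ 2" "y ^ 2 * (inverse y - y) = y - y ^ 3"
    using assms by (simp_all add: field_simps power2_eq_square power3_eq_cube)
  have "Const (y ^ 2) * Mev (inverse y) i j = Const (y - y ^ 2) * Rhat $ i $ j + Const (y + y ^ 2) * Shat $ i $ j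
     + Const (1 - y ^ 2) * Ahat $ i $ j - Const (y - y ^ 3) * Ahat $ j $ i"
    unfolding Mev_def distrib_left right_diff_distrib
    unfolding mult.assoc[symmetric] Const.hom_mult[symmetric] inverse_inverse_eq c by simp
  then show ?thesis
    by (simp add: Pmat_def Const.hom_add Const.hom_diff Const.hom_one Const.hom_mult algebra_simps
        power2_eq_square power3_eq_cube)
qed

lemma ring_homo_poly: "ring_homo (\<lambda>p. poly p x)"
  by unfold_locales simp_all

lemma det_scale:
  fixes A :: "'a :: comm_ring_1 ^ 'n ^ 'n"
  shows "det (\<chi> i j. c * A $ i $ j) = c ^ CARD('n) * det A"
  using det_rows_mul[of "\<lambda>_. c" "\<lambda>i. A $ i"] by (simp add: vector_scalar_mult_def)

lemma poly_det_Pmat: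
  assumes "y \<noteq> 0"
  shows "poly (det (Pmat :: (('n :: {finite, linorder} \<times> 'n) cpoly poly, 'n) sqmat)) (Const y)
    = Const (y ^ (2 * CARD('n))) * det (Mmat (inverse y))"
proof -
  interpret ring_homo "\<lambda>p. poly p (Const y :: ('n \<times> 'n) cpoly)" by (rule ring_homo_poly)
  have "poly (det (Pmat :: (('n :: {finite, linorder} \<times> 'n) cpoly poly, 'n) sqmat)) (Const y)
      = det (\<chi> i j. Const (y ^ 2) * (Mmat (inverse y) :: (('n :: {finite, linorder} \<times> 'n) cpoly, 'n) sqmat) $ i $ j)"
    unfolding hom_det by (simp add: poly_Pmat[OF assms] Mmat_def)
  then show ?thesis
    by (simp add: det_scale Const.hom_power power_mult)
qed

lemma Mmat_transpose:
  assumes "z \<noteq> 0"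
  shows "det (Mmat (inverse z)) = Const (inverse z ^ CARD('n)) * det (Mmat z :: (('n :: {finite, linorder} \<times> 'n) cpoly, 'n) sqmat)"
proof -
  have "Mev (inverse z) j i = Const (inverse z) * Mev z i j" for i j :: 'n
  proof -
    have c: "inverse z * (z - 1) = - (inverse z - 1)" "inverse z * (z + 1) = inverse z + 1"
      "inverse z * (z ^ 2 - 1) = z - inverse z" "inverse z * (z - inverse z) = - (inverse z ^ 2 - 1)"
      using assms by (simp_all add: field_simps power2_eq_square)
    have "Const (inverse z) * Mev z i j = Const (- (inverse z - 1)) * Rhat $ i $ j + Const (inverse z + 1) * Shat $ i $ j
      + Const (z - inverse z) * Ahat $ i $ j - Const (- (inverse z ^ 2 - 1)) * Ahat $ j $ i"
      unfolding Mev_def distrib_left right_diff_distrib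
      unfolding mult.assoc[symmetric] Const.hom_mult[symmetric] c by simp
    then show ?thesis
      by (simp add: Mev_def Shat_nth Rhat_skew[of j i] Const.hom_uminus Const.hom_diff algebra_simps)
  qed
  then have "Mmat (inverse z) = Finite_Cartesian_Product.transpose (\<chi> i j. Const (inverse z) * (Mmat z :: (('n :: {finite, linorder} \<times> 'n) cpoly, 'n) sqmat) $ i $ j)"
    by (simp add: Mmat_def Finite_Cartesian_Product.transpose_def vec_eq_iff)
  then show ?thesis
    by (simp add: det_scale Const.hom_power)
qed

lemma power_dvd_det_Pmat:
  "(1 - [:0, 1:]) ^ (CARD('n) - 1) dvd det (Pmat :: (('n :: {finite, linorder} \<times> 'n) cpoly poly, 'n) sqmat)"
proof -
  let ?x = "1 - [:0, 1:] :: ('n \<times> 'n) cpoly poly"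
  \<comment> \<open>The quotient by 1 - y of everything in \<open>Pmat\<close> except its S part,
    which is (y + y^2) S and has all rows proportional to \<open>?v\<close>.\<close>
  let ?N = "\<lambda>i. \<chi> j. [:Ahat $ i $ j, Rhat $ i $ j + Ahat $ i $ j - Ahat $ j $ i, - Ahat $ j $ i:]"
  let ?v = "(\<chi> j. [:Ghat j j:]) :: (('n \<times> 'n) cpoly poly, 'n) vec"
  have "Pmat = (\<chi> i. if i \<in> UNIV then ?x *s ?N i + [:0, Ghat i i, Ghat i i:] *s ?v else 0)"
    by (simp add: vec_eq_iff Pmat_def Shat_nth left_diff_distrib algebra_simps one_pCons)
  then show ?thesis
    using power_dvd_det[of UNIV ?x ?N "\<lambda>i. [:0, Ghat i i, Ghat i i:]" ?v "\<lambda>_. 0"] by simp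
qed

lemma poly_det_Pmat_0:
  "poly (det (Pmat :: (('n :: {finite, linorder} \<times> 'n) cpoly poly, 'n) sqmat)) 0 = 1"
proof -
  interpret ring_homo "\<lambda>p. poly p (0 :: ('n \<times> 'n) cpoly)" by (rule ring_homo_poly)
  show ?thesis
    unfolding hom_det by (rule det_unitriangular) (auto simp: Pmat_def Ahat_def)
qed

lemma palindromic_coeffs:
  fixes H :: "'v cpoly poly"
  assumes "finite F" "0 \<in> F"
    and "\<And>y. y \<notin> F \<Longrightarrow> Const (y ^ N) * poly H (Const (inverse y)) = t * poly H (Const y)"
  shows "k \<le> N \<Longrightarrow> coeff H (N - k) = t * coeff H k" "k > N \<Longrightarrow> t * coeff H k = 0"
proof -
  \<comment> \<open>Multiplying the functional equation by y^d makes both sides polynomials, and the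
    summand \<open>k\<close> in \<open>d\<close> ensures that index \<open>k\<close> occurs in the
    sums. The claim is then read off at exponent \<open>d + k\<close>.\<close>
  define d where "d = degree H + k"
  define P1 where "P1 = (\<Sum>k\<le>d. monom (coeff H k) (N + (d - k)))"
  define P2 where "P2 = (\<Sum>k\<le>d. monom (t * coeff H k) (d + k))"
  have H: "poly H x = (\<Sum>k\<le>d. coeff H k * x ^ k)" for x
    unfolding poly_altdef by (rule sum.mono_neutral_left) (auto simp: d_def coeff_eq_0)
  have "P1 - P2 = 0"
  proof (rule poly_Const_eq_0[OF assms(1)])
    fix y assume y: "y \<notin> F"
    then have y0: "y \<noteq> 0" using assms(2) by auto
    have "poly P1 (Const y) = (\<Sum>k\<le>d. Const (y ^ d) * (Const (y ^ N) * (coeff H k * Const (inverse y) ^ k)))"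
      unfolding P1_def poly_sum poly_monom
    proof (rule sum.cong)
      fix k assume "k \<in> {..d}"
      then have "y ^ (N + (d - k)) = y ^ d * y ^ N * inverse y ^ k"
        using y0 by (simp add: power_add power_diff field_simps)
      then show "coeff H k * Const y ^ (N + (d - k)) = Const (y ^ d) * (Const (y ^ N) * (coeff H k * Const (inverse y) ^ k))"
        by (simp add: Const.hom_mult mult_ac flip: Const.hom_power)
    qed simp
    also have "\<dots> = Const (y ^ d) * (Const (y ^ N) * poly H (Const (inverse y)))"
      by (simp add: H sum_distrib_left)
    also have "\<dots> = Const (y ^ d) * (t * poly H (Const y))"
      using assms(3)[OF y] by simp
    also have "\<dots> = poly P2 (Const y)"
      by (simp add: H P2_def poly_sum poly_monom sum_distrib_left power_add Const.hom_power mult_ac)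
    finally show "poly (P1 - P2) (Const y) = 0" by simp
  qed
  then have eq: "coeff P1 (d + k) = coeff P2 (d + k)" by simp
  have P2: "coeff P2 (d + k) = t * coeff H k"
    by (simp add: P2_def coeff_sum d_def)
  have P1: "coeff P1 (d + k) = (\<Sum>l\<le>d. if N + (d - l) = d + k then coeff H l else 0)"
    by (simp add: P1_def coeff_sum)
  show "coeff H (N - k) = t * coeff H k" if "k \<le> N"
  proof (cases "N - k \<le> d")
    case True
    then have "N + (d - l) = d + k \<longleftrightarrow> l = N - k" if "l \<le> d" for l
      using that \<open>k \<le> N\<close> by linarith
    then have "coeff P1 (d + k) = (\<Sum>l\<le>d. if l = N - k then coeff H l else 0)"
      unfolding P1 by (intro sum.cong) auto
    then show ?thesis using True eq P2 by simp
  next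
    case False
    then have "coeff P1 (d + k) = 0"
      unfolding P1 by (intro sum.neutral) auto
    then show ?thesis using False eq P2 by (simp add: coeff_eq_0 d_def)
  qed
  show "t * coeff H k = 0" if "k > N"
  proof -
    have "coeff P1 (d + k) = 0"
      unfolding P1 using that by (intro sum.neutral) auto
    then show ?thesis using eq P2 by simp
  qed
qed

lemma sum_reflect_split:
  fixes f :: "nat \<Rightarrow> 'a :: comm_monoid_add"
  shows "(\<Sum>k\<le>2 * n + 1. f k) = f 0 + (\<Sum>i = 1..n. f (n + 1 - i)) + (\<Sum>i = 1..n. f (n + i)) + f (2 * n + 1)"
proof -
  have "(\<Sum>i = 1..n. f (n + 1 - i)) = (\<Sum>k = 1..n. f k)"
    by (rule sum.reindex_bij_witness[where i = "\<lambda>k. n + 1 - k" and j = "\<lambda>i. n + 1 - i"]) auto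
  moreover have "(\<Sum>i = 1..n. f (n + i)) = (\<Sum>k = n + 1..2 * n. f k)"
    by (rule sum.reindex_bij_witness[where i = "\<lambda>k. k - n" and j = "\<lambda>i. n + i"]) auto
  moreover have "{..2 * n + 1} = {0} \<union> ({1..n} \<union> ({n + 1..2 * n} \<union> {2 * n + 1}))"
    by auto
  ultimately show ?thesis
    by (simp add: sum.union_disjoint add_ac)
qed

text \<open>\<open>L\<close> and \<open>X\<close> are any mutually inverse elements: the lemma is
  used both for \<lambda> and its inverse as Laurent series and for a nonzero number.\<close>

lemma laurent_split:
  fixes L X :: "'a :: comm_ring_1"
  assumes "L * X = 1"
  shows "L ^ (n + 1) * (\<Sum>k\<le>2 * n + 1. X ^ k * h k) = L ^ (n + 1) * h 0
    + (\<Sum>i = 1..n. L ^ i * h (n + 1 - i)) + (\<Sum>i = 1..n. X ^ (i - 1) * h (n + i)) + X ^ n * h (2 * n + 1)"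
proof -
  have LX: "L ^ k * X ^ k = 1" for k
    using assms by (simp flip: power_mult_distrib)
  have low: "L ^ (n + 1) * (X ^ (n + 1 - i) * y) = L ^ i * y" if "i \<in> {1..n}" for i y
  proof -
    have "L ^ (n + 1) = L ^ i * L ^ (n + 1 - i)"
      using that by (simp flip: power_add)
    then have "L ^ (n + 1) * (X ^ (n + 1 - i) * y) = L ^ i * y * (L ^ (n + 1 - i) * X ^ (n + 1 - i))"
      by (simp only: mult_ac)
    then show ?thesis by (simp only: LX mult_1_right)
  qed
  have high: "L ^ (n + 1) * (X ^ (n + i) * y) = X ^ (i - 1) * y" if "i \<ge> 1" for i y
  proof -
    have "n + i = (i - 1) + (n + 1)" using that by simp
    then have "X ^ (n + i) = X ^ (i - 1) * X ^ (n + 1)"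
      by (metis power_add)
    then have "L ^ (n + 1) * (X ^ (n + i) * y) = X ^ (i - 1) * y * (L ^ (n + 1) * X ^ (n + 1))"
      by (simp only: mult_ac)
    then show ?thesis by (simp only: LX mult_1_right)
  qed
  have "L ^ (n + 1) * (X ^ (2 * n + 1) * h (2 * n + 1)) = X ^ n * h (2 * n + 1)"
    using high[of "n + 1" "h (2 * n + 1)"] by (simp add: mult_2)
  moreover have "(\<Sum>i = 1..n. L ^ (n + 1) * (X ^ (n + 1 - i) * h (n + 1 - i))) = (\<Sum>i = 1..n. L ^ i * h (n + 1 - i))"
    by (rule sum.cong[OF refl]) (rule low)
  moreover have "(\<Sum>i = 1..n. L ^ (n + 1) * (X ^ (n + i) * h (n + i))) = (\<Sum>i = 1..n. X ^ (i - 1) * h (n + i))"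
    by (rule sum.cong[OF refl], rule high) simp
  ultimately show ?thesis
    unfolding sum_reflect_split distrib_left sum_distrib_left by (simp only: power_0 mult_1)
qed

text \<open>In y = \<lambda>^(-1), \<open>H\<close> is \<lambda>^(-n-1) times the square bracket of
  the theorem, so the coefficient of \<lambda>^i there is \<open>coeff H (n + 1 - i)\<close>. The
  constant term is 1 because \<open>Pmat\<close> at y = 0 is the unitriangular A, and
  \<open>Mmat_transpose\<close> gives the symmetry.\<close>

lemma generating_poly:
  obtains H :: "('n :: {finite, linorder} \<times> 'n) cpoly poly"
  where "det Pmat = (1 - [:0, 1:]) ^ (CARD('n) - 1) * H" "coeff H 0 = 1"
    "\<And>k. k \<le> 2 * CARD('n) + 1 \<Longrightarrow> coeff H (2 * CARD('n) + 1 - k) = (- 1) ^ (CARD('n) + 1) * coeff H k"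
    "\<And>k. k > 2 * CARD('n) + 1 \<Longrightarrow> coeff H k = 0"
proof -
  let ?n = "CARD('n)"
  obtain H :: "('n \<times> 'n) cpoly poly" where H: "det Pmat = (1 - [:0, 1:]) ^ (?n - 1) * H"
    using power_dvd_det_Pmat by (elim dvdE)
  have "poly (det (Pmat :: (('n \<times> 'n) cpoly poly, 'n) sqmat)) 0 = poly H 0"
    unfolding H by simp
  then have H0: "coeff H 0 = 1"
    unfolding poly_det_Pmat_0 by (simp add: poly_0_coeff_0)
  define E where "E = (\<lambda>z. det (Mmat z :: (('n \<times> 'n) cpoly, 'n) sqmat))"
  have n: "?n = Suc (?n - 1)" using zero_less_card_finite[where 'a = 'n] by linarith
  have eval: "Const ((1 - y) ^ (?n - 1)) * poly H (Const y) = Const (y ^ (2 * ?n)) * E (inverse y)"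
    if "y \<noteq> 0" for y
    using poly_det_Pmat[where 'n = 'n, OF that] unfolding H
    by (simp add: E_def Const.hom_power Const.hom_diff Const.hom_one)
  \<comment> \<open>The value 1 is left out because the factor (1 - y)^(n-1) has to be
    cancelled.\<close>
  have sym: "Const (y ^ (2 * ?n + 1)) * poly H (Const (inverse y)) = (- 1) ^ (?n + 1) * poly H (Const y)"
    if "y \<notin> {0, 1}" for y
  proof -
    have y: "y \<noteq> 0" "y \<noteq> 1" using that by auto
    let ?a = "poly H (Const y)" and ?b = "poly H (Const (inverse y))" and ?t = "(- 1) ^ (?n + 1) :: complex"
    have "1 - y = - 1 * y * (1 - inverse y)"
      using y by (simp add: field_simps)
    then have "(1 - y) ^ (?n - 1) = (- 1) ^ (?n - 1) * y ^ (?n - 1) * (1 - inverse y) ^ (?n - 1)"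
      by (simp only: power_mult_distrib)
    moreover have "y ^ (2 * ?n + 1) * y ^ (?n - 1) = y ^ (3 * ?n)"
    proof -
      have "(2 * ?n + 1) + (?n - 1) = 3 * ?n" using n by linarith
      then show ?thesis by (metis power_add)
    qed
    moreover have t: "(- 1) ^ (?n - 1) = ?t"
    proof -
      have "?n + 1 = (?n - 1) + 2" using n by linarith
      then have "?t = (- 1) ^ (?n - 1) * (- 1) ^ 2" by (metis power_add)
      then show ?thesis by simp
    qed
    ultimately have s: "(1 - y) ^ (?n - 1) * y ^ (2 * ?n + 1) = ?t * y ^ (3 * ?n) * (1 - inverse y) ^ (?n - 1)"
      by (simp add: mult_ac)
    have "Const ((1 - y) ^ (?n - 1)) * (Const (y ^ (2 * ?n + 1)) * ?b)
        = Const (?t * y ^ (3 * ?n)) * (Const ((1 - inverse y) ^ (?n - 1)) * ?b)"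
      by (simp only: mult.assoc[symmetric] Const.hom_mult[symmetric] s)
    also have "\<dots> = Const (?t * y ^ (3 * ?n)) * (Const (inverse y ^ (2 * ?n)) * E y)"
      using eval[of "inverse y"] y by simp
    also have "\<dots> = Const (?t * y ^ (2 * ?n)) * E (inverse y)"
    proof -
      have "E (inverse y) = Const (inverse y ^ ?n) * E y"
        unfolding E_def by (rule Mmat_transpose[OF y(1)])
      moreover have "?t * y ^ (3 * ?n) * inverse y ^ (2 * ?n) = ?t * y ^ (2 * ?n) * inverse y ^ ?n"
      proof -
        have "3 * ?n = ?n + 2 * ?n" "2 * ?n = ?n + ?n" by simp_all
        then have "y ^ (3 * ?n) = y ^ ?n * y ^ (2 * ?n)" "y ^ (2 * ?n) = y ^ ?n * y ^ ?n"
          by (metis power_add)+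
        then show ?thesis using y by (simp add: field_simps)
      qed
      ultimately show ?thesis
        by (simp only: mult.assoc[symmetric] Const.hom_mult[symmetric])
    qed
    also have "\<dots> = Const ((1 - y) ^ (?n - 1)) * (Const ?t * ?a)"
      unfolding Const.hom_mult mult.assoc eval[OF y(1), symmetric] by (rule mult.left_commute)
    finally have "Const ((1 - y) ^ (?n - 1)) * (Const (y ^ (2 * ?n + 1)) * ?b - Const ?t * ?a) = 0"
      by (simp only: right_diff_distrib diff_self)
    then have "Const (y ^ (2 * ?n + 1)) * ?b - Const ?t * ?a = 0"
      unfolding Const_mult_eq_0_iff using y by simp
    moreover have "Const ?t = (- 1) ^ (?n + 1)"
      by (simp only: Const.hom_power Const.hom_uminus Const.hom_one)
    ultimately show ?thesis by (metis eq_iff_diff_eq_0)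
  qed
  have pal: "k \<le> 2 * ?n + 1 \<Longrightarrow> coeff H (2 * ?n + 1 - k) = (- 1) ^ (?n + 1) * coeff H k"
    "k > 2 * ?n + 1 \<Longrightarrow> (- 1) ^ (?n + 1) * coeff H k = 0" for k
    using palindromic_coeffs[of "{0, 1}" "2 * ?n + 1" H "(- 1) ^ (?n + 1)" k] sym by auto
  have "(- 1) ^ m * x = 0 \<Longrightarrow> x = 0" for m and x :: "('n \<times> 'n) cpoly"
    by (cases "even m") auto
  then show ?thesis
    using that[OF H H0] pal by blast
qed

lemma det_Mhat_generating_poly:
  fixes H :: "('n :: {finite, linorder} \<times> 'n) cpoly poly"
  assumes H: "det Pmat = (1 - [:0, 1:]) ^ (CARD('n) - 1) * H" and deg: "\<And>k. k > 2 * CARD('n) + 1 \<Longrightarrow> coeff H k = 0"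
  shows "det Mhat = (lam - 1) ^ (CARD('n) - 1)
    * (lam ^ (CARD('n) + 1) * (\<Sum>k\<le>2 * CARD('n) + 1. fls_X ^ k * fls_const (coeff H k)))"
proof -
  let ?n = "CARD('n)"
  let ?i = "\<lambda>p :: ('n \<times> 'n) cpoly poly. fps_to_fls (fps_of_poly p)"
  interpret i: ring_homo ?i
    by unfold_locales (simp_all add: fps_of_poly_add fps_of_poly_mult fls_times_fps_to_fls)
  have LX: "lam * fls_X = (1 :: ('n \<times> 'n) cpoly fls)"
    by (rule fls_eqI) (simp add: fls_X_inv_times_nth)
  have "?i (Pmat $ a $ b) = fls_X ^ 2 * Mhat $ a $ b" for a b
  proof (rule fls_eqI)
    fix k :: int
    have "fls_nth (fls_X ^ 2 * Mhat $ a $ b) k = Mco a b (k - 2)"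
      by (simp add: Mco_def power2_eq_square mult.assoc fls_X_inv_times_nth)
    moreover have "k = 0 \<or> k = 1 \<or> k = 2 \<or> k = 3 \<or> k < 0 \<or> (\<exists>m. k = int m + 4)"
    proof (cases "k < 4")
      case False
      then have "k = int (nat (k - 4)) + 4" by simp
      then show ?thesis by blast
    qed linarith
    ultimately show "fls_nth (?i (Pmat $ a $ b)) k = fls_nth (fls_X ^ 2 * Mhat $ a $ b) k"
      by (auto simp: Mco_eq Pmat_def nat_add_distrib numeral_eq_Suc)
  qed
  then have "?i (det Pmat) = det (\<chi> a b. fls_X ^ 2 * (Mhat :: (('n \<times> 'n) cpoly fls, 'n) sqmat) $ a $ b)"
    unfolding i.hom_det by simp
  then have "fls_X ^ (2 * ?n) * det (Mhat :: (('n \<times> 'n) cpoly fls, 'n) sqmat) = ?i (det Pmat)"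
    unfolding det_scale by (simp add: power_mult)
  also have "\<dots> = (1 - fls_X) ^ (?n - 1) * ?i H"
    unfolding H by (simp only: i.hom_mult i.hom_power i.hom_diff i.hom_one)
      (simp add: fps_of_poly_pCons)
  also have "?i H = (\<Sum>k\<le>2 * ?n + 1. fls_X ^ k * fls_const (coeff H k))"
  proof -
    have "H = (\<Sum>k\<le>2 * ?n + 1. [:0, 1:] ^ k * [:coeff H k:])"
    proof -
      have "H = (\<Sum>k\<le>2 * ?n + 1. monom (coeff H k) k)"
        by (rule poly_eqI) (use deg in \<open>auto simp: coeff_sum not_le\<close>)
      then show ?thesis
        by (simp add: monom_altdef mult.commute[of "[:coeff H _:]"])
    qed
    then have "?i H = ?i (\<Sum>k\<le>2 * ?n + 1. [:0, 1:] ^ k * [:coeff H k:])"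
      by simp
    then show ?thesis
      by (simp only: i.hom_sum i.hom_mult i.hom_power) (simp add: fps_of_poly_pCons)
  qed
  finally have eq: "fls_X ^ (2 * ?n) * det (Mhat :: (('n \<times> 'n) cpoly fls, 'n) sqmat)
    = (1 - fls_X) ^ (?n - 1) * (\<Sum>k\<le>2 * ?n + 1. fls_X ^ k * fls_const (coeff H k))" .
  have "?n > 0" by simp
  then have "2 * ?n = (?n - 1) + (?n + 1)" by linarith
  then have l: "lam ^ (2 * ?n) = lam ^ (?n - 1) * (lam ^ (?n + 1) :: ('n \<times> 'n) cpoly fls)"
    by (metis power_add)
  have "lam * (1 - fls_X) = (lam - 1 :: ('n \<times> 'n) cpoly fls)"
    by (simp add: right_diff_distrib LX)
  then have l1: "lam ^ (?n - 1) * (1 - fls_X) ^ (?n - 1) = (lam - 1 :: ('n \<times> 'n) cpoly fls) ^ (?n - 1)"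
    by (simp flip: power_mult_distrib)
  have "det (Mhat :: (('n \<times> 'n) cpoly fls, 'n) sqmat) = lam ^ (2 * ?n) * (fls_X ^ (2 * ?n) * det Mhat)"
    by (simp add: LX flip: power_mult_distrib mult.assoc)
  also have "\<dots> = lam ^ (?n - 1) * (1 - fls_X) ^ (?n - 1) * (lam ^ (?n + 1) * (\<Sum>k\<le>2 * ?n + 1. fls_X ^ k * fls_const (coeff H k)))"
    unfolding eq l by (simp only: mult_ac)
  finally show ?thesis unfolding l1 .
qed

text \<open>The bracket with a fixed entry of M(w) acts coefficientwise on \<open>H\<close>. The
  polynomial of these brackets vanishes at almost all y, since determinants of M are central, so
  each coefficient vanishes.\<close>

lemma central_coeff:
  fixes H :: "('n :: {finite, linorder} \<times> 'n) cpoly poly"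
  assumes D: "is_D_bracket Ph B" and H: "det Pmat = (1 - [:0, 1:]) ^ (CARD('n) - 1) * H"
  shows "central B (coeff H k)"
proof (rule central_if_Mev)
  show "is_poisson_bracket B" using D by (simp add: is_D_bracket_def)
  then interpret poisson_algebra B by unfold_locales
  fix w :: complex and p l :: 'n
  assume w: "w \<noteq> 0"
  let ?n = "CARD('n)" and ?Z = "Mev w p l"
  define Q where "Q = (\<Sum>k\<le>degree H. monom (B (coeff H k) ?Z) k)"
  have "Q = 0"
  proof (rule poly_Const_eq_0[of "{0, 1, w, inverse w}"])
    \<comment> \<open>At 1 the factor (1 - y)^(n-1) cannot be cancelled; at \<open>w\<close> and
      \<open>inverse w\<close> the denominator of the quadratic bracket vanishes for z =
      1/y.\<close>
    fix y assume "y \<notin> {0, 1, w, inverse w}"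
    then have y: "y \<noteq> 0" "y \<noteq> 1" "y \<noteq> w" "y \<noteq> inverse w" by auto
    have "poly H (Const y) = (\<Sum>k\<le>degree H. Const (y ^ k) * coeff H k)"
      by (simp add: poly_altdef Const.hom_power mult.commute)
    then have "B (poly H (Const y)) ?Z = (\<Sum>k\<le>degree H. Const (y ^ k) * B (coeff H k) ?Z)"
      by (simp only: L.der_sum Const_left)
    also have "\<dots> = poly Q (Const y)"
      by (simp add: Q_def poly_sum poly_monom Const.hom_power mult.commute)
    finally have Q: "poly Q (Const y) = B (poly H (Const y)) ?Z" ..
    have "Const ((1 - y) ^ (?n - 1)) * poly H (Const y) = Const (y ^ (2 * ?n)) * det (Mmat (inverse y))"
      using poly_det_Pmat[where 'n = 'n, OF y(1)] unfolding H
      by (simp add: Const.hom_power Const.hom_diff Const.hom_one)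
    then have "Const ((1 - y) ^ (?n - 1)) * B (poly H (Const y)) ?Z = Const (y ^ (2 * ?n)) * B (det (Mmat (inverse y))) ?Z"
      by (simp only: flip: Const_left)
    also have "B (det (Mmat (inverse y))) ?Z = 0"
      by (rule bracket_det_Mev[OF D]) (use w y in \<open>auto simp: field_simps\<close>)
    finally show "poly Q (Const y) = 0"
      using y by (simp add: Q Const_mult_eq_0_iff)
  qed simp
  then have "coeff Q k = 0" by simp
  then show "B (coeff H k) ?Z = 0"
    by (cases "k \<le> degree H") (simp_all add: Q_def coeff_sum coeff_eq_0 L.der_zero)
qed

section \<open>Involutions with at most one fixed point\<close>

lemma exists_involution:
  assumes "finite S"
  shows "\<exists>s. (\<forall>i\<in>S. s i \<in> S \<and> s (s i) = i) \<and> (\<forall>i\<in>S. \<forall>j\<in>S. s i = i \<longrightarrow> s j = j \<longrightarrow> i = j)"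
  using assms
proof (induction "card S" arbitrary: S rule: less_induct)
  case less
  show ?case
  proof (cases "\<exists>a\<in>S. \<exists>b\<in>S. a \<noteq> b")
    case False
    then show ?thesis by (intro exI[of _ id]) auto
  next
    case True
    then obtain a b where ab: "a \<in> S" "b \<in> S" "a \<noteq> b" by blast
    have lt: "card (S - {a, b}) < card S"
      using ab less.prems by (intro psubset_card_mono) auto
    have "finite (S - {a, b})" using less.prems by simp
    from less.hyps[OF lt this] obtain s where s: "\<forall>i\<in>S - {a, b}. s i \<in> S - {a, b} \<and> s (s i) = i"
      "\<forall>i\<in>S - {a, b}. \<forall>j\<in>S - {a, b}. s i = i \<longrightarrow> s j = j \<longrightarrow> i = j"
      by (elim exE conjE)
    define t where "t = s(a := b, b := a)"
    have t: "t a = b" "t b = a" "\<And>i. i \<notin> {a, b} \<Longrightarrow> t i = s i"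
      using ab(3) by (auto simp: t_def)
    have "t i \<in> S \<and> t (t i) = i" if "i \<in> S" for i
    proof (cases "i \<in> {a, b}")
      case True
      then show ?thesis using t(1,2) ab by auto
    next
      case False
      then have "s i \<in> S - {a, b}" "s (s i) = i" using s(1) that by auto
      then show ?thesis using t(3)[OF False] t(3)[of "s i"] by auto
    qed
    moreover have "i = j" if "i \<in> S" "j \<in> S" "t i = i" "t j = j" for i j
    proof -
      have "i \<notin> {a, b}" "j \<notin> {a, b}"
        using that(3,4) t(1,2) ab(3) by auto
      then have "i \<in> S - {a, b}" "j \<in> S - {a, b}" "s i = i" "s j = j"
        using that t(3)[of i] t(3)[of j] by auto
      then show ?thesis using s(2) by metis
    qed
    ultimately show ?thesis by metis
  qed
qed

lemma prod_involution:
  fixes f :: "'n :: {finite, linorder} \<Rightarrow> 'a :: comm_monoid_mult"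
  assumes s: "\<And>i. s (s i) = i"
  shows "(\<Prod>i | i \<le> s i. if s i = i then f i else f i * f (s i)) = (\<Prod>i\<in>UNIV. f i)"
proof -
  have split: "{i. i \<le> s i} = {i. s i = i} \<union> {i. i < s i}" by auto
  have "(\<Prod>i | i \<le> s i. if s i = i then f i else f i * f (s i))
      = (\<Prod>i | s i = i. f i) * (\<Prod>i | i < s i. f i * f (s i))"
    unfolding split by (subst prod.union_disjoint) (auto intro!: arg_cong2[of _ _ _ _ "(*)"] prod.cong)
  also have "(\<Prod>i | i < s i. f i * f (s i)) = (\<Prod>i | i < s i. f i) * (\<Prod>i | s i < i. f i)"
  proof -
    have "(\<Prod>i | i < s i. f (s i)) = (\<Prod>i | s i < i. f i)"
      by (rule prod.reindex_bij_witness[where i = s and j = s]) (auto simp: s)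
    then show ?thesis by (simp add: prod.distrib)
  qed
  also have "(\<Prod>i | s i = i. f i) * ((\<Prod>i | i < s i. f i) * (\<Prod>i | s i < i. f i))
      = (\<Prod>i\<in>{i. s i = i} \<union> ({i. i < s i} \<union> {i. s i < i}). f i)"
    by (subst prod.union_disjoint; (subst prod.union_disjoint)?) auto
  also have "{i. s i = i} \<union> ({i. i < s i} \<union> {i. s i < i}) = UNIV"
    by (auto simp: not_less_iff_gr_or_eq)
  finally show ?thesis .
qed

section \<open>Algebraic independence\<close>

text \<open>\<open>cheb t k\<close> is the quotient of $z^k+tz^{1-k}$ by $z+t$, where $t=\pm1$, written as a
  polynomial in $z+z^{-1}$.\<close>

fun cheb :: "complex \<Rightarrow> nat \<Rightarrow> complex poly" where
  "cheb t 0 = [:t:]"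
| "cheb t (Suc 0) = 1"
| "cheb t (Suc (Suc k)) = [:0, 1:] * cheb t (Suc k) - cheb t k"

lemma cheb_eval:
  assumes t: "t * t = 1" and z: "z \<noteq> 0"
  shows "(z + t) * poly (cheb t k) (z + inverse z) = z ^ k + t * (z * inverse z ^ k)"
proof (induction k rule: induct_nat_012)
  case 0
  then show ?case using t by (simp add: algebra_simps)
next
  case 1
  then show ?case using z by simp
next
  case (ge2 k)
  have zi: "z * inverse z = 1" using z by simp
  have "(z + t) * poly (cheb t (Suc (Suc k))) (z + inverse z)
      = (z + inverse z) * ((z + t) * poly (cheb t (Suc k)) (z + inverse z))
      - (z + t) * poly (cheb t k) (z + inverse z)"
    by (simp add: algebra_simps)
  also have "\<dots> = (z + inverse z) * (z ^ Suc k + t * (z * inverse z ^ Suc k)) - (z ^ k + t * (z * inverse z ^ k))"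
    using ge2 by simp
  also have "\<dots> = z ^ Suc (Suc k) + t * (z * inverse z ^ Suc (Suc k)) + (z * inverse z - 1) * (z ^ k + t * (z * inverse z ^ k))"
    by (simp add: algebra_simps)
  finally show ?case by (simp add: zi)
qed

lemma cheb_degree: "degree (cheb t (Suc k)) \<le> k" "coeff (cheb t (Suc k)) k = 1"
proof -
  have "degree (cheb t (Suc k)) \<le> k \<and> coeff (cheb t (Suc k)) k = 1 \<and> degree (cheb t k) \<le> k"
  proof (induction k)
    case (Suc k)
    have "degree ([:0, 1:] * cheb t (Suc k)) \<le> Suc k"
      using Suc degree_mult_le[of "[:0, 1:]" "cheb t (Suc k)"] by simp
    moreover have "coeff ([:0, 1:] * cheb t (Suc k)) (Suc k) = 1"
      using Suc by simp
    moreover have "coeff (cheb t k) (Suc k) = 0"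
      using Suc by (intro coeff_eq_0) simp
    ultimately show ?case
      using Suc by (simp add: degree_diff_le)
  qed simp
  then show "degree (cheb t (Suc k)) \<le> k" "coeff (cheb t (Suc k)) k = 1" by auto
qed

text \<open>The roots are indexed by an arbitrary set of the right size, so that later each matrix
  index receives one root.\<close>

lemma monic_complex_poly_factors:
  fixes p :: "complex poly"
  assumes "finite S" "degree p = card S" "coeff p (degree p) = 1"
  shows "\<exists>r. p = (\<Prod>i\<in>S. [:- r i, 1:])"
  using assms
proof (induction S arbitrary: p rule: finite_induct)
  case empty
  then obtain c where "p = [:c:]"
    by (auto elim: degree_eq_zeroE)
  then show ?case using empty by simp
next
  case (insert a S)
  then obtain x where "poly p x = 0"
    using alg_closed_imp_poly_has_root[of p] by auto
  then obtain q where q: "p = [:- x, 1:] * q"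
    by (auto simp: poly_eq_0_iff_dvd elim: dvdE)
  have "p \<noteq> 0" using insert.prems by auto
  then have q0: "q \<noteq> 0" using q by auto
  have "degree p = Suc (degree q)"
    unfolding q by (subst degree_mult_eq) (use q0 in auto)
  moreover have "lead_coeff p = lead_coeff [:- x, 1:] * lead_coeff q"
    unfolding q by (rule lead_coeff_mult)
  ultimately obtain r where r: "q = (\<Prod>i\<in>S. [:- r i, 1:])"
    using insert.IH[of q] insert.prems insert.hyps by auto
  have "(\<Prod>i\<in>S. [:- r i, 1:]) = (\<Prod>i\<in>S. [:- (r(a := x)) i, 1:])"
    using insert.hyps by (intro prod.cong) auto
  then have "p = (\<Prod>i\<in>insert a S. [:- (r(a := x)) i, 1:])"
    by (subst prod.insert[OF insert.hyps(1,2)]) (simp only: q r fun_upd_same)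
  then show ?case by blast
qed

text \<open>The sum and the difference of \<open>a\<close> and \<open>b\<close> are square roots of
  Q + 2 P and Q - 2 P.\<close>

lemma sum_product_solvable: "\<exists>a b :: complex. a * b = P \<and> a ^ 2 + b ^ 2 = Q"
proof -
  define p where "p = csqrt (Q + 2 * P)"
  define q where "q = csqrt (Q - 2 * P)"
  have pq: "p ^ 2 = Q + 2 * P" "q ^ 2 = Q - 2 * P"
    by (simp_all add: p_def q_def)
  have "(p + q) / 2 * ((p - q) / 2) = (p ^ 2 - q ^ 2) / 4"
    "((p + q) / 2) ^ 2 + ((p - q) / 2) ^ 2 = (p ^ 2 + q ^ 2) / 2"
    by (simp_all add: field_simps power2_eq_square)
  then have "(p + q) / 2 * ((p - q) / 2) = P \<and> ((p + q) / 2) ^ 2 + ((p - q) / 2) ^ 2 = Q"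
    unfolding pq by simp
  then show ?thesis by blast
qed

definition block_point :: "('n \<Rightarrow> 'n) \<Rightarrow> ('n \<Rightarrow> complex) \<Rightarrow> 'n \<times> 'n \<Rightarrow> complex" where
  "block_point s v = (\<lambda>(i, j). if j = s i then v i else 0)"

lemma peval_Ghat: "peval x (Ghat i j) = x (i, j)"
  by (simp add: Ghat_def ring_homo_id)

lemmas peval_simps = peval.hom_add peval.hom_diff peval.hom_mult peval.hom_zero peval.hom_one
  peval.hom_uminus eval_poly_Const[OF ring_homo_id] peval_Ghat

text \<open>Uniqueness of the fixed point enters here: two distinct indices never both have a
  nonzero diagonal coordinate, so S becomes diagonal at the point and no entries arise outside the
  blocks.\<close>

lemma peval_Mev_block:
  fixes s :: "'n :: {finite, linorder} \<Rightarrow> 'n"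
  assumes s: "\<And>i. s (s i) = i" and fp: "\<And>i j. s i = i \<Longrightarrow> s j = j \<Longrightarrow> i = j" and z: "z \<noteq> 0"
  shows "peval (block_point s v) (Mev z i j) =
    (if j = i then (if s i = i then (z + 1) * v i ^ 2 else 0) + (z - 1) ^ 2 * (z + 1) * inverse z
     else if j = s i then if i < j then (z - 1) * (z * v i - v j) else (z - 1) * (v i - inverse z * v j)
     else 0)"
proof -
  let ?x = "block_point s v"
  have zz: "z ^ 2 - 1 - (z - inverse z) = (z - 1) ^ 2 * (z + 1) * inverse z"
    using z by (simp add: field_simps power2_eq_square)
  consider "j = i" | "j \<noteq> i" "i \<noteq> j" "j = s i" "i < j" | "j \<noteq> i" "i \<noteq> j" "j = s i" "j < i" | "j \<noteq> i" "j \<noteq> s i"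
    by force
  then show ?thesis
  proof cases
    case 1
    have "peval ?x (Mev z i i) = (z + 1) * (?x (i, i) * ?x (i, i)) + (z ^ 2 - 1 - (z - inverse z))"
      by (simp add: Mev_def Rhat_def Shat_def Ahat_def peval_simps)
    then show ?thesis
      unfolding zz using 1 by (auto simp: block_point_def power2_eq_square)
  next
    case 2
    have "s j = i" "s i \<noteq> i" "s j \<noteq> j" "\<not> j < i" using 2 s by auto
    then show ?thesis
      using 2(2-4) by (simp add: Mev_def Rhat_def Shat_def Ahat_def peval_simps block_point_def)
        (simp add: algebra_simps power2_eq_square)
  next
    case 3
    have "s j = i" "s i \<noteq> i" "s j \<noteq> j" "\<not> i < j" using 3 s by auto
    then show ?thesis
      using 3(2-4) by (simp add: Mev_def Rhat_def Shat_def Ahat_def peval_simps block_point_def)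
        (simp add: z algebra_simps power2_eq_square)
  next
    case 4
    then have "s j \<noteq> i" using s by auto
    moreover have "?x (i, i) * ?x (j, j) = 0"
      using 4 fp[of i j] by (auto simp: block_point_def)
    ultimately show ?thesis
      using 4 by (auto simp: Mev_def Rhat_def Shat_def Ahat_def peval_simps)
        (auto simp: block_point_def)
  qed
qed

text \<open>Moved indices come in pairs, so a fixed index exists exactly when n is odd. For a = z +
  1 and b = z - 1 the product is (z - 1)^(n-1) (z + (-1)^(n+1)).\<close>

lemma prod_fixed_points:
  fixes a b :: complex and s :: "'n :: {finite, linorder} \<Rightarrow> 'n"
  assumes s: "\<And>i. s (s i) = i" and fp: "\<And>i j. s i = i \<Longrightarrow> s j = j \<Longrightarrow> i = j"
  shows "(\<Prod>i\<in>UNIV. if s i = i then a else b) = b ^ (CARD('n) - 1) * (if even CARD('n) then b else a)"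
proof -
  let ?F = "{i. s i = i}" and ?N = "{i. s i \<noteq> i}"
  have "card {i. s i < i} = card {i. i < s i}"
    by (rule bij_betw_same_card[of s], rule bij_betw_byWitness[where f' = s]) (auto simp: s)
  moreover have "?N = {i. i < s i} \<union> {i. s i < i}" by auto
  moreover have "card ({i. i < s i} \<union> {i. s i < i}) = card {i. i < s i} + card {i. s i < i}"
    by (rule card_Un_disjoint) auto
  ultimately have N: "even (card ?N)" by simp
  have "UNIV = ?F \<union> ?N" by auto
  moreover have "card (?F \<union> ?N) = card ?F + card ?N"
    by (rule card_Un_disjoint) auto
  ultimately have n: "CARD('n) = card ?F + card ?N" by simp
  have F: "card ?F \<le> 1"
    using card_le_Suc0_iff_eq[of ?F] fp by auto
  have "(\<Prod>i\<in>UNIV. if s i = i then a else b) = a ^ card ?F * b ^ card ?N"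
    by (simp add: prod.If_cases Collect_neg_eq[symmetric])
  also have "\<dots> = b ^ (CARD('n) - 1) * (if even CARD('n) then b else a)"
  proof (cases "card ?F = 0")
    case True
    then have "CARD('n) = card ?N" using n by simp
    moreover have "CARD('n) > 0" by simp
    ultimately show ?thesis
      using N True by (simp add: power_eq_if)
  next
    case False
    then have F1: "card ?F = 1" using F by linarith
    then have "CARD('n) = Suc (card ?N)" using n by linarith
    then show ?thesis unfolding F1 using N by simp
  qed
  finally show ?thesis .
qed

text \<open>With u = z + 1/z, a fixed index contributes (z + 1)(u - 2 + v^2), and a pair with
  coordinates a, b contributes (z - 1)^2 (u^2 - a b u + a^2 + b^2 - 4). The hypotheses on
  \<open>v\<close> say that these polynomials in u have the roots \<open>r\<close>.\<close>

lemma det_block_point: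
  fixes s :: "'n :: {finite, linorder} \<Rightarrow> 'n"
  assumes s: "\<And>i. s (s i) = i" and fp: "\<And>i j. s i = i \<Longrightarrow> s j = j \<Longrightarrow> i = j"
    and v: "\<And>i. s i = i \<Longrightarrow> v i ^ 2 = 2 - r i"
      "\<And>i. i < s i \<Longrightarrow> v i * v (s i) = r i + r (s i)"
      "\<And>i. i < s i \<Longrightarrow> v i ^ 2 + v (s i) ^ 2 = r i * r (s i) + 4"
    and z: "z \<noteq> 0"
  shows "peval (block_point s v) (det (Mmat z)) = (z - 1) ^ (CARD('n) - 1)
    * ((z + (- 1) ^ (CARD('n) + 1)) * (\<Prod>i\<in>UNIV. z + inverse z - r i))"
proof -
  let ?x = "block_point s v"
  let ?A = "\<chi> i j. peval ?x (Mev z i j)"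
  let ?f = "\<lambda>i. (if s i = i then z + 1 else z - 1) * (z + inverse z - r i)"
  have "peval ?x (det (Mmat z)) = det ?A"
    by (simp add: peval.hom_det Mmat_def)
  also have "\<dots> = (\<Prod>i | i \<le> s i. blk s ?A i)"
    by (rule det_involution_blocks[OF s]) (simp add: peval_Mev_block[OF s fp z])
  also have "\<dots> = (\<Prod>i | i \<le> s i. if s i = i then ?f i else ?f i * ?f (s i))"
  proof (rule prod.cong)
    fix i assume "i \<in> {i. i \<le> s i}"
    then have le: "i \<le> s i" by simp
    show "blk s ?A i = (if s i = i then ?f i else ?f i * ?f (s i))"
    proof (cases "s i = i")
      case True
      have "blk s ?A i = (z + 1) * (2 - r i) + (z - 1) ^ 2 * (z + 1) * inverse z"
        using True v(1)[OF True] by (simp add: blk_def peval_Mev_block[OF s fp z])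
      also have "\<dots> = ?f i"
        using z True by (simp add: field_simps power2_eq_square)
      finally show ?thesis using True by simp
    next
      case False
      then have lt: "i < s i" and nlt: "\<not> s i < i" "i \<noteq> s i" using le by auto
      let ?a = "v i" and ?b = "v (s i)" and ?d = "(z - 1) ^ 2 * (z + 1) * inverse z"
      have "blk s ?A i = ?d * ?d - (z - 1) * (z * ?a - ?b) * ((z - 1) * (?b - inverse z * ?a))"
        using False lt nlt by (simp add: blk_def peval_Mev_block[OF s fp z] s)
      also have "\<dots> = (z - 1) ^ 2 * ((z + inverse z) ^ 2 - 4 - (?a * ?b) * (z + inverse z) + (?a ^ 2 + ?b ^ 2))"
        using z by (simp add: field_simps power2_eq_square)
      also have "\<dots> = ?f i * ?f (s i)"
        unfolding v(2)[OF lt] v(3)[OF lt] using False by (simp add: s algebra_simps power2_eq_square)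
      finally show ?thesis using False by simp
    qed
  qed simp
  also have "\<dots> = (\<Prod>i\<in>UNIV. ?f i)"
    by (rule prod_involution[OF s])
  also have "\<dots> = (\<Prod>i\<in>UNIV. if s i = i then z + 1 else z - 1) * (\<Prod>i\<in>UNIV. z + inverse z - r i)"
    by (rule prod.distrib)
  also have "(\<Prod>i\<in>UNIV. if s i = i then z + 1 else z - 1) = (z - 1) ^ (CARD('n) - 1) * (if even CARD('n) then z - 1 else z + 1)"
    by (rule prod_fixed_points[OF s fp])
  finally show ?thesis by (simp add: mult.assoc)
qed

text \<open>For prescribed \<open>t\<close>, the expected generating function is z + \<tau> times a
  monic polynomial \<open>E\<close> of degree n in z + 1/z. Its roots are distributed over the
  matrix indices and realised by a point of the block subspace.\<close>

lemma generating_coefficients_surjective: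
  fixes H :: "('n :: {finite, linorder} \<times> 'n) cpoly poly" and t :: "nat \<Rightarrow> complex"
  assumes H: "det Pmat = (1 - [:0, 1:]) ^ (CARD('n) - 1) * H" "coeff H 0 = 1"
    and pal: "\<And>k. k \<le> 2 * CARD('n) + 1 \<Longrightarrow> coeff H (2 * CARD('n) + 1 - k) = (- 1) ^ (CARD('n) + 1) * coeff H k"
    and deg: "\<And>k. k > 2 * CARD('n) + 1 \<Longrightarrow> coeff H k = 0"
  shows "\<exists>x. \<forall>i\<in>{1..CARD('n)}. peval x (coeff H (CARD('n) + 1 - i)) = t i"
proof -
  let ?n = "CARD('n)"
  define \<tau> :: complex where "\<tau> = (- 1) ^ (?n + 1)"
  have \<tau>: "\<tau> * \<tau> = 1" by (simp add: \<tau>_def flip: power_mult_distrib)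
  obtain s :: "'n \<Rightarrow> 'n" where s: "\<And>i. s (s i) = i" and fp: "\<And>i j. s i = i \<Longrightarrow> s j = j \<Longrightarrow> i = j"
    using exists_involution[of "UNIV :: 'n set"] by auto
  \<comment> \<open>The first summand produces the extreme terms z^(n+1) and \<tau> z^(-n), the
    others the prescribed middle terms.\<close>
  define E where "E = cheb \<tau> (?n + 1) + (\<Sum>i = 1..?n. smult (t i) (cheb \<tau> i))"
  have low: "degree (smult (t i) (cheb \<tau> i)) \<le> ?n - 1" if "i \<in> {1..?n}" for i
    using that cheb_degree(1)[of \<tau> "i - 1"] degree_smult_le[of "t i" "cheb \<tau> i"] by auto
  then have low': "degree (\<Sum>i = 1..?n. smult (t i) (cheb \<tau> i)) \<le> ?n - 1"
    by (intro degree_sum_le) auto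
  have npos: "?n > 0" by simp
  have "coeff (\<Sum>i = 1..?n. smult (t i) (cheb \<tau> i)) ?n = 0"
    using low' npos by (intro coeff_eq_0) linarith
  then have c1: "coeff E ?n = 1"
    using cheb_degree(2)[of \<tau> ?n] by (simp add: E_def)
  have "degree E \<le> ?n"
    unfolding E_def using cheb_degree(1)[of \<tau> ?n] low' by (intro degree_add_le) auto
  then have "degree E = ?n"
    using c1 by (metis le_antisym le_degree zero_neq_one)
  then obtain r :: "'n \<Rightarrow> complex" where r: "E = (\<Prod>i\<in>UNIV. [:- r i, 1:])"
    using monic_complex_poly_factors[of "UNIV :: 'n set" E] c1 by auto
  have "\<exists>a b. a * b = r i + r (s i) \<and> a ^ 2 + b ^ 2 = r i * r (s i) + 4" for i
    by (rule sum_product_solvable)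
  then obtain a b where ab: "\<And>i. a i * b i = r i + r (s i)" "\<And>i. a i ^ 2 + b i ^ 2 = r i * r (s i) + 4"
    by metis
  \<comment> \<open>Both coordinates of a pair must come from the same solution, the one chosen for
    its smaller index.\<close>
  define v where "v i = (if s i = i then csqrt (2 - r i) else if i < s i then a i else b (s i))" for i
  have v: "\<And>i. s i = i \<Longrightarrow> v i ^ 2 = 2 - r i"
    "\<And>i. i < s i \<Longrightarrow> v i * v (s i) = r i + r (s i)"
    "\<And>i. i < s i \<Longrightarrow> v i ^ 2 + v (s i) ^ 2 = r i * r (s i) + 4"
    using ab by (auto simp: v_def s)
  define x where "x = block_point s v"
  define h where "h k = peval x (coeff H k)" for k
  have h0: "h 0 = 1" by (simp add: h_def H(2) peval.hom_one)
  have hpal: "h (2 * ?n + 1 - k) = \<tau> * h k" if "k \<le> 2 * ?n + 1" for k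
    unfolding h_def \<tau>_def pal[OF that] by (simp add: peval.hom_mult peval.hom_power peval.hom_uminus peval.hom_one)
  \<comment> \<open>The determinant is computed from \<open>H\<close> and from the blocks. Once (z -
    1)^(n-1) is cancelled, both sides have the same symmetry and the same extreme terms.\<close>
  have key: "(\<Sum>i = 1..?n. (h (?n + 1 - i) - t i) * (z ^ i + \<tau> * inverse z ^ (i - 1))) = 0" if "z \<notin> {0, 1}" for z
  proof -
    have z: "z \<noteq> 0" "z \<noteq> 1" using that by auto
    let ?y = "inverse z"
    have zy: "z * ?y = 1" using z by simp
    have "Const ((1 - ?y) ^ (?n - 1)) * poly H (Const ?y) = Const (?y ^ (2 * ?n)) * det (Mmat z)"
      using poly_det_Pmat[where 'n = 'n, of ?y] z unfolding H(1)
      by (simp add: Const.hom_power Const.hom_diff Const.hom_one)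
    then have "peval x (Const ((1 - ?y) ^ (?n - 1)) * poly H (Const ?y)) = peval x (Const (?y ^ (2 * ?n)) * det (Mmat z))"
      by simp
    moreover have "peval x (poly H (Const ?y)) = (\<Sum>k\<le>2 * ?n + 1. ?y ^ k * h k)"
    proof -
      have "poly H (Const ?y) = (\<Sum>k\<le>2 * ?n + 1. coeff H k * Const ?y ^ k)"
        unfolding poly_altdef
        by (rule sum.mono_neutral_left) (use deg in \<open>auto simp: coeff_eq_0 intro!: degree_le\<close>)
      then show ?thesis
        by (simp add: peval.hom_sum peval_simps peval.hom_power h_def mult.commute)
    qed
    ultimately have "(1 - ?y) ^ (?n - 1) * (\<Sum>k\<le>2 * ?n + 1. ?y ^ k * h k) = ?y ^ (2 * ?n) * peval x (det (Mmat z))"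
      by (simp add: peval_simps)
    then have e1: "z ^ (2 * ?n) * ((1 - ?y) ^ (?n - 1) * (\<Sum>k\<le>2 * ?n + 1. ?y ^ k * h k)) = peval x (det (Mmat z))"
      using z by (simp add: field_simps)
    have "2 * ?n = (?n - 1) + (?n + 1)" using npos by linarith
    then have e2: "z ^ (2 * ?n) = z ^ (?n - 1) * z ^ (?n + 1)" by (metis power_add)
    have e3: "(z - 1) ^ (?n - 1) = z ^ (?n - 1) * (1 - ?y) ^ (?n - 1)"
      using z by (simp add: right_diff_distrib flip: power_mult_distrib)
    have "(z - 1) ^ (?n - 1) * (z ^ (?n + 1) * (\<Sum>k\<le>2 * ?n + 1. ?y ^ k * h k)) = peval x (det (Mmat z))"
      unfolding e1[symmetric] e2 e3 by (simp only: mult_ac)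
    also have "\<dots> = (z - 1) ^ (?n - 1) * ((z + \<tau>) * (\<Prod>i\<in>UNIV. z + inverse z - r i))"
      unfolding x_def \<tau>_def by (rule det_block_point[of s v r z, OF s fp v z(1)])
    finally have "(z - 1) ^ (?n - 1) * (z ^ (?n + 1) * (\<Sum>k\<le>2 * ?n + 1. ?y ^ k * h k))
        = (z - 1) ^ (?n - 1) * ((z + \<tau>) * (\<Prod>i\<in>UNIV. z + inverse z - r i))" .
    then have "z ^ (?n + 1) * (\<Sum>k\<le>2 * ?n + 1. ?y ^ k * h k) = (z + \<tau>) * (\<Prod>i\<in>UNIV. z + inverse z - r i)"
      using z by simp
    also have "(\<Prod>i\<in>UNIV. z + inverse z - r i) = poly E (z + inverse z)"
      unfolding r by (simp add: poly_prod)
    also have "(z + \<tau>) * poly E (z + ?y) = (z + \<tau>) * poly (cheb \<tau> (?n + 1)) (z + ?y)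
        + (\<Sum>i = 1..?n. t i * ((z + \<tau>) * poly (cheb \<tau> i) (z + ?y)))"
      by (simp add: E_def poly_sum distrib_left sum_distrib_left mult_ac)
    also have "\<dots> = z ^ (?n + 1) + \<tau> * (z * ?y ^ (?n + 1)) + (\<Sum>i = 1..?n. t i * (z ^ i + \<tau> * (z * ?y ^ i)))"
      unfolding cheb_eval[OF \<tau> z(1)] by simp
    also have "z ^ (?n + 1) * (\<Sum>k\<le>2 * ?n + 1. ?y ^ k * h k) = z ^ (?n + 1) * h 0
        + (\<Sum>i = 1..?n. z ^ i * h (?n + 1 - i)) + (\<Sum>i = 1..?n. ?y ^ (i - 1) * h (?n + i)) + ?y ^ ?n * h (2 * ?n + 1)"
      by (rule laurent_split[OF zy])
    also have "h (2 * ?n + 1) = \<tau>"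
      using hpal[of 0] h0 by simp
    also have "(\<Sum>i = 1..?n. ?y ^ (i - 1) * h (?n + i)) = (\<Sum>i = 1..?n. ?y ^ (i - 1) * (\<tau> * h (?n + 1 - i)))"
    proof (rule sum.cong)
      fix i assume "i \<in> {1..?n}"
      then have "2 * ?n + 1 - (?n + 1 - i) = ?n + i" by auto
      then show "?y ^ (i - 1) * h (?n + i) = ?y ^ (i - 1) * (\<tau> * h (?n + 1 - i))"
        using hpal[of "?n + 1 - i"] by simp
    qed simp
    also have "(\<Sum>i = 1..?n. t i * (z ^ i + \<tau> * (z * ?y ^ i))) = (\<Sum>i = 1..?n. t i * (z ^ i + \<tau> * ?y ^ (i - 1)))"
    proof (rule sum.cong)
      fix i assume "i \<in> {1..?n}"
      then have "z * ?y ^ i = z * ?y * ?y ^ (i - 1)"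
        by (simp add: power_eq_if)
      then show "t i * (z ^ i + \<tau> * (z * ?y ^ i)) = t i * (z ^ i + \<tau> * ?y ^ (i - 1))"
        by (simp add: zy)
    qed simp
    finally have fin: "z ^ (?n + 1) * h 0 + (\<Sum>i = 1..?n. z ^ i * h (?n + 1 - i)) + (\<Sum>i = 1..?n. ?y ^ (i - 1) * (\<tau> * h (?n + 1 - i))) + ?y ^ ?n * \<tau>
      = z ^ (?n + 1) + \<tau> * (z * ?y ^ (?n + 1)) + (\<Sum>i = 1..?n. t i * (z ^ i + \<tau> * ?y ^ (i - 1)))" .
    have pw: "\<tau> * (z * ?y ^ (?n + 1)) = ?y ^ ?n * \<tau>"
      using z by simp
    have cancel: "A + B = C" if "w * 1 + A + B + e = w + e + C" for A B C e w :: complex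
      using that by simp
    have "(\<Sum>i = 1..?n. z ^ i * h (?n + 1 - i)) + (\<Sum>i = 1..?n. ?y ^ (i - 1) * (\<tau> * h (?n + 1 - i)))
      = (\<Sum>i = 1..?n. t i * (z ^ i + \<tau> * ?y ^ (i - 1)))"
      by (rule cancel[OF fin[unfolded h0 pw]])
    then show ?thesis
      by (simp add: algebra_simps sum_subtractf sum.distrib)
  qed
  \<comment> \<open>z^n times the sum in \<open>key\<close>. The exponents \<open>?n + i\<close>
    exceed n while \<open>?n + 1 - i\<close> do not, so the coefficient at \<open>?n + i\<close>
    isolates one difference.\<close>
  define Q where "Q = (\<Sum>i = 1..?n. smult (h (?n + 1 - i) - t i) (monom 1 (?n + i) + monom \<tau> (?n + 1 - i)))"
  have "poly Q z = 0" if "z \<notin> {0, 1}" for z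
  proof -
    have z: "z \<noteq> 0" using that by auto
    have "poly Q z = (\<Sum>i = 1..?n. z ^ ?n * ((h (?n + 1 - i) - t i) * (z ^ i + \<tau> * inverse z ^ (i - 1))))"
      unfolding Q_def poly_sum
    proof (rule sum.cong)
      fix i assume i: "i \<in> {1..?n}"
      then have "?n = (?n + 1 - i) + (i - 1)" by auto
      then have "z ^ ?n = z ^ (?n + 1 - i) * z ^ (i - 1)" by (metis power_add)
      then have "z ^ ?n * inverse z ^ (i - 1) = z ^ (?n + 1 - i)"
        using z by (simp add: power_inverse)
      then show "poly (smult (h (?n + 1 - i) - t i) (monom 1 (?n + i) + monom \<tau> (?n + 1 - i))) z
        = z ^ ?n * ((h (?n + 1 - i) - t i) * (z ^ i + \<tau> * inverse z ^ (i - 1)))"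
        by (simp add: poly_monom power_add distrib_left mult_ac)
    qed simp
    then show ?thesis using key[OF that] by (simp flip: sum_distrib_left)
  qed
  then have "UNIV - {0, 1} \<subseteq> {z. poly Q z = 0}" by auto
  moreover have "infinite (UNIV - {0, 1} :: complex set)"
    by (rule Diff_infinite_finite) (simp_all add: infinite_UNIV_char_0)
  ultimately have Q: "Q = 0"
    using finite_subset poly_roots_finite by blast
  have "h (?n + 1 - i) = t i" if i: "i \<in> {1..?n}" for i
  proof -
    have "0 = coeff Q (?n + i)" by (simp add: Q)
    also have "\<dots> = (\<Sum>l = 1..?n. if l = i then h (?n + 1 - l) - t l else 0)"
      unfolding Q_def coeff_sum by (rule sum.cong) (use i in auto)
    also have "\<dots> = h (?n + 1 - i) - t i" using i by simp
    finally show ?thesis by simp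
  qed
  then show ?thesis
    by (intro exI[of _ x]) (simp add: h_def)
qed

lemma eval_poly_cong:
  assumes "\<And>m v. m \<in> Poly_Mapping.keys p \<Longrightarrow> v \<in> Poly_Mapping.keys m \<Longrightarrow> f v = g v"
  shows "eval_poly c f p = eval_poly c g p"
  unfolding eval_poly_def mono_eval_def using assms by (intro sum.cong prod.cong arg_cong2[of _ _ _ _ "(*)"]) auto

lemma hom_poly_subst:
  fixes h :: "'w cpoly \<Rightarrow> 'r :: comm_ring_1" and p :: "'v cpoly"
  assumes c: "ring_homo c" and h: "ring_homo h" "\<And>a. h (Const a) = c a"
  shows "h (poly_subst f p) = eval_poly c (\<lambda>v. h (f v)) p"
  using hom_eq_eval_poly[OF c ring_homo_comp[OF h(1) ring_homo_eval_poly[OF ring_homo_Const]], of f p]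
  by (simp add: ring_homo_Const h(2) poly_subst_eq_eval)

lemma alg_indep_if_surjective:
  assumes "\<And>t. \<exists>x. \<forall>i\<in>I. peval x (f i) = t i"
  shows "alg_indep I f"
  unfolding alg_indep_def
proof (intro allI impI)
  fix Q :: "'a cpoly"
  assume keys: "\<forall>m\<in>Poly_Mapping.keys Q. Poly_Mapping.keys m \<subseteq> I" and Q: "poly_subst f Q = 0"
  show "Q = 0"
  proof (rule peval_zero_imp_zero)
    fix t
    obtain x where x: "\<forall>i\<in>I. peval x (f i) = t i" using assms by blast
    have "peval t Q = peval (\<lambda>i. peval x (f i)) Q"
      by (rule eval_poly_cong) (use x keys in \<open>force\<close>)
    also have "\<dots> = peval x (poly_subst f Q)"
      by (rule hom_poly_subst[OF ring_homo_id, symmetric])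
        (simp_all add: ring_homo_eval_poly ring_homo_id)
    finally show "peval t Q = 0" by (simp add: Q peval.hom_zero)
  qed
qed

section \<open>Algebraic dependence of too many polynomials\<close>

lemma linear_system_nontrivial_solution:
  fixes a :: "'e \<Rightarrow> 'u \<Rightarrow> complex"
  assumes "finite E" "finite U" "card E < card U"
  shows "\<exists>x. (\<exists>u\<in>U. x u \<noteq> 0) \<and> (\<forall>e\<in>E. (\<Sum>u\<in>U. a e u * x u) = 0)"
  using assms
proof (induction E arbitrary: U a rule: finite_induct)
  case empty
  then have "U \<noteq> {}" by auto
  then show ?case by (intro exI[of _ "\<lambda>_. 1"]) auto
next
  case (insert e E)
  show ?case
  proof (cases "\<forall>u\<in>U. a e u = 0")
    case True
    obtain x where x: "\<exists>u\<in>U. x u \<noteq> 0" "\<forall>e\<in>E. (\<Sum>u\<in>U. a e u * x u) = 0"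
      using insert.IH[of U a] insert.prems insert.hyps by auto
    have "(\<Sum>u\<in>U. a e u * x u) = 0"
      using True by (intro sum.neutral) auto
    then show ?thesis using x by (intro exI[of _ x]) auto
  next
    case False
    then obtain v where v: "v \<in> U" "a e v \<noteq> 0" by auto
    define U' where "U' = U - {v}"
    define a' where "a' e' u = a e' u - a e' v / a e v * a e u" for e' u
    have U': "finite U'" "U = insert v U'" "v \<notin> U'" using v insert.prems by (auto simp: U'_def)
    then have "card E < card U'" using insert.prems insert.hyps by simp
    then obtain x' where x': "\<exists>u\<in>U'. x' u \<noteq> 0" "\<forall>e\<in>E. (\<Sum>u\<in>U'. a' e u * x' u) = 0"
      using insert.IH[of U' a'] U' by auto
    define s where "s = (\<Sum>u\<in>U'. a e u * x' u)"
    define x where "x = x'(v := - s / a e v)"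
    have sum: "(\<Sum>u\<in>U. a e' u * x u) = a e' v * (- s / a e v) + (\<Sum>u\<in>U'. a e' u * x' u)" for e'
    proof -
      have "(\<Sum>u\<in>U'. a e' u * x u) = (\<Sum>u\<in>U'. a e' u * x' u)"
        using U'(3) by (intro sum.cong) (auto simp: x_def)
      then show ?thesis using U' by (simp add: x_def)
    qed
    have "(\<Sum>u\<in>U. a e' u * x u) = 0" if "e' \<in> insert e E" for e'
    proof (cases "e' = e")
      case True
      then show ?thesis unfolding sum using v by (simp add: s_def)
    next
      case False
      then have "(\<Sum>u\<in>U'. a' e' u * x' u) = 0" using that x'(2) by auto
      then have "(\<Sum>u\<in>U'. a e' u * x' u) = a e' v / a e v * s"
        by (simp add: a'_def s_def left_diff_distrib sum_subtractf sum_distrib_left mult.assoc)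
      then show ?thesis unfolding sum by simp
    qed
    moreover have "\<exists>u\<in>U. x u \<noteq> 0"
      using x'(1) U' by (auto simp: x_def)
    ultimately show ?thesis by blast
  qed
qed

definition exps :: "'v set \<Rightarrow> ('v \<Rightarrow> nat) \<Rightarrow> ('v \<Rightarrow>\<^sub>0 nat)" where
  "exps V k = (\<Sum>v\<in>V. Poly_Mapping.single v (k v))"

lemma lookup_exps: "finite V \<Longrightarrow> Poly_Mapping.lookup (exps V k) v = (if v \<in> V then k v else 0)"
  by (simp add: exps_def lookup_sum lookup_single when_def)

text \<open>Each exponent is bounded separately, rather than the total degree, so the admissible
  monomials form a cube and are counted by a power.\<close>

definition bounded_exponents :: "'v set \<Rightarrow> nat \<Rightarrow> 'v cpoly \<Rightarrow> bool" where
  "bounded_exponents V N p \<longleftrightarrow>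
    (\<forall>m\<in>Poly_Mapping.keys p. Poly_Mapping.keys m \<subseteq> V \<and> (\<forall>v. Poly_Mapping.lookup m v \<le> N))"

lemma bounded_exponents_mult:
  assumes "bounded_exponents V N p" "bounded_exponents V M q"
  shows "bounded_exponents V (N + M) (p * q)"
  unfolding bounded_exponents_def
proof
  fix m assume "m \<in> Poly_Mapping.keys (p * q)"
  then obtain a b where ab: "m = a + b" "a \<in> Poly_Mapping.keys p" "b \<in> Poly_Mapping.keys q"
    using keys_mult[of p q] by auto
  have "Poly_Mapping.keys a \<subseteq> V" "Poly_Mapping.keys b \<subseteq> V"
    "\<And>v. Poly_Mapping.lookup a v \<le> N" "\<And>v. Poly_Mapping.lookup b v \<le> M"
    using assms ab(2,3) unfolding bounded_exponents_def by blast+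
  then show "Poly_Mapping.keys m \<subseteq> V \<and> (\<forall>v. Poly_Mapping.lookup m v \<le> N + M)"
    using keys_add[of a b] unfolding ab(1) lookup_add by (blast intro: add_mono)
qed

lemma bounded_exponents_1: "bounded_exponents V N 1"
  by (simp add: bounded_exponents_def)

lemma bounded_exponents_power: "bounded_exponents V N p \<Longrightarrow> bounded_exponents V (k * N) (p ^ k)"
  by (induction k) (auto intro: bounded_exponents_1 bounded_exponents_mult)

lemma bounded_exponents_prod:
  "(\<And>i. i \<in> I \<Longrightarrow> bounded_exponents V N (f i)) \<Longrightarrow> bounded_exponents V (card I * N) (prod f I)"
  by (induction I rule: infinite_finite_induct) (auto intro: bounded_exponents_1 bounded_exponents_mult)

lemma bounded_exponents_mono: "bounded_exponents V N p \<Longrightarrow> N \<le> M \<Longrightarrow> bounded_exponents V M p"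
  unfolding bounded_exponents_def by (meson order_trans)

text \<open>Counting: with r = \<open>card I\<close> and n = \<open>card V\<close>, the (K + 1)^r
  products of powers up to K lie in a space spanned by (N + 1)^n monomials with N linear in K. As r
  > n, a large K forces a linear relation among the products, and its coefficients form the
  polynomial \<open>Q\<close>.\<close>

lemma not_alg_indep_if_few_variables:
  fixes f :: "'i \<Rightarrow> 'v cpoly"
  assumes I: "finite I" and V: "finite V" and card: "card V < card I"
    and f: "\<And>i m. i \<in> I \<Longrightarrow> m \<in> Poly_Mapping.keys (f i) \<Longrightarrow> Poly_Mapping.keys m \<subseteq> V"
  shows "\<not> alg_indep I f"
proof
  assume indep: "alg_indep I f"
  let ?r = "card I" and ?n = "card V"
  have "\<exists>D. \<forall>i\<in>I. bounded_exponents V D (f i)"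
  proof -
    define D where "D = (\<Sum>i\<in>I. \<Sum>m\<in>Poly_Mapping.keys (f i). \<Sum>v\<in>V. Poly_Mapping.lookup m v)"
    have "Poly_Mapping.lookup m v \<le> D" if "i \<in> I" "m \<in> Poly_Mapping.keys (f i)" for i m v
    proof (cases "v \<in> V")
      case True
      then have "Poly_Mapping.lookup m v \<le> (\<Sum>v\<in>V. Poly_Mapping.lookup m v)"
        using V by (intro member_le_sum) auto
      also have "\<dots> \<le> (\<Sum>m\<in>Poly_Mapping.keys (f i). \<Sum>v\<in>V. Poly_Mapping.lookup m v)"
        using that by (intro member_le_sum[of m "Poly_Mapping.keys (f i)" "\<lambda>m. \<Sum>v\<in>V. Poly_Mapping.lookup m v"]) auto
      also have "\<dots> \<le> D"
        unfolding D_def using that I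
        by (intro member_le_sum[of i I "\<lambda>i. \<Sum>m\<in>Poly_Mapping.keys (f i). \<Sum>v\<in>V. Poly_Mapping.lookup m v"]) auto
      finally show ?thesis .
    next
      case False
      then have "v \<notin> Poly_Mapping.keys m" using f[OF that] by auto
      then show ?thesis by (simp add: in_keys_iff)
    qed
    then show ?thesis using f unfolding bounded_exponents_def by blast
  qed
  then obtain D where D: "\<And>i. i \<in> I \<Longrightarrow> bounded_exponents V D (f i)" by blast
  \<comment> \<open>Chosen so that (N + 1)^n is at most ((D r + 1)(K + 1))^n = K (K + 1)^n, which is
    less than (K + 1)^(n+1).\<close>
  define K where "K = (D * ?r + 1) ^ ?n"
  define N where "N = ?r * (K * D)"
  define U where "U = PiE I (\<lambda>_. {..K})"
  define E where "E = exps V ` PiE V (\<lambda>_. {..N})"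
  define P where "P k = (\<Prod>i\<in>I. f i ^ k i)" for k
  have fin: "finite U" "finite E"
    unfolding U_def E_def using I V by (auto intro!: finite_PiE)
  have "card U = (K + 1) ^ ?r"
    unfolding U_def using I by (simp add: card_PiE)
  moreover have "card E \<le> (N + 1) ^ ?n"
    unfolding E_def using V by (intro order_trans[OF card_image_le]) (auto intro!: finite_PiE simp: card_PiE)
  moreover have "(N + 1) ^ ?n < (K + 1) ^ ?r"
  proof -
    have "(N + 1) ^ ?n \<le> ((D * ?r + 1) * (K + 1)) ^ ?n"
      by (rule power_mono) (auto simp: N_def algebra_simps)
    also have "\<dots> = K * (K + 1) ^ ?n"
      by (simp only: power_mult_distrib K_def)
    also have "\<dots> < (K + 1) * (K + 1) ^ ?n" by simp
    also have "\<dots> = (K + 1) ^ (?n + 1)" by simp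
    also have "\<dots> \<le> (K + 1) ^ ?r"
      using card by (intro power_increasing) auto
    finally show ?thesis .
  qed
  ultimately have "card E < card U" by linarith
  from linear_system_nontrivial_solution[OF fin(2,1) this, of "\<lambda>m k. Poly_Mapping.lookup (P k) m"]
  obtain x where x: "\<exists>k\<in>U. x k \<noteq> 0" "\<And>m. m \<in> E \<Longrightarrow> (\<Sum>k\<in>U. Poly_Mapping.lookup (P k) m * x k) = 0"
    by blast
  have P: "m \<in> E" if "k \<in> U" "m \<in> Poly_Mapping.keys (P k)" for k m
  proof -
    have "bounded_exponents V N (P k)"
      unfolding P_def N_def
    proof (rule bounded_exponents_prod)
      fix i assume "i \<in> I"
      then have "k i \<le> K" using that(1) by (auto simp: U_def)
      then show "bounded_exponents V (K * D) (f i ^ k i)"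
        using bounded_exponents_mono[OF bounded_exponents_power[OF D[OF \<open>i \<in> I\<close>]]] by simp
    qed
    then have m: "Poly_Mapping.keys m \<subseteq> V" "\<And>v. Poly_Mapping.lookup m v \<le> N"
      using that(2) by (auto simp: bounded_exponents_def)
    have "m = exps V (restrict (Poly_Mapping.lookup m) V)"
    proof (rule poly_mapping_eqI)
      fix v
      show "Poly_Mapping.lookup m v = Poly_Mapping.lookup (exps V (restrict (Poly_Mapping.lookup m) V)) v"
        using m(1) V by (cases "v \<in> V") (auto simp: lookup_exps in_keys_iff)
    qed
    moreover have "restrict (Poly_Mapping.lookup m) V \<in> PiE V (\<lambda>_. {..N})"
      using m(2) by auto
    ultimately show ?thesis unfolding E_def by blast
  qed
  define Q where "Q = (\<Sum>k\<in>U. Poly_Mapping.single (exps I k) (x k))"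
  have "Poly_Mapping.lookup Q (exps I k) = x k" if "k \<in> U" for k
  proof -
    have "exps I l = exps I k \<longleftrightarrow> l = k" if "l \<in> U" for l
    proof
      assume "exps I l = exps I k"
      then have "l i = k i" if "i \<in> I" for i
        using that I by (metis lookup_exps)
      then show "l = k"
        using \<open>l \<in> U\<close> \<open>k \<in> U\<close> unfolding U_def by (intro PiE_ext) auto
    qed simp
    then have "Poly_Mapping.lookup Q (exps I k) = (\<Sum>l\<in>U. if l = k then x l else 0)"
      unfolding Q_def lookup_sum by (intro sum.cong) (auto simp: lookup_single when_def)
    then show ?thesis using that fin by simp
  qed
  then have "Q \<noteq> 0" using x(1) by (metis lookup_zero)
  moreover have "poly_subst f Q = 0"
  proof -
    have mono: "mono_eval f (exps I k) = P k" for k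
      unfolding P_def using I
      by (subst mono_eval_superset[of I]) (auto simp: lookup_exps in_keys_iff split: if_splits)
    have "poly_subst f Q = (\<Sum>k\<in>U. Const (x k) * P k)"
      unfolding Q_def poly_subst_eq_eval
      by (simp add: eval_poly_sum[OF ring_homo_Const] eval_poly_single[OF ring_homo_Const] mono)
    moreover have "Poly_Mapping.lookup (\<Sum>k\<in>U. Const (x k) * P k) m = 0" for m
    proof (cases "m \<in> E")
      case True
      then show ?thesis
        using x(2)[of m] unfolding lookup_sum lookup_Const_mult by (simp add: mult.commute)
    next
      case False
      then have "Poly_Mapping.lookup (P k) m = 0" if "k \<in> U" for k
        using P[OF that] by (auto simp: in_keys_iff)
      then show ?thesis by (simp add: lookup_sum lookup_Const_mult)
    qed
    ultimately show ?thesis by (simp add: poly_mapping_eq_iff fun_eq_iff)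
  qed
  moreover have "\<forall>m\<in>Poly_Mapping.keys Q. Poly_Mapping.keys m \<subseteq> I"
  proof
    fix m assume "m \<in> Poly_Mapping.keys Q"
    then obtain k where "k \<in> U" "m \<in> Poly_Mapping.keys (Poly_Mapping.single (exps I k) (x k))"
      unfolding Q_def using keys_sum[of "\<lambda>k. Poly_Mapping.single (exps I k) (x k)" U] by auto
    then have "m = exps I k" by (auto split: if_splits)
    then show "Poly_Mapping.keys m \<subseteq> I"
      using I by (auto simp: in_keys_iff lookup_exps split: if_splits)
  qed
  ultimately show False using indep unfolding alg_indep_def by blast
qed

section \<open>Partial derivatives and expansion at a point\<close>

lift_definition pd :: "'v \<Rightarrow> 'v cpoly \<Rightarrow> 'v cpoly" is
  "\<lambda>u f m. of_nat (Poly_Mapping.lookup m u + 1) * f (m + Poly_Mapping.single u 1)"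
proof -
  fix u :: 'v and f :: "('v \<Rightarrow>\<^sub>0 nat) \<Rightarrow> complex"
  assume "finite {m. f m \<noteq> 0}"
  then have "finite ((\<lambda>m. m + Poly_Mapping.single u 1) -` {m. f m \<noteq> 0})"
    by (rule finite_vimageI) (simp add: inj_def)
  then show "finite {m. of_nat (Poly_Mapping.lookup m u + 1) * f (m + Poly_Mapping.single u 1) \<noteq> 0}"
    by (rule finite_subset[rotated]) auto
qed

lemma lookup_pd:
  "Poly_Mapping.lookup (pd u f) m = of_nat (Poly_Mapping.lookup m u + 1) * Poly_Mapping.lookup f (m + Poly_Mapping.single u 1)"
  by (simp add: pd.rep_eq)

lemma pd_add: "pd u (f + g) = pd u f + pd u g"
  by (rule poly_mapping_eqI) (simp add: lookup_pd lookup_add ring_distribs)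

lemma pd_0: "pd u 0 = 0"
  using pd_add[of u 0 0] by simp

lemma pd_sum: "pd u (sum f A) = (\<Sum>x\<in>A. pd u (f x))"
  by (induction A rule: infinite_finite_induct) (simp_all add: pd_0 pd_add)

text \<open>The subtraction of exponents is truncated, which is harmless: when \<open>u\<close> does
  not occur in \<open>k\<close>, the factor \<open>lookup k u\<close> is zero. The same remark
  justifies \<open>shift\<close> in \<open>pd_mult\<close>.\<close>

lemma pd_single:
  "pd u (Poly_Mapping.single k a) = Poly_Mapping.single (k - Poly_Mapping.single u 1) (of_nat (Poly_Mapping.lookup k u) * a)"
proof (rule poly_mapping_eqI)
  fix m :: "'a \<Rightarrow>\<^sub>0 nat"
  let ?e = "Poly_Mapping.single u (1 :: nat)"
  show "Poly_Mapping.lookup (pd u (Poly_Mapping.single k a)) m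
      = Poly_Mapping.lookup (Poly_Mapping.single (k - ?e) (of_nat (Poly_Mapping.lookup k u) * a)) m"
  proof (cases "Poly_Mapping.lookup k u = 0")
    case True
    have "Poly_Mapping.lookup (m + ?e) u \<noteq> 0"
      by (simp add: lookup_add)
    then have "k \<noteq> m + ?e" using True by metis
    then show ?thesis by (simp add: lookup_pd True lookup_single_not_eq)
  next
    case False
    have "k = (k - ?e) + ?e"
      by (rule poly_mapping_eqI) (use False in \<open>auto simp: lookup_add lookup_minus lookup_single when_def\<close>)
    then have iff: "k = m + ?e \<longleftrightarrow> k - ?e = m"
      by (metis add_diff_cancel_right')
    show ?thesis
    proof (cases "k - ?e = m")
      case True
      then have k: "k = m + ?e" using iff by simp
      have "Poly_Mapping.lookup k u = Poly_Mapping.lookup m u + 1"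
        unfolding k by (simp add: lookup_add)
      moreover have "Poly_Mapping.lookup (Poly_Mapping.single k a) (m + ?e) = a"
        unfolding k by simp
      ultimately show ?thesis unfolding True lookup_pd by simp
    next
      case False
      then show ?thesis using iff by (simp add: lookup_pd lookup_single_not_eq)
    qed
  qed
qed

lemma pd_mult: "pd u (f * g) = f * pd u g + pd u f * g"
proof -
  let ?e = "Poly_Mapping.single u (1 :: nat)"
  have shift: "Poly_Mapping.single (k + (l - ?e)) (of_nat (Poly_Mapping.lookup l u) * c)
    = Poly_Mapping.single (k + l - ?e) (of_nat (Poly_Mapping.lookup l u) * c)" for k l and c :: complex
  proof (cases "Poly_Mapping.lookup l u = 0")
    case False
    have "k + (l - ?e) = k + l - ?e"
      by (rule poly_mapping_eqI) (use False in \<open>auto simp: lookup_add lookup_minus lookup_single when_def\<close>)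
    then show ?thesis by simp
  qed simp
  have single: "pd u (Poly_Mapping.single k a * Poly_Mapping.single l b)
      = Poly_Mapping.single k a * pd u (Poly_Mapping.single l b) + pd u (Poly_Mapping.single k a) * Poly_Mapping.single l b" for k l a b
  proof -
    have "Poly_Mapping.single k a * pd u (Poly_Mapping.single l b) = Poly_Mapping.single (k + l - ?e) (of_nat (Poly_Mapping.lookup l u) * (a * b))"
      using shift[of k l "a * b"] by (simp add: pd_single mult_single mult_ac)
    moreover have "pd u (Poly_Mapping.single k a) * Poly_Mapping.single l b = Poly_Mapping.single (k + l - ?e) (of_nat (Poly_Mapping.lookup k u) * (a * b))"
      using shift[of l k "a * b"] by (simp add: pd_single mult_single mult_ac add.commute)
    ultimately show ?thesis
      by (simp add: mult_single pd_single lookup_add ring_distribs add.commute flip: single_add)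
  qed
  let ?F = "\<lambda>f m. Poly_Mapping.single m (Poly_Mapping.lookup f m)"
  have "pd u (sum (?F f) A * sum (?F g) C) = sum (?F f) A * pd u (sum (?F g) C) + pd u (sum (?F f) A) * sum (?F g) C" for A C
    by (simp add: pd_sum sum_product single sum.distrib) 
  from this[of "Poly_Mapping.keys f" "Poly_Mapping.keys g"] show ?thesis
    unfolding cpoly_sum_singles[symmetric] .
qed

lemma pd_Const: "pd u (Const a) = 0"
  by (simp add: Const_def pd_single)

lemma pd_Var: "pd u (Var v) = (if u = v then 1 else 0)"
  by (simp add: Var_def pd_single lookup_single)

lemma pd_eq_0_imp_lookup_eq_0:
  assumes "pd u h = 0" "m \<in> Poly_Mapping.keys h"
  shows "Poly_Mapping.lookup m u = 0"
proof (rule ccontr)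
  let ?e = "Poly_Mapping.single u (1 :: nat)"
  assume "Poly_Mapping.lookup m u \<noteq> 0"
  then have "m = (m - ?e) + ?e"
    by (intro poly_mapping_eqI) (auto simp: lookup_add lookup_minus lookup_single when_def)
  moreover have "of_nat (Poly_Mapping.lookup (m - ?e) u + 1) * Poly_Mapping.lookup h ((m - ?e) + ?e) = 0"
    using assms(1) lookup_pd[of u h "m - ?e"] by simp
  moreover have "of_nat (Poly_Mapping.lookup (m - ?e) u + 1) \<noteq> (0 :: complex)"
    by (simp only: of_nat_eq_0_iff)
  ultimately have "Poly_Mapping.lookup h m = 0" by simp
  then show False using assms(2) by (simp add: in_keys_iff)
qed

lemma (in poisson_algebra) chain_rule:
  fixes f y :: "'v cpoly"
  assumes "finite (UNIV :: 'v set)"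
  shows "B f y = (\<Sum>u\<in>UNIV. pd u f * B (Var u) y)"
proof (induction f rule: cpoly_induct)
  case (Var v)
  have "(\<Sum>u\<in>UNIV. pd u (Var v) * B (Var u) y) = (\<Sum>u\<in>UNIV. if u = v then B (Var u) y else 0)"
    by (intro sum.cong) (auto simp: pd_Var)
  then show ?case using assms by simp
next
  case (mult p q)
  then show ?case
    by (simp add: mult_left pd_mult ring_distribs sum.distrib sum_distrib_left sum_distrib_right mult_ac)
qed (simp_all add: Const_zero pd_Const add_left pd_add ring_distribs sum.distrib)

section \<open>Expansion along a curve through the origin\<close>

definition c0 :: "'v cpoly \<Rightarrow> complex" where
  "c0 = peval (\<lambda>_. 0)"

interpretation c0: ring_homo c0
  unfolding c0_def by (rule ring_homo_eval_poly[OF ring_homo_id])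

lemma c0_simps [simp]: "c0 (Const a) = a" "c0 (Var v) = 0" "c0 (Ghat i j) = 0"
  by (simp_all add: c0_def ring_homo_id Ghat_def)

text \<open>The linear part of \<open>f\<close> at the origin, applied to the vector
  \<open>p\<close>.\<close>

definition c1 :: "('v :: finite \<Rightarrow> complex) \<Rightarrow> 'v cpoly \<Rightarrow> complex" where
  "c1 p f = (\<Sum>u\<in>UNIV. c0 (pd u f) * p u)"

lemma c1_simps:
  "c1 p (Const a) = 0" "c1 p (Var u) = p u" "c1 p (f + g) = c1 p f + c1 p g"
  "c1 p (f * g) = c0 f * c1 p g + c1 p f * c0 g"
proof -
  show "c1 p (Var u) = p u"
  proof -
    have "c1 p (Var u) = (\<Sum>v\<in>UNIV. if v = u then p v else 0)"
      unfolding c1_def by (intro sum.cong) (auto simp: pd_Var c0.hom_one c0.hom_zero)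
    then show ?thesis by simp
  qed
qed (simp_all add: c1_def pd_Const pd_add pd_mult c0.hom_zero c0.hom_add c0.hom_mult sum.distrib
    sum_distrib_left sum_distrib_right ring_distribs mult_ac)

text \<open>\<open>expand p f\<close> is $f(tp+t^2x)$ as a polynomial in $t$.\<close>

definition expand :: "('v \<Rightarrow> complex) \<Rightarrow> 'v cpoly \<Rightarrow> 'v cpoly poly" where
  "expand p = eval_poly (\<lambda>a. [:Const a:]) (\<lambda>u. [:0, Const (p u), Var u:])"

lemma ring_homo_Const_poly: "ring_homo (\<lambda>a. [:Const a:])"
  by unfold_locales (simp_all add: Const.hom_add Const.hom_mult Const.hom_one one_pCons)

interpretation expand: ring_homo "expand p"
  unfolding expand_def by (rule ring_homo_eval_poly[OF ring_homo_Const_poly])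

lemma expand_gen [simp]: "expand p (Const a) = [:Const a:]" "expand p (Var u) = [:0, Const (p u), Var u:]"
  by (simp_all add: expand_def ring_homo_Const_poly)

lemma coeff_expand_0: "coeff (expand p f) 0 = Const (c0 f)"
  by (induction f rule: cpoly_induct)
    (simp_all add: Const.hom_zero expand.hom_add expand.hom_mult c0.hom_add c0.hom_mult Const.hom_add Const.hom_mult
      coeff_mult_0)

text \<open>The variables enter the curve only with t^2, so the coefficient of t is still a
  constant. This is what freezes the linear part of the bracket at \<open>p\<close>.\<close>

lemma coeff_expand_1: "coeff (expand p f) (Suc 0) = Const (c1 p f)"
  by (induction f rule: cpoly_induct)
    (simp_all add: Const.hom_zero expand.hom_add expand.hom_mult c1_simps Const.hom_add Const.hom_mult
      coeff_mult coeff_expand_0)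

text \<open>The chain rule: the inner derivative of t p + t^2 x in the direction of a variable is
  t^2.\<close>

lemma pd_coeff_expand: "pd u (coeff (expand p f) k) = coeff (monom 1 2 * expand p (pd u f)) k"
proof (induction f arbitrary: k rule: cpoly_induct)
  case (Const a)
  show ?case by (cases k) (simp_all add: pd_Const pd_0 expand.hom_zero)
next
  case (Var v)
  have "k = 0 \<or> k = Suc 0 \<or> k = Suc (Suc 0) \<or> k > 2" by linarith
  then show ?case
    by (auto simp: pd_Var pd_0 pd_Const expand.hom_one expand.hom_zero coeff_pCons coeff_monom_mult numeral_2_eq_2 split: nat.splits)
next
  case (add f g)
  then show ?case by (simp add: expand.hom_add pd_add distrib_left)
next
  case (mult f g)
  let ?F = "expand p f" and ?G = "expand p g" and ?t = "monom 1 2 :: 'a cpoly poly"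
  have "pd u (coeff (expand p (f * g)) k) = (\<Sum>i\<le>k. coeff ?F i * coeff (?t * expand p (pd u g)) (k - i)
      + coeff (?t * expand p (pd u f)) i * coeff ?G (k - i))"
    by (simp only: expand.hom_mult coeff_mult[of ?F ?G] pd_sum pd_mult mult)
  also have "\<dots> = coeff (?F * (?t * expand p (pd u g)) + (?t * expand p (pd u f)) * ?G) k"
    by (simp only: coeff_add coeff_mult[of ?F] coeff_mult[of _ ?G] sum.distrib)
  also have "?F * (?t * expand p (pd u g)) + (?t * expand p (pd u f)) * ?G = ?t * expand p (pd u (f * g))"
    by (simp add: pd_mult expand.hom_add expand.hom_mult algebra_simps)
  finally show ?case .
qed

text \<open>At t = 1 the expansion is f(p + x), from which a translation by \<open>p\<close>
  recovers the values of \<open>f\<close>.\<close>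

lemma expand_eq_0_iff: "expand p f = 0 \<longleftrightarrow> f = 0"
proof
  assume 0: "expand p f = 0"
  show "f = 0"
  proof (rule peval_zero_imp_zero)
    fix x
    define h where "h = (\<lambda>f. peval (\<lambda>u. x u - p u) (poly (expand p f) 1))"
    have h: "ring_homo h"
      unfolding h_def
      by (unfold_locales; simp add: expand.hom_add expand.hom_mult expand.hom_one peval.hom_add peval.hom_mult peval.hom_one)
    have "h (Const a) = a" for a
      by (simp add: h_def ring_homo_id)
    then have "h f = peval (\<lambda>u. h (Var u)) f"
      by (intro hom_eq_eval_poly ring_homo_id h)
    moreover have "h (Var u) = x u" for u
      by (simp add: h_def ring_homo_id peval.hom_add)
    ultimately show "peval x f = 0"
      using 0 by (simp add: h_def peval.hom_zero)
  qed
qed (simp add: expand.hom_zero)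

definition restrict_vars :: "'v set \<Rightarrow> 'v cpoly \<Rightarrow> 'v cpoly" where
  "restrict_vars L = poly_subst (\<lambda>u. if u \<in> L then Var u else 0)"

interpretation restrict_vars: ring_homo "restrict_vars L"
  unfolding restrict_vars_def poly_subst_eq_eval by (rule ring_homo_eval_poly[OF ring_homo_Const])

lemma restrict_vars_gen [simp]: "restrict_vars L (Const a) = Const a"
  "restrict_vars L (Var u) = (if u \<in> L then Var u else 0)"
  by (simp_all add: restrict_vars_def poly_subst_eq_eval ring_homo_Const)

lemma restrict_coeff_expand:
  assumes "\<And>u. u \<notin> L \<Longrightarrow> p u = 0"
  shows "restrict_vars L (coeff (expand p f) k) = coeff (expand p (restrict_vars L f)) k"
proof (induction f arbitrary: k rule: cpoly_induct)
  case (Const a)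
  show ?case by (cases k) (simp_all add: restrict_vars.hom_zero)
next
  case (Var v)
  show ?case
    by (auto simp: assms Const.hom_zero restrict_vars.hom_zero coeff_pCons expand.hom_zero split: nat.splits)
next
  case (mult f g)
  then show ?case
    by (simp add: expand.hom_mult restrict_vars.hom_mult restrict_vars.hom_sum coeff_mult)
qed (simp add: expand.hom_add restrict_vars.hom_add)

lemma restrict_vars_id:
  assumes "\<And>u. u \<notin> L \<Longrightarrow> pd u h = 0"
  shows "restrict_vars L h = h"
proof -
  have "restrict_vars L h = eval_poly Const Var h"
    unfolding restrict_vars_def poly_subst_eq_eval
  proof (rule eval_poly_cong)
    fix m v assume "m \<in> Poly_Mapping.keys h" "v \<in> Poly_Mapping.keys m"
    then have "v \<in> L"
      using pd_eq_0_imp_lookup_eq_0[of v h m] assms by (auto simp: in_keys_iff)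
    then show "(if v \<in> L then Var v else 0) = Var v" by simp
  qed
  also have "\<dots> = h"
    using hom_eq_eval_poly[OF ring_homo_Const ring_homo_id, of h] by simp
  finally show ?thesis .
qed

lemma keys_restrict_vars:
  assumes "m \<in> Poly_Mapping.keys (restrict_vars L f)"
  shows "Poly_Mapping.keys m \<subseteq> L"
proof -
  have "\<forall>m\<in>Poly_Mapping.keys (restrict_vars L f). Poly_Mapping.keys m \<subseteq> L"
  proof (induction f rule: cpoly_induct)
    case (add f g)
    then show ?case
      using keys_add[of "restrict_vars L f" "restrict_vars L g"] by (auto simp: restrict_vars.hom_add)
  next
    case (mult f g)
    show ?case
    proof
      fix m assume "m \<in> Poly_Mapping.keys (restrict_vars L (f * g))"
      then obtain a b where ab: "m = a + b" "a \<in> Poly_Mapping.keys (restrict_vars L f)" "b \<in> Poly_Mapping.keys (restrict_vars L g)"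
        using keys_mult[of "restrict_vars L f" "restrict_vars L g"] by (auto simp: restrict_vars.hom_mult)
      then show "Poly_Mapping.keys m \<subseteq> L"
        using mult keys_add[of a b] by blast
    qed
  next
    case (Const a)
    show ?case unfolding restrict_vars_gen by (simp add: Const_def split: if_splits)
  next
    case (Var v)
    show ?case unfolding restrict_vars_gen by (simp add: Var_def split: if_splits)
  qed
  then show ?thesis using assms by blast
qed

text \<open>If \<open>f\<close> Poisson commutes with \<open>y\<close> and the bracket vanishes at the origin, then the lowest
  coefficient of \<open>f(tp + t\<^sup>2x)\<close> is killed by the vector field that \<open>y\<close> generates for the linear part
  of the bracket, frozen at \<open>p\<close>.\<close>

lemma lowest_coeff_expand:
  fixes p :: "'v :: finite \<Rightarrow> complex"
  assumes B: "is_poisson_bracket B" and f: "B f y = 0" and c0: "\<And>u. c0 (B (Var u) y) = 0" and low: "\<And>i. i < k \<Longrightarrow> coeff (expand p f) i = 0"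
  shows "(\<Sum>u\<in>UNIV. pd u (coeff (expand p f) k) * Const (c1 p (B (Var u) y))) = 0"
proof -
  interpret poisson_algebra B by unfold_locales (rule B)
  let ?t = "monom 1 2 :: 'v cpoly poly" and ?b = "\<lambda>u. expand p (B (Var u) y)"
  have "(\<Sum>u\<in>UNIV. (?t * expand p (pd u f)) * ?b u) = ?t * expand p (B f y)"
    unfolding chain_rule[OF finite_class.finite_UNIV, of f y]
    by (simp add: expand.hom_sum expand.hom_mult sum_distrib_left mult.assoc)
  \<comment> \<open>At exponent \<open>Suc k\<close> only i = k survives: smaller i vanish by
    \<open>low\<close>, and i = k + 1 meets the constant term of the bracket, which is 0.\<close>
  then have "0 = coeff (\<Sum>u\<in>UNIV. (?t * expand p (pd u f)) * ?b u) (Suc k)"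
    using f by (simp add: expand.hom_zero)
  also have "\<dots> = (\<Sum>u\<in>UNIV. \<Sum>i\<le>Suc k. pd u (coeff (expand p f) i) * coeff (?b u) (Suc k - i))"
    by (simp only: coeff_sum coeff_mult[of "?t * _"] pd_coeff_expand)
  also have "\<dots> = (\<Sum>u\<in>UNIV. pd u (coeff (expand p f) k) * Const (c1 p (B (Var u) y)))"
  proof (rule sum.cong)
    fix u :: 'v
    have "(\<Sum>i\<le>Suc k. pd u (coeff (expand p f) i) * coeff (?b u) (Suc k - i))
        = (\<Sum>i\<le>Suc k. if i = k then pd u (coeff (expand p f) k) * Const (c1 p (B (Var u) y)) else 0)"
    proof (rule sum.cong)
      fix i assume "i \<in> {..Suc k}"
      then have "i < k \<or> i = k \<or> i = Suc k" by auto
      then show "pd u (coeff (expand p f) i) * coeff (?b u) (Suc k - i)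
          = (if i = k then pd u (coeff (expand p f) k) * Const (c1 p (B (Var u) y)) else 0)"
        by (auto simp: low pd_0 coeff_expand_0 coeff_expand_1 c0 Const.hom_zero)
    qed simp
    then show "(\<Sum>i\<le>Suc k. pd u (coeff (expand p f) i) * coeff (?b u) (Suc k - i))
        = pd u (coeff (expand p f) k) * Const (c1 p (B (Var u) y))"
      by simp
  qed simp
  finally show ?thesis ..
qed

text \<open>\<open>nondeg\<close> is applied to the gradient of the lowest coefficient
  \<open>h\<close> at every point. So \<open>h\<close> involves only variables in \<open>L\<close>
  and equals its own restriction, which vanishes with that of \<open>f\<close> because
  \<open>p\<close> lies in the subspace of \<open>L\<close>.\<close>

lemma eq_0_if_restriction_eq_0:
  fixes p :: "'v :: finite \<Rightarrow> complex"
  assumes B: "is_poisson_bracket B" and c0: "\<And>f g. c0 (B f g) = 0" and p: "\<And>u. u \<notin> L \<Longrightarrow> p u = 0"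
    and nondeg: "\<And>d u. (\<And>y. (\<Sum>v\<in>UNIV. d v * c1 p (B (Var v) y)) = 0) \<Longrightarrow> u \<notin> L \<Longrightarrow> d u = 0"
    and f: "\<And>y. B f y = 0" "restrict_vars L f = 0"
  shows "f = 0"
proof (rule ccontr)
  assume "f \<noteq> 0"
  then have "expand p f \<noteq> 0"
    by (simp add: expand_eq_0_iff)
  then have "\<exists>k. coeff (expand p f) k \<noteq> 0"
    by (metis leading_coeff_0_iff)
  define k where "k = (LEAST k. coeff (expand p f) k \<noteq> 0)"
  define h where "h = coeff (expand p f) k"
  have h: "h \<noteq> 0"
    unfolding h_def k_def by (rule LeastI_ex) fact
  have low: "coeff (expand p f) i = 0" if "i < k" for i
    using not_less_Least[of i "\<lambda>k. coeff (expand p f) k \<noteq> 0"] that by (auto simp: k_def)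
  have "pd u h = 0" if u: "u \<notin> L" for u
  proof (rule peval_zero_imp_zero)
    fix x
    have "(\<Sum>v\<in>UNIV. peval x (pd v h) * c1 p (B (Var v) y)) = 0" for y
    proof -
      have "(\<Sum>v\<in>UNIV. pd v h * Const (c1 p (B (Var v) y))) = 0"
        unfolding h_def by (rule lowest_coeff_expand[OF B]) (fact f(1), fact c0, fact low)
      then have "peval x (\<Sum>v\<in>UNIV. pd v h * Const (c1 p (B (Var v) y))) = 0"
        by (simp add: peval.hom_zero)
      then show ?thesis by (simp add: peval.hom_sum peval.hom_mult ring_homo_id)
    qed
    from nondeg[OF this u] show "peval x (pd u h) = 0" .
  qed
  then have "restrict_vars L h = h" by (rule restrict_vars_id)
  moreover have "restrict_vars L h = 0"
    unfolding h_def using restrict_coeff_expand[of L p f k] p f(2) by (simp add: expand.hom_zero)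
  ultimately show False using h by simp
qed

section \<open>The linear part of the bracket at the origin\<close>


text \<open>Point derivations at the origin. Formulas are proved for all of them and not just for
  \<open>c1 p\<close>, because bracketing with a fixed element yields another one
  (\<open>tangent_bracket\<close>), so the formulas can be iterated.\<close>

definition tangent :: "('v cpoly \<Rightarrow> complex) \<Rightarrow> bool" where
  "tangent \<phi> \<longleftrightarrow> (\<forall>f g. \<phi> (f + g) = \<phi> f + \<phi> g) \<and> (\<forall>a f. \<phi> (Const a * f) = a * \<phi> f)
    \<and> (\<forall>f g. \<phi> (f * g) = c0 f * \<phi> g + \<phi> f * c0 g)"

lemma tangentD:
  assumes "tangent \<phi>"
  shows "\<phi> (f + g) = \<phi> f + \<phi> g" "\<phi> (Const a * f) = a * \<phi> f" "\<phi> (f * g) = c0 f * \<phi> g + \<phi> f * c0 g"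
    "\<phi> (- f) = - \<phi> f" "\<phi> (f - g) = \<phi> f - \<phi> g" "\<phi> 0 = 0"
proof -
  show *: "\<phi> (f + g) = \<phi> f + \<phi> g" "\<phi> (Const a * f) = a * \<phi> f" "\<phi> (f * g) = c0 f * \<phi> g + \<phi> f * c0 g" for f g a
    using assms unfolding tangent_def by blast+
  show 0: "\<phi> 0 = 0" using *(2)[of 0 0] by simp
  show m: "\<phi> (- f) = - \<phi> f" for f using *(1)[of f "- f"] 0 by (simp add: eq_neg_iff_add_eq_0 add.commute)
  show "\<phi> (f - g) = \<phi> f - \<phi> g" using *(1)[of f "- g"] m by simp
qed

lemma tangent_c1: "tangent (c1 p)"
  by (simp add: tangent_def c1_simps)

text \<open>Modulo the products killed by \<open>S\<close>, for i < j the entry of M(z) is (z - 1)(R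
  + (z + 1) G). Two values of z separate G from R, and R then gives the entry below the
  diagonal.\<close>

lemma Ghat_from_Mev:
  fixes \<phi> :: "('n :: {finite, linorder} \<times> 'n) cpoly \<Rightarrow> complex"
  assumes add: "\<And>f g. \<phi> (f + g) = \<phi> f + \<phi> g" and scale: "\<And>a f. \<phi> (Const a * f) = a * \<phi> f"
    and S: "\<And>i j. \<phi> (Ghat i i * Ghat j j) = 0"
    and z: "z \<noteq> 1" "w \<noteq> 1" "z \<noteq> w"
    and M: "\<And>i j. i \<noteq> j \<Longrightarrow> \<phi> (Mev z i j) = 0" "\<And>i j. i \<noteq> j \<Longrightarrow> \<phi> (Mev w i j) = 0"
  shows "i \<noteq> j \<Longrightarrow> \<phi> (Ghat i j) = 0"
proof -
  have zero: "\<phi> 0 = 0" using scale[of 0 0] by simp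
  have minus: "\<phi> (- f) = - \<phi> f" for f
    using add[of f "- f"] zero by (simp add: eq_neg_iff_add_eq_0 add.commute)
  have diff: "\<phi> (f - g) = \<phi> f - \<phi> g" for f g
    using add[of f "- g"] minus by simp
  have *: "\<phi> (Ghat i j) = 0 \<and> \<phi> (Ghat j i) = 0" if "i < j" for i j
  proof -
    have ij: "i \<noteq> j" "\<not> j < i" using that by auto
    have "\<phi> (Mev z i j) = (z - 1) * (\<phi> (Rhat $ i $ j) + (z + 1) * \<phi> (Ghat i j))" for z
    proof -
      have "\<phi> (Mev z i j) = (z - 1) * \<phi> (Rhat $ i $ j) + (z ^ 2 - 1) * \<phi> (Ghat i j)"
        using that ij by (simp add: Mev_def Shat_nth Ahat_def add diff scale S zero)
      then show ?thesis by (simp add: algebra_simps power2_eq_square)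
    qed
    then have e: "\<phi> (Rhat $ i $ j) + (z + 1) * \<phi> (Ghat i j) = 0" "\<phi> (Rhat $ i $ j) + (w + 1) * \<phi> (Ghat i j) = 0"
      using M[OF ij(1)] z by simp_all
    then have "(z - w) * \<phi> (Ghat i j) = 0" by algebra
    then have "\<phi> (Ghat i j) = 0" "\<phi> (Rhat $ i $ j) = 0" using z e by simp_all
    moreover have "\<phi> (Rhat $ i $ j) = - \<phi> (Ghat j i) - \<phi> (Ghat i j)"
      using that by (simp add: Rhat_def diff S)
    ultimately show ?thesis by simp
  qed
  then show "i \<noteq> j \<Longrightarrow> \<phi> (Ghat i j) = 0"
    by (metis linorder_less_linear)
qed

definition delta :: "'n \<Rightarrow> 'n \<Rightarrow> complex" where
  "delta i j = (if i = j then 1 else 0)"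

lemma delta_sum [simp]:
  fixes f :: "'n :: finite \<Rightarrow> complex"
  shows "(\<Sum>i\<in>UNIV. f i * delta i j) = f j" "(\<Sum>i\<in>UNIV. f i * delta j i) = f j"
proof -
  have "(\<Sum>i\<in>UNIV. f i * delta i j) = (\<Sum>i\<in>UNIV. if i = j then f i else 0)"
    "(\<Sum>i\<in>UNIV. f i * delta j i) = (\<Sum>i\<in>UNIV. if i = j then f i else 0)"
    by (intro sum.cong; auto simp: delta_def)+
  then show "(\<Sum>i\<in>UNIV. f i * delta i j) = f j" "(\<Sum>i\<in>UNIV. f i * delta j i) = f j" by simp_all
qed

lemma c0_Mev:
  "c0 (Mev z i j) = ((z ^ 2 - 1) - (z - inverse z)) * delta i j"
  by (simp add: Mev_def Rhat_def Shat_nth Ahat_def delta_def c0.hom_add c0.hom_diff c0.hom_mult c0.hom_uminus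
      c0.hom_zero c0.hom_one)

lemma c0_Rhat: "c0 (Rhat $ i $ j) = 0"
  by (simp add: Rhat_def c0.hom_diff c0.hom_mult c0.hom_uminus c0.hom_zero)

locale D_algebra =
  fixes Ph :: complex and B :: "('n :: {finite, linorder} \<times> 'n) cpoly \<Rightarrow> ('n \<times> 'n) cpoly \<Rightarrow> ('n \<times> 'n) cpoly"
  assumes D: "is_D_bracket Ph B"
begin

sublocale poisson_algebra B
  using D by unfold_locales (simp add: is_D_bracket_def)

text \<open>An exact formula. A diagonal entry of M(2) is 3 times the square of the generator plus a
  constant, so by the Leibniz rule \<open>bracket_Mev_diag\<close> acquires a common factor
  \<open>Ghat j j\<close>, which cancels.\<close>

lemma bracket_diag: "B (Ghat i i) (Ghat j j) = Ghat i j - Ghat j i"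
proof -
  have lt: "B (Ghat j j) (Ghat p p) = Ghat j p - Ghat p j" if jp: "j < p" for j p
  proof -
    let ?g = "Ghat j j" and ?h = "Ghat p p"
    have ne: "j \<noteq> p" "\<not> p < j" using jp by auto
    have "B (Mev 2 j j) ?h = Const 6 * (?g * B ?g ?h)"
    proof -
      have "Mev 2 j j = Const 3 * (?g * ?g) + Const (3 / 2)"
        by (simp add: Mev_def Rhat_def Shat_nth Ahat_def flip: Const.hom_diff)
      then have "B (Mev 2 j j) ?h = Const 3 * (?g * B ?g ?h + B ?g ?h * ?g)"
        by (simp only: add_left mult_left Const_zero mult_zero_left add_0_right)
      also have "\<dots> = (Const 3 + Const 3) * (?g * B ?g ?h)"
        by (simp add: algebra_simps)
      finally show ?thesis by (simp flip: Const.hom_add)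
    qed
    moreover have "Const (2 - 1) * B (Mev 2 j j) ?h = Const (- 4) * (Mev 2 p j * ?g) + Const 2 * (Mev 2 j p * ?g)"
      using bracket_Mev_diag[OF D, of 2 j j p] jp by (simp add: eps_def)
    ultimately have "?g * (Const 6 * B ?g ?h - (Const (- 4) * Mev 2 p j + Const 2 * Mev 2 j p)) = 0"
      by (simp add: Const.hom_one algebra_simps)
    then have "Const 6 * B ?g ?h - (Const (- 4) * Mev 2 p j + Const 2 * Mev 2 j p) = 0"
      unfolding Ghat_def Var_mult_eq_0_iff .
    moreover have "Const (- 4) * Mev 2 p j + Const 2 * Mev 2 j p = Const 6 * (Ghat j p - Ghat p j)"
    proof -
      have e: "Mev 2 p j = - (?g * ?h - Ghat p j - Ghat j p) + Const 3 * (?g * ?h) - Const (3 / 2) * Ghat j p"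
        "Mev 2 j p = (?g * ?h - Ghat p j - Ghat j p) + Const 3 * (?g * ?h) + Const 3 * Ghat j p"
        using jp ne by (simp_all add: Mev_def Rhat_def Shat_nth Ahat_def Const.hom_one mult.commute)
      have "Const 4 * Const (3 / 2) = (Const 6 :: ('n \<times> 'n) cpoly)"
        by (subst Const.hom_mult[symmetric]) simp
      then have "4 * Const (3 / 2) = (6 :: ('n \<times> 'n) cpoly)"
        by (simp add: Const.hom_numeral)
      then have c: "4 * (Const (3 / 2) * Ghat j p) = 6 * Ghat j p"
        by (subst mult.assoc[symmetric]) simp
      \<comment> \<open>\<open>gh\<close> is the product of the diagonal generators,
        \<open>a\<close> and \<open>x\<close> are the two off-diagonal ones, and \<open>c\<close> is
        3/2 times \<open>x\<close>. The products cancel.\<close>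
      have "- 4 * (- (gh - a - x) + 3 * gh - c) + 2 * (gh - a - x + 3 * gh + 3 * x) = 6 * (x - a)"
        if "4 * c = 6 * x" for gh a x c :: "('n \<times> 'n) cpoly"
      proof -
        have "- 4 * (- (gh - a - x) + 3 * gh - c) + 2 * (gh - a - x + 3 * gh + 3 * x) = 4 * c - 6 * a"
          by (simp add: algebra_simps)
        then show ?thesis using that by (simp add: algebra_simps)
      qed
      from this[OF c] show ?thesis
        unfolding e Const.hom_uminus Const.hom_numeral .
    qed
    ultimately have "Const 6 * (B ?g ?h - (Ghat j p - Ghat p j)) = 0"
      by (simp add: right_diff_distrib)
    then show ?thesis unfolding Const_mult_eq_0_iff by simp
  qed
  have "B f f = 0" for f
  proof -
    have "B f f = - B f f" by (rule skew)
    then have "B f f + B f f = 0" by (simp only: eq_neg_iff_add_eq_0)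
    then have "Const 2 * B f f = 0" by (simp only: Const.hom_numeral mult_2)
    then show ?thesis unfolding Const_mult_eq_0_iff by simp
  qed
  with lt show ?thesis
  proof (cases i j rule: linorder_cases)
    case greater
    then show ?thesis using lt[OF greater] unfolding skew[of "Ghat i i" "Ghat j j"] by simp
  qed (simp_all add: lt)
qed

lemma c0_bracket_S: "c0 (B (Ghat i i * Ghat j j) y) = 0"
  by (simp add: mult_left c0.hom_add c0.hom_mult)

text \<open>At the origin M(z) is a scalar matrix. The terms of the bracket without signs cancel,
  and the signs meet only in antisymmetric pairs. The values 2, 3 in one argument and 5, 7 in the
  other avoid z = w and z w = 1; \<open>Ghat_from_Mev\<close> then treats one argument at a
  time.\<close>

lemma c0_bracket_Ghat: "c0 (B (Ghat i j) (Ghat k l)) = 0"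
proof -
  have MM: "c0 (B (Mev z j i) (Mev w p l)) = 0" if "z \<in> {2, 3}" "w \<in> {5, 7}" for z w j i p l
  proof -
    have z: "z \<noteq> 0" "w \<noteq> 0" "z \<noteq> w" "z * w \<noteq> 1" using that by auto
    define m m' where "m = (z ^ 2 - 1) - (z - inverse z)" and "m' = (w ^ 2 - 1) - (w - inverse w)"
    have c0: "c0 (Mev z a b) = m * delta a b" "c0 (Mev w a b) = m' * delta a b" for a b :: 'n
      unfolding m_def m'_def by (rule c0_Mev)+
    have "delta l i = delta i l" "delta p j = delta j p" by (auto simp: delta_def)
    then have "c0 (Const ((z - w) * (1 - z * w)) * B (Mev z j i) (Mev w p l))
      = (z - w) * (1 - z * w) * m * m' * (delta p i * delta j l * (eps j p + eps i l) + delta j p * delta i l * (eps i p + eps j l))"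
      unfolding Mev_bracket[OF D z(1,2)] c0.hom_add c0.hom_mult c0 c0_simps
      by (simp only:) (simp add: algebra_simps)
    also have "delta p i * delta j l * (eps j p + eps i l) = 0"
      by (auto simp: delta_def eps_def)
    also have "delta j p * delta i l * (eps i p + eps j l) = 0"
      by (auto simp: delta_def eps_def)
    finally show ?thesis using z by (simp add: c0.hom_mult)
  qed
  have Mg: "c0 (B (Mev z p l) (Ghat i i)) = 0" if "z \<noteq> 0" "z \<noteq> 1" for z p l i
  proof -
    have "c0 (Const (z - 1) * B (Mev z p l) (Ghat i i)) = 0"
      unfolding bracket_Mev_diag[OF D that] by (simp add: c0.hom_add c0.hom_mult)
    then show ?thesis using that by (simp add: c0.hom_mult)
  qed
  have gM: "c0 (B (Ghat i i) (Mev z p l)) = 0" if "z \<noteq> 0" "z \<noteq> 1" for z p l i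
    using Mg[OF that, of p l i] skew[of "Ghat i i" "Mev z p l"] by (simp add: c0.hom_uminus)
  have xM: "c0 (B (Ghat i j) (Mev w p l)) = 0" if w: "w \<in> {5, 7}" for w p l i j
  proof (cases "i = j")
    case False
    show ?thesis
      by (rule Ghat_from_Mev[where \<phi> = "\<lambda>f. c0 (B f (Mev w p l))" and z = 2 and w = 3])
        (use MM w False in \<open>auto simp: add_left Const_left c0.hom_add c0.hom_mult c0_bracket_S\<close>)
  qed (use gM w in auto)
  have xg: "c0 (B (Ghat i j) (Ghat k k)) = 0" for i j k
  proof (cases "i = j")
    case True
    then show ?thesis by (simp add: bracket_diag c0.hom_diff)
  next
    case False
    show ?thesis
      by (rule Ghat_from_Mev[where \<phi> = "\<lambda>f. c0 (B f (Ghat k k))" and z = 2 and w = 3])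
        (use Mg False in \<open>auto simp: add_left Const_left c0.hom_add c0.hom_mult c0_bracket_S\<close>)
  qed
  show ?thesis
  proof (cases "k = l")
    case True
    then show ?thesis using xg by simp
  next
    case False
    show ?thesis
      by (rule Ghat_from_Mev[where \<phi> = "\<lambda>f. c0 (B (Ghat i j) f)" and z = 5 and w = 7])
        (use xM False in \<open>auto simp: R.der_add R.der_mult Const_right Const_zero c0.hom_add c0.hom_mult\<close>)
  qed
qed

lemma c0_bracket: "c0 (B f g) = 0"
proof -
  have "c0 (B f (Var v)) = 0" for f and v :: "'n \<times> 'n"
  proof -
    have "c0 (B (Var u) (Var v)) = 0" for u
      using c0_bracket_Ghat[of "fst u" "snd u" "fst v" "snd v"] by (simp add: Ghat_def)
    then show ?thesis
      by (simp add: chain_rule[of f] c0.hom_sum c0.hom_mult)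
  qed
  then have "c0 (B (Var v) f) = 0" for v f
    using skew[of "Var v" f] by (simp add: c0.hom_uminus)
  then show ?thesis
    by (simp add: chain_rule[of f g] c0.hom_sum c0.hom_mult)
qed

text \<open>The unwanted Leibniz terms contain the value of a bracket at the origin, which is
  0.\<close>

lemma tangent_bracket: "tangent \<phi> \<Longrightarrow> tangent (\<lambda>f. \<phi> (B f y))"
  unfolding tangent_def[of "\<lambda>f. \<phi> (B f y)"]
proof (intro conjI allI)
  assume T: "tangent \<phi>"
  show "\<phi> (B (f + g) y) = \<phi> (B f y) + \<phi> (B g y)" for f g
    unfolding add_left by (rule tangentD(1)[OF T])
  show "\<phi> (B (Const a * f) y) = a * \<phi> (B f y)" for a f
    unfolding Const_left by (rule tangentD(2)[OF T])
  show "\<phi> (B (f * g) y) = c0 f * \<phi> (B g y) + \<phi> (B f y) * c0 g" for f g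
    unfolding mult_left by (simp add: tangentD(1,3)[OF T] c0_bracket)
qed

text \<open>Products of generators vanish to first order, so R is, up to sign,
  \<open>Ghat i j + Ghat j i\<close>. This splits a generator into its components in so(n+1) and
  so(n).\<close>

lemma tangent_Rhat:
  assumes "tangent \<phi>" and that: "i \<noteq> j"
  shows "2 * \<phi> (Ghat i j) = \<phi> (Ghat i j) - \<phi> (Ghat j i) + eps i j * \<phi> (Rhat $ i $ j)"
proof -
  note T = tangentD[OF assms(1)]
  show ?thesis
  proof (cases "i < j")
    case True
    then show ?thesis by (simp add: Rhat_def eps_def T)
  next
    case False
    then have "j < i" using that by simp
    then show ?thesis using False by (simp add: Rhat_def eps_def T)
  qed
qed

lemma tangent_bracket_Mev_diag:
  assumes T: "tangent \<phi>" and z: "z \<noteq> 0" "z \<noteq> 1"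
  shows "(z - 1) * \<phi> (B (Mev z j i) (Ghat p p)) = ((z ^ 2 - 1) - (z - inverse z))
    * ((eps j p * (z - 1) - (z + 1)) * delta p i * \<phi> (Ghat j j) + (eps i p * (z - 1) + (z + 1)) * delta j p * \<phi> (Ghat i i))"
proof -
  have "\<phi> (Const (z - 1) * B (Mev z j i) (Ghat p p)) = (z - 1) * \<phi> (B (Mev z j i) (Ghat p p))"
    by (rule tangentD[OF T])
  then show ?thesis
    unfolding bracket_Mev_diag[OF D z] tangentD(1,2)[OF T] tangentD(3)[OF T, of "Mev z _ _"]
    by (simp add: c0_Mev algebra_simps)
qed

text \<open>The two summands commute: -2 R is M(-1), and the scalar value of M(z) at the origin
  vanishes at z = -1.\<close>

lemma tangent_bracket_Rhat_diag:
  assumes T: "tangent \<phi>"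
  shows "\<phi> (B (Rhat $ j $ i) (Ghat p p)) = 0"
proof -
  have "Mev (- 1) j i = Const (- 2) * Rhat $ j $ i"
    by (simp add: Mev_def Const.hom_zero)
  then have "(- 1 - 1) * (- 2 * \<phi> (B (Rhat $ j $ i) (Ghat p p))) = 0"
    using tangent_bracket_Mev_diag[OF T, of "- 1" j i p] by (simp add: Const_left tangentD(2)[OF T])
  then show ?thesis by simp
qed

lemma tangent_bracket_S:
  assumes T: "tangent \<phi>"
  shows "\<phi> (B (Ghat i i * Ghat j j) y) = 0" "\<phi> (B y (Ghat i i * Ghat j j)) = 0"
  using tangentD[OF T] by (simp_all add: mult_left R.der_mult c0_bracket)

text \<open>Together with \<open>bracket_diag\<close> these are relations of so(n+1). An entry of
  M(2) above the diagonal is R + 3 S + 3 G, where R and S contribute nothing to first order.\<close>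

lemma tangent_bracket_Ghat_diag:
  assumes T: "tangent \<phi>"
  shows "\<phi> (B (Ghat i j - Ghat j i) (Ghat p p)) = 4 * (delta i p * \<phi> (Ghat j j) - delta j p * \<phi> (Ghat i i))"
proof -
  note T' = tangentD[OF T]
  have lt: "\<phi> (B (Ghat j i - Ghat i j) (Ghat p p)) = 4 * (delta j p * \<phi> (Ghat i i) - delta i p * \<phi> (Ghat j j))"
    if ji: "j < i" for i j
  proof -
    have ne: "j \<noteq> i" "\<not> i < j" using ji by auto
    let ?h = "Ghat p p"
    have "Mev 2 j i = Rhat $ j $ i + Const 3 * (Ghat j j * Ghat i i) + Const 3 * Ghat j i"
      using ji ne by (simp add: Mev_def Shat_nth Ahat_def Const.hom_one)
    then have "\<phi> (B (Mev 2 j i) ?h) = 3 * \<phi> (B (Ghat j i) ?h)"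
      by (simp add: add_left Const_left T'(1,2) tangent_bracket_Rhat_diag[OF T] tangent_bracket_S[OF T])
    then have "3 * \<phi> (B (Ghat j i) ?h) = (3 / 2) * ((eps j p - 3) * delta p i * \<phi> (Ghat j j) + (eps i p + 3) * delta j p * \<phi> (Ghat i i))"
      using tangent_bracket_Mev_diag[OF T, of 2 j i p] by simp
    then have 1: "\<phi> (B (Ghat j i) ?h) = 2 * (delta j p * \<phi> (Ghat i i) - delta i p * \<phi> (Ghat j j))"
      using ji ne by (auto simp: delta_def eps_def)
    have "Rhat $ j $ i = Ghat j j * Ghat i i - Ghat i j - Ghat j i"
      using ji by (simp add: Rhat_def)
    then have "\<phi> (B (Ghat j j * Ghat i i - Ghat i j - Ghat j i) ?h) = 0"
      using tangent_bracket_Rhat_diag[OF T, of j i p] by simp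
    then have "0 - \<phi> (B (Ghat i j) ?h) - \<phi> (B (Ghat j i) ?h) = 0"
      by (simp only: L.der_diff T'(5) tangent_bracket_S[OF T])
    then have "\<phi> (B (Ghat i j) ?h) = - \<phi> (B (Ghat j i) ?h)"
      by algebra
    then show ?thesis
      using 1 by (simp add: L.der_diff T'(5))
  qed
  show ?thesis
  proof (cases i j rule: linorder_cases)
    case less
    then show ?thesis by (rule lt)
  next
    case equal
    then show ?thesis by (simp add: L.der_zero T'(6))
  next
    case greater
    have "\<phi> (B (Ghat i j - Ghat j i) (Ghat p p)) = - \<phi> (B (Ghat j i - Ghat i j) (Ghat p p))"
      by (simp add: L.der_diff T'(5))
    then show ?thesis using lt[OF greater] by simp
  qed
qed

text \<open>With \<open>bracket_diag\<close>, this form of the Jacobi identity reduces brackets with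
  \<open>Ghat i j - Ghat j i\<close> to iterated brackets with diagonal generators.\<close>

lemma bracket_bracket: "B f (B g h) = B (B f g) h - B (B f h) g"
proof -
  have "B f (B g h) = - B g (B h f) - B h (B f g)"
    using jacobi[of f g h] by (simp add: add_eq_0_iff2 add.assoc algebra_simps)
  moreover have "B g (B h f) = B (B f h) g"
    unfolding skew[of g] skew[of h f] by (simp add: L.der_uminus)
  moreover have "B h (B f g) = - B (B f g) h"
    by (rule skew)
  ultimately show ?thesis by simp
qed

text \<open>The relations of so(n). The first argument is taken at -1; the second cannot be, as both
  sides of \<open>Mev_bracket\<close> vanish for z = w. Instead M(2) - M(-2) is used, which above
  the diagonal is 4 R + 4 S.\<close>

lemma tangent_bracket_Rhat_Rhat:
  assumes T: "tangent \<phi>"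
  shows "\<phi> (B (Rhat $ j $ i) (Rhat $ p $ l)) = - 4 * (delta j l * \<phi> (Rhat $ p $ i) - delta p i * \<phi> (Rhat $ j $ l)
     + delta i l * \<phi> (Rhat $ j $ p) - delta p j * \<phi> (Rhat $ l $ i))"
proof -
  note T' = tangentD[OF T]
  have R: "Mev (- 1) j i = Const (- 2) * Rhat $ j $ i" for j i
    by (simp add: Mev_def Const.hom_zero)
  have MR: "(1 + w) * \<phi> (B (Rhat $ j $ i) (Mev w p l)) = ((w ^ 2 - 1) - (w - inverse w)) *
      ((eps j p * (1 + w) + (w - 1)) * delta j l * \<phi> (Rhat $ p $ i)
     + (eps i l * (1 + w) - (w - 1)) * delta p i * \<phi> (Rhat $ j $ l)
     + (eps i p * (1 + w) - (1 - w)) * delta i l * \<phi> (Rhat $ j $ p)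
     + (eps j l * (1 + w) + (1 - w)) * delta p j * \<phi> (Rhat $ l $ i))"
    if w: "w \<noteq> 0" "w \<noteq> - 1" for w j i p l
  proof -
    define m where "m = (w ^ 2 - 1) - (w - inverse w)"
    have m1: "(- 1 :: complex) \<noteq> 0" by simp
    have RM: "\<phi> (Const (- 2) * Rhat $ a $ b * Mev w c d) = - 2 * \<phi> (Rhat $ a $ b) * (m * delta c d)" for a b c d
      unfolding T'(3)[of "Const (- 2) * Rhat $ a $ b"] by (simp add: c0.hom_mult c0_Rhat c0_Mev T'(2) m_def)
    have e1: "\<phi> (Const ((- 1 - w) * (1 - (- 1) * w)) * B (Mev (- 1) j i) (Mev w p l))
      = 2 * (1 + w) ^ 2 * \<phi> (B (Rhat $ j $ i) (Mev w p l))"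
      unfolding R Const_left T'(2) by (simp add: algebra_simps power2_eq_square)
    have e2: "\<phi> (Const ((- 1 - w) * (1 - (- 1) * w)) * B (Mev (- 1) j i) (Mev w p l)) = 2 * (1 + w) * (((w ^ 2 - 1) - (w - inverse w)) *
      ((eps j p * (1 + w) + (w - 1)) * delta j l * \<phi> (Rhat $ p $ i)
     + (eps i l * (1 + w) - (w - 1)) * delta p i * \<phi> (Rhat $ j $ l)
     + (eps i p * (1 + w) - (1 - w)) * delta i l * \<phi> (Rhat $ j $ p)
     + (eps j l * (1 + w) + (1 - w)) * delta p j * \<phi> (Rhat $ l $ i)))"
      unfolding Mev_bracket[OF D m1 w(1)] unfolding R T'(1,2) unfolding RM m_def[symmetric] by (simp add: algebra_simps)
    have "2 * (1 + w) * ((1 + w) * \<phi> (B (Rhat $ j $ i) (Mev w p l))) = 2 * (1 + w) * (((w ^ 2 - 1) - (w - inverse w)) *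
      ((eps j p * (1 + w) + (w - 1)) * delta j l * \<phi> (Rhat $ p $ i)
     + (eps i l * (1 + w) - (w - 1)) * delta p i * \<phi> (Rhat $ j $ l)
     + (eps i p * (1 + w) - (1 - w)) * delta i l * \<phi> (Rhat $ j $ p)
     + (eps j l * (1 + w) + (1 - w)) * delta p j * \<phi> (Rhat $ l $ i)))"
      unfolding e2[symmetric] e1 by (simp only: power2_eq_square mult.assoc)
    moreover have "2 * (1 + w) \<noteq> 0" using w by (simp add: add_eq_0_iff)
    ultimately show ?thesis unfolding mult_cancel_left by blast
  qed
  let ?F = "\<lambda>p l. - 4 * (delta j l * \<phi> (Rhat $ p $ i) - delta p i * \<phi> (Rhat $ j $ l)
     + delta i l * \<phi> (Rhat $ j $ p) - delta p j * \<phi> (Rhat $ l $ i))"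
  have lt: "\<phi> (B (Rhat $ j $ i) (Rhat $ p $ l)) = ?F p l" if pl: "p < l" for p l
  proof -
    have ne: "p \<noteq> l" "\<not> l < p" using pl by auto
    have "Mev 2 p l - Mev (- 2) p l = Const 4 * Rhat $ p $ l + Const 4 * (Ghat p p * Ghat l l)"
      using pl ne by (simp add: Mev_def Shat_nth Ahat_def Const.hom_one Const.hom_uminus Const.hom_numeral)
    then have "\<phi> (B (Rhat $ j $ i) (Mev 2 p l - Mev (- 2) p l)) = 4 * \<phi> (B (Rhat $ j $ i) (Rhat $ p $ l))"
      by (simp add: R.der_add Const_right T'(1,2) tangent_bracket_S[OF T])
    then have "4 * \<phi> (B (Rhat $ j $ i) (Rhat $ p $ l)) = \<phi> (B (Rhat $ j $ i) (Mev 2 p l)) - \<phi> (B (Rhat $ j $ i) (Mev (- 2) p l))"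
      by (simp add: R.der_diff T'(5))
    moreover define Y where "Y = delta j l * \<phi> (Rhat $ p $ i) - delta p i * \<phi> (Rhat $ j $ l)
      + delta i l * \<phi> (Rhat $ j $ p) - delta p j * \<phi> (Rhat $ l $ i)"
    have e: "eps j p * delta j l = delta j l" "eps i l * delta p i = - delta p i"
      "eps i p * delta i l = delta i l" "eps j l * delta p j = - delta p j"
      using pl ne by (auto simp: delta_def eps_def)
    have "3 * \<phi> (B (Rhat $ j $ i) (Mev 2 p l)) = 3 / 2 *
      ((3 * (eps j p * delta j l) + delta j l) * \<phi> (Rhat $ p $ i) + (3 * (eps i l * delta p i) - delta p i) * \<phi> (Rhat $ j $ l)
      + (3 * (eps i p * delta i l) + delta i l) * \<phi> (Rhat $ j $ p) + (3 * (eps j l * delta p j) - delta p j) * \<phi> (Rhat $ l $ i))"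
      using MR[of 2 j i p l] by (simp add: algebra_simps)
    then have "3 * \<phi> (B (Rhat $ j $ i) (Mev 2 p l)) = 3 * (2 * Y)"
      unfolding e Y_def by (simp add: algebra_simps)
    then have "\<phi> (B (Rhat $ j $ i) (Mev 2 p l)) = 2 * Y" by simp
    moreover have "- \<phi> (B (Rhat $ j $ i) (Mev (- 2) p l)) = 9 / 2 *
      ((- (eps j p * delta j l) - 3 * delta j l) * \<phi> (Rhat $ p $ i) + (3 * delta p i - eps i l * delta p i) * \<phi> (Rhat $ j $ l)
      + (- (eps i p * delta i l) - 3 * delta i l) * \<phi> (Rhat $ j $ p) + (3 * delta p j - eps j l * delta p j) * \<phi> (Rhat $ l $ i))"
      using MR[of "- 2" j i p l] by (simp add: algebra_simps)
    then have "\<phi> (B (Rhat $ j $ i) (Mev (- 2) p l)) = 18 * Y"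
      unfolding e Y_def by (simp add: algebra_simps)
    ultimately have "\<phi> (B (Rhat $ j $ i) (Rhat $ p $ l)) = - 4 * Y" by simp
    then show ?thesis unfolding Y_def .
  qed
  have rs: "\<phi> (Rhat $ a $ b) = - \<phi> (Rhat $ b $ a)" for a b
    using T'(4)[of "Rhat $ b $ a"] Rhat_skew[of a b] by simp
  have "\<phi> (B (Rhat $ j $ i) (Rhat $ p $ l)) = ?F p l"
  proof (cases p l rule: linorder_cases)
    case less
    then show ?thesis by (rule lt)
  next
    case equal
    have "Rhat $ l $ l = 0" by (simp add: Rhat_def)
    then show ?thesis using equal rs[of j l] rs[of l i] by (auto simp: R.der_zero T'(6) delta_def)
  next
    case greater
    have "\<phi> (B (Rhat $ j $ i) (Rhat $ p $ l)) = - \<phi> (B (Rhat $ j $ i) (Rhat $ l $ p))"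
      unfolding Rhat_skew[of p l] R.der_uminus T'(4) ..
    also have "\<dots> = ?F p l"
      unfolding lt[OF greater] using rs[of l j] rs[of j l] rs[of p i] rs[of p j] rs[of l i] by (auto simp: delta_def)
    finally show ?thesis .
  qed
  then show ?thesis .
qed

end

section \<open>Nondegeneracy at a regular point\<close>

text \<open>\<open>comm\<close> says that \<open>V\<close> commutes with the matrix whose entries
  are \<open>k p\<close> at \<open>(p, s p)\<close>, hence with its square, which is diagonal with
  entries - (k p)^2.\<close>

lemma commuting_with_involution:
  fixes V :: "'n \<Rightarrow> 'n \<Rightarrow> complex"
  assumes s: "\<And>i. s (s i) = i" and k: "\<And>i. k (s i) = - k i"
    and comm: "\<And>p l. V p (s l) * k (s l) = k p * V (s p) l" and ne: "k m ^ 2 \<noteq> k p ^ 2"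
  shows "V p m = 0"
proof -
  have 1: "V p m * k m = k p * V (s p) (s m)"
    using comm[of p "s m"] by (simp add: s)
  have 2: "V (s p) (s m) * k m = k p * V p m"
    using comm[of "s p" m] by (simp add: s k)
  have "V p m * k m ^ 2 = V p m * k m * k m"
    by (simp add: power2_eq_square)
  also have "\<dots> = k p * (V (s p) (s m) * k m)"
    unfolding 1 by simp
  also have "\<dots> = V p m * k p ^ 2"
    unfolding 2 by (simp add: power2_eq_square)
  finally show ?thesis using ne by simp
qed

text \<open>Only one coordinate of each pair is nonzero, so the so(n) and so(n+1) components have
  the same entries up to sign there. Twice 1/4 is not an integer, so it cannot collide with a value
  of \<open>N\<close>.\<close>

definition regular_point :: "('n :: linorder \<Rightarrow> 'n) \<Rightarrow> ('n \<Rightarrow> nat) \<Rightarrow> 'n \<times> 'n \<Rightarrow> complex" where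
  "regular_point s N = (\<lambda>(i, j). if j = s i then if s i = i then 1 / 4 else if i < j then of_nat (N i) else 0 else 0)"

lemma sum_single:
  fixes f :: "'n :: finite \<Rightarrow> complex"
  assumes "\<And>i. i \<noteq> a \<Longrightarrow> f i = 0"
  shows "(\<Sum>i\<in>UNIV. f i) = f a"
proof -
  have "(\<Sum>i\<in>UNIV. f i) = (\<Sum>i\<in>{a}. f i)"
    by (rule sum.mono_neutral_right) (use assms in auto)
  then show ?thesis by simp
qed

text \<open>Read as an element of the Lie algebra, \<open>d\<close> stabilises the regular point
  under the coadjoint action. Such a stabiliser is a Cartan subalgebra, here the one supported on
  the positions \<open>(i, s i)\<close>.\<close>

lemma (in D_algebra) nondegenerate:
  fixes d :: "'n \<times> 'n \<Rightarrow> complex"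
  assumes s: "\<And>i. s (s i) = i" and fp: "\<And>i j. s i = i \<Longrightarrow> s j = j \<Longrightarrow> i = j"
    and N: "inj N" "\<And>i. N i > 0"
    and d: "\<And>y. (\<Sum>v\<in>UNIV. d v * c1 (regular_point s N) (B (Var v) y)) = 0"
    and ij: "j \<noteq> s i"
  shows "d (i, j) = 0"
proof -
  define x where "x = regular_point s N"
  define \<phi> where "\<phi> = c1 x"
  have T: "tangent \<phi>" unfolding \<phi>_def by (rule tangent_c1)
  note T' = tangentD[OF T]
  have TB: "tangent (\<lambda>f. \<phi> (B f y))" for y by (rule tangent_bracket[OF T])
  have \<phi>x: "\<phi> (Ghat i j) = x (i, j)" for i j
    by (simp add: \<phi>_def Ghat_def c1_simps)
  define \<kappa> where "\<kappa> i j = x (i, j) - x (j, i)" for i j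
  define g where "g i = x (i, i)" for i
  define r where "r i j = \<phi> (Rhat $ i $ j)" for i j
  define kk where "kk i = \<kappa> i (s i)" for i
  \<comment> \<open>The absolute value of \<open>kk i\<close>; \<open>min\<close> finds the
    coordinate of the pair that is nonzero.\<close>
  define n0 where "n0 i = (if s i = i then 0 else N (min i (s i)))" for i
  \<comment> \<open>\<open>e\<close> and \<open>V\<close> hold the so(n+1) component of
    \<open>d\<close>, \<open>VR\<close> its so(n) component.\<close>
  define e where "e i = d (i, i)" for i
  define V where "V i j = d (i, j) - d (j, i)" for i j
  define W where "W i j = eps i j * d (i, j)" for i j
  define VR where "VR i j = W i j - W j i" for i j
  have s_eq: "s a = b \<longleftrightarrow> a = s b" for a b using s by metis
  have \<kappa>0: "\<kappa> a b = 0" if "b \<noteq> s a" for a b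
    using that s_eq[of b a] by (auto simp: \<kappa>_def x_def regular_point_def)
  have g: "g a = (if s a = a then 1 / 4 else 0)" for a
    by (auto simp: g_def x_def regular_point_def)
  have \<phi>\<kappa>: "\<phi> (B (Ghat a a) (Ghat b b)) = \<kappa> a b" for a b
    by (simp add: bracket_diag T'(5) \<phi>x \<kappa>_def)
  have r_eq: "r a b = eps a b * (x (a, b) + x (b, a))" for a b
  proof (cases "a = b")
    case True
    have "Rhat $ b $ b = 0" by (simp add: Rhat_def)
    then show ?thesis using True by (simp add: r_def T'(6) eps_def)
  next
    case False
    then have "eps a b * r a b = x (a, b) + x (b, a)"
      using tangent_Rhat[OF T False] by (simp add: \<phi>x r_def algebra_simps)
    moreover have "eps a b * (eps a b * r a b) = r a b"
      using False by (simp add: eps_def)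
    ultimately show ?thesis by simp
  qed
  have r0: "r a b = 0" if "b \<noteq> s a" for a b
    unfolding r_eq using that s_eq[of b a] by (auto simp: x_def regular_point_def)
  have kk_s: "kk (s a) = - kk a" for a
    by (simp add: kk_def \<kappa>_def s)
  have r_kk: "r a (s a) = - kk a" for a
  proof -
    have "s a < a \<or> s a = a \<or> a < s a" by auto
    then show ?thesis
      unfolding r_eq kk_def \<kappa>_def by (auto simp: eps_def x_def regular_point_def s)
  qed
  have kk_sq: "kk a ^ 2 = of_nat (n0 a) ^ 2" for a
  proof -
    consider "s a = a" | "s a \<noteq> a" "a < s a" "\<not> s a < a" | "s a \<noteq> a" "s a < a" "\<not> a < s a" by force
    then show ?thesis
      by cases (auto simp: kk_def \<kappa>_def x_def regular_point_def n0_def s min_def)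
  qed
  have n0: "b = a \<or> b = s a" if eq0: "n0 a = n0 b" for a b
  proof -
    have pos: "N c \<noteq> 0" for c using N(2)[of c] by simp
    consider "s a = a" "s b = b" | "s a \<noteq> a" "s b \<noteq> b"
      using eq0 pos[of "min a (s a)"] pos[of "min b (s b)"] unfolding n0_def
      by (cases "s a = a"; cases "s b = b") simp_all
    then show ?thesis
    proof cases
      case 1
      then show ?thesis using fp by blast
    next
      case 2
      then have "min a (s a) = min b (s b)"
        using eq0 injD[OF N(1)] by (simp add: n0_def)
      then have "a = b \<or> a = s b \<or> s a = b \<or> s a = s b"
        by (auto simp: min_def split: if_splits)
      then show ?thesis using s by metis
    qed
  qed
  have kk_ne: "kk b ^ 2 \<noteq> kk a ^ 2" if "b \<noteq> a" "b \<noteq> s a" for a b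
  proof
    assume "kk b ^ 2 = kk a ^ 2"
    then have "of_nat (n0 b ^ 2) = (of_nat (n0 a ^ 2) :: complex)"
      unfolding kk_sq by simp
    then have "n0 b ^ 2 = n0 a ^ 2"
      unfolding of_nat_eq_iff .
    then have "n0 a = n0 b" by simp
    then show False using n0 that by blast
  qed
  \<comment> \<open>Twice the hypothesis, with off-diagonal generators split by
    \<open>tangent_Rhat\<close>; doubling avoids halves.\<close>
  have eq: "2 * (\<Sum>i\<in>UNIV. e i * \<phi> (B (Ghat i i) y))
      + (\<Sum>i\<in>UNIV. \<Sum>j\<in>UNIV. d (i, j) * \<phi> (B (Ghat i j - Ghat j i) y))
      + (\<Sum>i\<in>UNIV. \<Sum>j\<in>UNIV. W i j * \<phi> (B (Rhat $ i $ j) y)) = 0" for y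
  proof -
    have "(\<Sum>v\<in>UNIV. d v * \<phi> (B (Var v) y)) = (\<Sum>i\<in>UNIV. \<Sum>j\<in>UNIV. d (i, j) * \<phi> (B (Ghat i j) y))"
      using sum.cartesian_product[of "\<lambda>i j. d (i, j) * \<phi> (B (Ghat i j) y)" UNIV UNIV]
      by (simp add: Ghat_def case_prod_unfold)
    then have "0 = 2 * (\<Sum>i\<in>UNIV. \<Sum>j\<in>UNIV. d (i, j) * \<phi> (B (Ghat i j) y))"
      using d[of y] by (simp add: \<phi>_def x_def)
    also have "\<dots> = (\<Sum>i\<in>UNIV. \<Sum>j\<in>UNIV. 2 * (d (i, j) * \<phi> (B (Ghat i j) y)))"
      by (simp only: sum_distrib_left)
    also have "\<dots> = (\<Sum>i\<in>UNIV. \<Sum>j\<in>UNIV. 2 * (d (i, j) * \<phi> (B (Ghat i i) y) * delta i j)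
        + d (i, j) * \<phi> (B (Ghat i j - Ghat j i) y) + W i j * \<phi> (B (Rhat $ i $ j) y))"
    proof (intro sum.cong refl)
      fix i j :: 'n
      show "2 * (d (i, j) * \<phi> (B (Ghat i j) y)) = 2 * (d (i, j) * \<phi> (B (Ghat i i) y) * delta i j)
        + d (i, j) * \<phi> (B (Ghat i j - Ghat j i) y) + W i j * \<phi> (B (Rhat $ i $ j) y)"
      proof (cases "i = j")
        case True
        then show ?thesis by (simp add: delta_def W_def eps_def L.der_zero T'(6))
      next
        case False
        have "2 * (d (i, j) * \<phi> (B (Ghat i j) y)) = d (i, j) * (2 * \<phi> (B (Ghat i j) y))" by simp
        also have "\<dots> = d (i, j) * (\<phi> (B (Ghat i j - Ghat j i) y) + eps i j * \<phi> (B (Rhat $ i $ j) y))"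
          unfolding tangent_Rhat[OF TB False] L.der_diff T'(5) ..
        finally show ?thesis using False by (simp add: delta_def W_def algebra_simps)
      qed
    qed
    also have "\<dots> = 2 * (\<Sum>i\<in>UNIV. e i * \<phi> (B (Ghat i i) y))
      + (\<Sum>i\<in>UNIV. \<Sum>j\<in>UNIV. d (i, j) * \<phi> (B (Ghat i j - Ghat j i) y))
      + (\<Sum>i\<in>UNIV. \<Sum>j\<in>UNIV. W i j * \<phi> (B (Rhat $ i $ j) y))"
    proof -
      have "(\<Sum>i\<in>UNIV. \<Sum>j\<in>UNIV. d (i, j) * \<phi> (B (Ghat i i) y) * delta i j) = (\<Sum>i\<in>UNIV. e i * \<phi> (B (Ghat i i) y))"
        unfolding e_def by (intro sum.cong refl, subst sum_single) (auto simp: delta_def)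
      then show ?thesis by (simp only: sum.distrib sum_distrib_left[symmetric])
    qed
    finally show ?thesis by simp
  qed
  have dsum: "(\<Sum>i\<in>UNIV. \<Sum>j\<in>UNIV. F i j * (delta i a * u j)) = (\<Sum>j\<in>UNIV. F a j * u j)"
    "(\<Sum>i\<in>UNIV. \<Sum>j\<in>UNIV. F i j * (delta j a * u i)) = (\<Sum>i\<in>UNIV. F i a * u i)" for F :: "'n \<Rightarrow> 'n \<Rightarrow> complex" and a u
  proof -
    show "(\<Sum>i\<in>UNIV. \<Sum>j\<in>UNIV. F i j * (delta i a * u j)) = (\<Sum>j\<in>UNIV. F a j * u j)"
      by (subst sum_single[of a]) (auto simp: delta_def)
    show "(\<Sum>i\<in>UNIV. \<Sum>j\<in>UNIV. F i j * (delta j a * u i)) = (\<Sum>i\<in>UNIV. F i a * u i)"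
      by (intro sum.cong refl, subst sum_single[of a]) (auto simp: delta_def)
  qed
  have \<kappa>_sum: "(\<Sum>i\<in>UNIV. u i * \<kappa> i l) = - u (s l) * kk l" for u l
  proof -
    have "u i * \<kappa> i l = 0" if "i \<noteq> s l" for i using \<kappa>0[of l i] that s_eq[of i l] by auto
    from sum_single[of "s l" "\<lambda>i. u i * \<kappa> i l", OF this] show ?thesis
      using kk_s[of l] by (simp add: kk_def s)
  qed
  have r_sum: "(\<Sum>i\<in>UNIV. u i * r i l) = u (s l) * kk l" "(\<Sum>j\<in>UNIV. u j * r l j) = - u (s l) * kk l" for u l
  proof -
    have "u i * r i l = 0" if "i \<noteq> s l" for i using r0[of l i] that s_eq[of i l] by auto
    from sum_single[of "s l" "\<lambda>i. u i * r i l", OF this] show "(\<Sum>i\<in>UNIV. u i * r i l) = u (s l) * kk l"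
      using r_kk[of "s l"] kk_s[of l] by (simp add: s)
    have "u j * r l j = 0" if "j \<noteq> s l" for j using r0[of j l] that by auto
    from sum_single[of "s l" "\<lambda>j. u j * r l j", OF this] show "(\<Sum>j\<in>UNIV. u j * r l j) = - u (s l) * kk l"
      using r_kk[of l] by simp
  qed

  \<comment> \<open>Testing against R sees only the so(n) component.\<close>
  have comm_R: "VR p (s l) * kk (s l) = kk p * VR (s p) l" for p l
  proof -
    have "\<phi> (B (Ghat i i) (Rhat $ p $ l)) = 0" for i
      unfolding skew[of "Ghat i i"] T'(4) by (simp add: tangent_bracket_Rhat_diag[OF T])
    moreover have "\<phi> (B (Ghat i j - Ghat j i) (Rhat $ p $ l)) = 0" for i j
    proof -
      have "\<phi> (B (Rhat $ p $ l) (B (Ghat i i) (Ghat j j))) = 0"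
        unfolding bracket_bracket T'(5) using tangent_bracket_Rhat_diag[OF TB] by simp
      then show ?thesis
        unfolding skew[of "Ghat i j - Ghat j i"] T'(4) bracket_diag by simp
    qed
    moreover have "W i j * \<phi> (B (Rhat $ i $ j) (Rhat $ p $ l)) = - 4 * (W i j * (delta i l * r p j)
        - W i j * (delta j p * r i l) + W i j * (delta j l * r i p) - W i j * (delta i p * r l j))" for i j
    proof -
      have "delta p j = delta j p" "delta p i = delta i p" by (auto simp: delta_def)
      then show ?thesis
        unfolding tangent_bracket_Rhat_Rhat[OF T] r_def by (simp add: algebra_simps)
    qed
    ultimately have "0 = (\<Sum>i\<in>UNIV. \<Sum>j\<in>UNIV. - 4 * (W i j * (delta i l * r p j)
        - W i j * (delta j p * r i l) + W i j * (delta j l * r i p) - W i j * (delta i p * r l j)))"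
      using eq[of "Rhat $ p $ l"] by simp
    also have "\<dots> = - 4 * ((\<Sum>j\<in>UNIV. W l j * r p j) - (\<Sum>i\<in>UNIV. W i p * r i l) + (\<Sum>i\<in>UNIV. W i l * r i p) - (\<Sum>j\<in>UNIV. W p j * r l j))"
      by (simp only: sum_distrib_left[symmetric] sum.distrib sum_subtractf dsum(1)[of W l "r p"] dsum(1)[of W p "r l"]
          dsum(2)[of W p "\<lambda>i. r i l"] dsum(2)[of W l "\<lambda>i. r i p"])
    finally have "0 = - 4 * ((- W l (s p) * kk p) - W (s l) p * kk l + W (s p) l * kk p - (- W p (s l) * kk l))"
      unfolding r_sum .
    then have "(- W l (s p) * kk p) - W (s l) p * kk l + W (s p) l * kk p - (- W p (s l) * kk l) = 0"
      by algebra
    then show ?thesis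
      unfolding VR_def kk_s by (simp add: algebra_simps)
  qed
  have VR0: "VR p m = 0" if "m \<noteq> p" "m \<noteq> s p" for p m
    by (rule commuting_with_involution[where V = VR and s = s and k = kk, OF s kk_s comm_R kk_ne[OF that]])

  \<comment> \<open>Testing against a diagonal generator gives the row of the additional index in
    the commutation equation of so(n+1).\<close>
  have A: "e (s q) * kk q = 2 * (\<Sum>j\<in>UNIV. V q j * g j)" for q
  proof -
    have P: "W i j * \<phi> (B (Rhat $ i $ j) (Ghat q q)) = 0" for i j
      by (simp add: tangent_bracket_Rhat_diag[OF T])
    have K: "d (i, j) * \<phi> (B (Ghat i j - Ghat j i) (Ghat q q))
      = 4 * (d (i, j) * (delta i q * g j) - d (i, j) * (delta j q * g i))" for i j
      unfolding tangent_bracket_Ghat_diag[OF T] \<phi>x g_def by (simp add: algebra_simps)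
    have "2 * (\<Sum>i\<in>UNIV. e i * \<kappa> i q) + (\<Sum>i\<in>UNIV. \<Sum>j\<in>UNIV. 4 * (d (i, j) * (delta i q * g j) - d (i, j) * (delta j q * g i))) = 0"
      using eq[of "Ghat q q"] unfolding P K \<phi>\<kappa> by simp
    then have "2 * (\<Sum>i\<in>UNIV. e i * \<kappa> i q) + 4 * ((\<Sum>j\<in>UNIV. d (q, j) * g j) - (\<Sum>i\<in>UNIV. d (i, q) * g i)) = 0"
      by (simp only: sum_distrib_left[symmetric] sum_subtractf dsum(1)[of "\<lambda>i j. d (i, j)" q g] dsum(2)[of "\<lambda>i j. d (i, j)" q g])
    moreover have "(\<Sum>j\<in>UNIV. V q j * g j) = (\<Sum>j\<in>UNIV. d (q, j) * g j) - (\<Sum>i\<in>UNIV. d (i, q) * g i)"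
      by (simp add: V_def left_diff_distrib sum_subtractf)
    ultimately have "2 * (- e (s q) * kk q) + 4 * (\<Sum>j\<in>UNIV. V q j * g j) = 0"
      unfolding \<kappa>_sum by simp
    then show ?thesis by algebra
  qed
  \<comment> \<open>The other entries of that equation, from testing against
    \<open>Ghat p l - Ghat l p\<close> in its form as a bracket.\<close>
  have C: "- V p (s l) * kk l + V l (s p) * kk p = 2 * (e p * g l - e l * g p)" for p l
  proof -
    let ?y = "B (Ghat p p) (Ghat l l)"
    have P: "W i j * \<phi> (B (Rhat $ i $ j) ?y) = 0" for i j
      unfolding bracket_bracket T'(5) using tangent_bracket_Rhat_diag[OF TB] by simp
    have E: "e i * \<phi> (B (Ghat i i) ?y) = - 4 * (e i * delta i p * g l - e i * delta i l * g p)" for i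
    proof -
      have "delta p i = delta i p" "delta l i = delta i l" by (auto simp: delta_def)
      then show ?thesis
        unfolding skew[of "Ghat i i"] bracket_diag T'(4) tangent_bracket_Ghat_diag[OF T] \<phi>x g_def
        by (simp add: algebra_simps)
    qed
    have K: "d (i, j) * \<phi> (B (Ghat i j - Ghat j i) ?y) = 4 * (d (i, j) * (delta i p * \<kappa> j l) - d (i, j) * (delta j p * \<kappa> i l)
      - d (i, j) * (delta i l * \<kappa> j p) + d (i, j) * (delta j l * \<kappa> i p))" for i j
      unfolding bracket_bracket T'(5) tangent_bracket_Ghat_diag[OF TB] \<phi>\<kappa> by (simp add: algebra_simps)
    have "2 * (\<Sum>i\<in>UNIV. - 4 * (e i * delta i p * g l - e i * delta i l * g p))
      + (\<Sum>i\<in>UNIV. \<Sum>j\<in>UNIV. 4 * (d (i, j) * (delta i p * \<kappa> j l) - d (i, j) * (delta j p * \<kappa> i l)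
      - d (i, j) * (delta i l * \<kappa> j p) + d (i, j) * (delta j l * \<kappa> i p))) = 0"
      using eq[of ?y] unfolding P E K by simp
    then have "2 * (- 4 * (e p * g l - e l * g p)) + 4 * ((\<Sum>j\<in>UNIV. d (p, j) * \<kappa> j l) - (\<Sum>i\<in>UNIV. d (i, p) * \<kappa> i l)
      - (\<Sum>j\<in>UNIV. d (l, j) * \<kappa> j p) + (\<Sum>i\<in>UNIV. d (i, l) * \<kappa> i p)) = 0"
      by (simp only: sum_distrib_left[symmetric] sum_distrib_right[symmetric] sum_subtractf sum.distrib delta_sum
          dsum(1)[of "\<lambda>i j. d (i, j)" p "\<lambda>j. \<kappa> j l"] dsum(1)[of "\<lambda>i j. d (i, j)" l "\<lambda>j. \<kappa> j p"]
          dsum(2)[of "\<lambda>i j. d (i, j)" p "\<lambda>i. \<kappa> i l"] dsum(2)[of "\<lambda>i j. d (i, j)" l "\<lambda>i. \<kappa> i p"])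
    then show ?thesis
      unfolding \<kappa>_sum V_def by algebra
  qed
  \<comment> \<open>Without a fixed index \<open>g\<close> is 0 and \<open>A\<close> suffices.
    Otherwise \<open>A\<close> and \<open>C\<close> couple \<open>e q\<close> with one entry of
    \<open>V\<close> and leave \<open>e q * (4 * kk q ^ 2 - 1) = 0\<close>, where 4 times a natural
    number is never 1.\<close>
  have e0: "e q = 0" if q: "s q \<noteq> q" for q
  proof (cases "\<exists>f. s f = f")
    case False
    then have "g a = 0" for a by (simp add: g)
    then have "e q * kk (s q) = 0"
      using A[of "s q"] by (simp add: s)
    moreover have "kk q \<noteq> 0"
      using kk_sq[of q] q N(2)[of "min q (s q)"] by (auto simp: n0_def)
    ultimately show ?thesis by (simp add: kk_s)
  next
    case True
    then obtain f where f: "s f = f" by blast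
    have gf: "g a = 0" if "a \<noteq> f" for a using that fp[OF _ f] by (auto simp: g)
    have gf1: "g f = 1 / 4" by (simp add: g f)
    have "q \<noteq> f" using q f by auto
    have kf: "kk f = 0" using kk_s[of f] f by simp
    have Vf: "(\<Sum>j\<in>UNIV. V (s q) j * g j) = V (s q) f / 4"
      by (subst sum_single[of f]) (use gf gf1 in auto)
    have "- (e q * kk q) = 2 * (\<Sum>j\<in>UNIV. V (s q) j * g j)"
      using A[of "s q"] by (simp add: s kk_s)
    then have 1: "- (e q * kk q) * 2 = V (s q) f"
      unfolding Vf by simp
    have 2: "V f (s q) * kk q * 2 = e q"
      using C[of q f] by (simp add: f kf gf1 gf[OF \<open>q \<noteq> f\<close>])
    have "V f (s q) = - V (s q) f" by (simp add: V_def)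
    then have "e q * (4 * kk q ^ 2 - 1) = 0" using 1 2 by algebra
    moreover have "4 * kk q ^ 2 \<noteq> 1"
    proof
      assume "4 * kk q ^ 2 = 1"
      then have "of_nat (4 * n0 q ^ 2) = (of_nat 1 :: complex)"
        unfolding kk_sq by simp
      then have "4 * n0 q ^ 2 = 1" unfolding of_nat_eq_iff .
      then have "4 dvd (1 :: nat)" by (metis dvd_triv_left)
      then show False by simp
    qed
    ultimately show ?thesis by simp
  qed
  \<comment> \<open>Now \<open>e\<close> and \<open>g\<close> are both supported on the fixed index,
    so the right side of \<open>C\<close> vanishes.\<close>
  have comm: "V p (s l) * kk (s l) = kk p * V (s p) l" for p l
  proof -
    have "e p * g l - e l * g p = 0"
    proof (cases "s p = p \<and> s l = l")
      case True
      then have "p = l" using fp by blast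
      then show ?thesis by simp
    next
      case False
      then show ?thesis using e0[of p] e0[of l] by (auto simp: g)
    qed
    then have "- V p (s l) * kk l + V l (s p) * kk p = 0" using C[of p l] by simp
    moreover have "V l (s p) = - V (s p) l" by (simp add: V_def)
    ultimately show ?thesis unfolding kk_s by (simp add: algebra_simps)
  qed
  have V0: "V p m = 0" if "m \<noteq> p" "m \<noteq> s p" for p m
    by (rule commuting_with_involution[where V = V and s = s and k = kk, OF s kk_s comm kk_ne[OF that]])
  show ?thesis
  proof (cases "j = i")
    case True
    then show ?thesis using e0[of i] ij by (auto simp: e_def)
  next
    case False
    \<comment> \<open>\<open>V\<close> makes \<open>d\<close> symmetric at this position;
      \<open>VR\<close>, owing to the sign in \<open>W\<close>, makes it antisymmetric.\<close>
    have "d (i, j) = d (j, i)" using V0[OF False ij] by (simp add: V_def)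
    moreover have "eps i j * (d (i, j) + d (j, i)) = 0"
      using VR0[OF False ij] False by (auto simp: VR_def W_def eps_def add_eq_0_iff split: if_splits)
    then have "d (i, j) + d (j, i) = 0" using False by (auto simp: eps_def split: if_splits)
    ultimately show ?thesis by simp
  qed
qed

section \<open>The upper bound on independent central elements, and the theorem\<close>

lemma (in poisson_algebra) bracket_poly_subst:
  assumes f: "\<And>i. i \<in> I \<Longrightarrow> B (f i) y = 0" and Q: "\<forall>m\<in>Poly_Mapping.keys Q. Poly_Mapping.keys m \<subseteq> I"
  shows "B (poly_subst f Q) y = 0"
proof -
  have pow: "B (f i ^ k) y = 0" if "i \<in> I" for i k
    by (induction k) (simp_all add: L.der_one mult_left f[OF that])
  have "B (\<Prod>v\<in>Poly_Mapping.keys m. f v ^ Poly_Mapping.lookup m v) y = 0" if "m \<in> Poly_Mapping.keys Q" for m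
    unfolding L.der_prod[OF finite_keys]
  proof (rule sum.neutral, rule ballI)
    fix v assume "v \<in> Poly_Mapping.keys m"
    then have "v \<in> I" using Q that by blast
    then show "B (f v ^ Poly_Mapping.lookup m v) y * (\<Prod>v\<in>Poly_Mapping.keys m - {v}. f v ^ Poly_Mapping.lookup m v) = 0"
      by (simp add: pow)
  qed
  then show ?thesis
    unfolding poly_subst_def L.der_sum Const_left by (intro sum.neutral) auto
qed

lemma (in D_algebra) central_alg_indep_le:
  fixes f :: "nat \<Rightarrow> ('n \<times> 'n) cpoly"
  assumes central: "\<And>i. i \<in> {1..m} \<Longrightarrow> central B (f i)" and indep: "alg_indep {1..m} f"
  shows "m \<le> CARD('n)"
proof (rule ccontr)
  assume "\<not> m \<le> CARD('n)"
  obtain s :: "'n \<Rightarrow> 'n" where s: "\<And>i. s (s i) = i" and fp: "\<And>i j. s i = i \<Longrightarrow> s j = j \<Longrightarrow> i = j"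
    using exists_involution[of "UNIV :: 'n set"] by auto
  obtain N0 :: "'n \<Rightarrow> nat" where N0: "inj N0"
    using finite_imp_inj_to_nat_seg[of "UNIV :: 'n set"] by auto
  define N where "N i = Suc (N0 i)" for i
  have N: "inj N" "\<And>i. N i > 0" using N0 by (auto simp: N_def inj_def)
  define L where "L = (\<lambda>i. (i, s i)) ` UNIV"
  have "card L \<le> CARD('n)" unfolding L_def by (rule card_image_le) simp
  then have "card L < card {1..m}" using \<open>\<not> m \<le> CARD('n)\<close> by simp
  then have "\<not> alg_indep {1..m} (\<lambda>i. restrict_vars L (f i))"
    by (intro not_alg_indep_if_few_variables[of "{1..m}" L]) (auto simp: L_def dest: keys_restrict_vars)
  then obtain Q :: "nat cpoly" where Q: "\<forall>k\<in>Poly_Mapping.keys Q. Poly_Mapping.keys k \<subseteq> {1..m}"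
    "poly_subst (\<lambda>i. restrict_vars L (f i)) Q = 0" "Q \<noteq> 0"
    unfolding alg_indep_def by blast
  \<comment> \<open>\<open>Q\<close> is a relation between the restrictions, so \<open>F\<close> is
    a central element that vanishes on the subspace.\<close>
  define F where "F = poly_subst f Q"
  have "restrict_vars L F = eval_poly Const (\<lambda>i. restrict_vars L (f i)) Q"
    unfolding F_def by (rule hom_poly_subst[OF ring_homo_Const restrict_vars.ring_homo_axioms]) simp
  then have res: "restrict_vars L F = 0" using Q by (simp add: poly_subst_eq_eval)
  have FV: "B F (Var u) = 0" for u
    unfolding F_def using central Q(1)
    by (intro bracket_poly_subst[of "{1..m}"]) (auto simp: central_def Ghat_def split: prod.splits, metis surj_pair)
  have F: "B F y = 0" for y
  proof -
    have "B (Var u) F = 0" for u using skew[of "Var u" F] FV by simp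
    then have "B y F = 0" by (simp add: chain_rule[of y F])
    then show ?thesis using skew[of F y] by simp
  qed
  have "F = 0"
  proof (rule eq_0_if_restriction_eq_0[OF poisson c0_bracket, where p = "regular_point s N" and L = L])
    show "regular_point s N u = 0" if "u \<notin> L" for u
      using that by (auto simp: regular_point_def L_def split: prod.splits)
    show "d u = 0" if "\<And>y. (\<Sum>v\<in>UNIV. d v * c1 (regular_point s N) (B (Var v) y)) = 0" "u \<notin> L" for d :: "'n \<times> 'n \<Rightarrow> complex" and u
    proof -
      obtain i j where u: "u = (i, j)" by (cases u)
      then have ji: "j \<noteq> s i" using that(2) by (auto simp: L_def)
      from s fp N(1) N(2) that(1) ji show ?thesis unfolding u by (rule nondegenerate)
    qed
  qed (use F res in auto)
  then show False
    using indep Q(1,3) unfolding alg_indep_def F_def by blast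
qed

theorem proposition7p6:
  fixes Ph :: complex
    and B :: "('n :: {finite, linorder} \<times> 'n) cpoly \<Rightarrow> ('n \<times> 'n) cpoly \<Rightarrow> ('n \<times> 'n) cpoly"
    and n :: nat
  assumes "n = CARD('n)" and "n \<ge> 2"
    and "exp (Ph / 2) + exp (- Ph / 2) \<noteq> 0"
    and "is_D_bracket Ph B"
  shows "\<exists>c :: nat \<Rightarrow> ('n \<times> 'n) cpoly.
    det Mhat = (lam - 1) ^ (n - 1) *
      (lam ^ (n + 1)
       + (\<Sum>i = 1..n. lam ^ i * fls_const (c i))
       + (- 1) ^ (n + 1) * (\<Sum>i = 1..n. fls_X ^ (i - 1) * fls_const (c i))
       + (- 1) ^ (n + 1) * fls_X ^ n) \<and>
    (\<forall>i\<in>{1..n}. central B (c i)) \<and>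
    alg_indep {1..n} c \<and>
    (\<forall>m (d :: nat \<Rightarrow> ('n \<times> 'n) cpoly).
       (\<forall>i\<in>{1..m}. central B (d i)) \<and> alg_indep {1..m} d \<longrightarrow> m \<le> n)"
proof -
  interpret D_algebra Ph B by unfold_locales fact
  obtain H :: "('n \<times> 'n) cpoly poly" where H: "det Pmat = (1 - [:0, 1:]) ^ (CARD('n) - 1) * H" "coeff H 0 = 1"
    and pal: "\<And>k. k \<le> 2 * CARD('n) + 1 \<Longrightarrow> coeff H (2 * CARD('n) + 1 - k) = (- 1) ^ (CARD('n) + 1) * coeff H k"
    and deg: "\<And>k. k > 2 * CARD('n) + 1 \<Longrightarrow> coeff H k = 0"
    using generating_poly by blast
  \<comment> \<open>After multiplication by \<lambda>^(n+1), this is the coefficient of \<lambda>^i;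
    the symmetry of \<open>H\<close> supplies the lower half.\<close>
  define c where "c i = coeff H (n + 1 - i)" for i
  let ?h = "\<lambda>k. fls_const (coeff H k)"
  have top: "?h (2 * n + 1) = (- 1) ^ (n + 1)"
    using pal[of 0] H(2) assms(1) fls_const_power[of "- 1 :: ('n \<times> 'n) cpoly" "n + 1"] by simp
  have upper: "?h (n + i) = (- 1) ^ (n + 1) * fls_const (c i)" if "i \<in> {1..n}" for i
  proof -
    have "2 * n + 1 - (n + 1 - i) = n + i" "n + 1 - i \<le> 2 * n + 1" using that by auto
    then have "coeff H (n + i) = (- 1) ^ (n + 1) * c i"
      using pal[of "n + 1 - i"] assms(1) by (simp add: c_def)
    moreover have "fls_const ((- 1) ^ (n + 1) * c i) = (- 1) ^ (n + 1) * fls_const (c i)"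
      unfolding fls_const_mult_const[symmetric] fls_const_power by simp
    ultimately show ?thesis by simp
  qed
  have LX: "lam * fls_X = (1 :: ('n \<times> 'n) cpoly fls)"
    by (rule fls_eqI) (simp add: fls_X_inv_times_nth)
  have "lam ^ (n + 1) * (\<Sum>k\<le>2 * n + 1. fls_X ^ k * ?h k) = lam ^ (n + 1) * ?h 0
    + (\<Sum>i = 1..n. lam ^ i * ?h (n + 1 - i)) + (\<Sum>i = 1..n. fls_X ^ (i - 1) * ?h (n + i)) + fls_X ^ n * ?h (2 * n + 1)"
    by (rule laurent_split[OF LX])
  also have "(\<Sum>i = 1..n. fls_X ^ (i - 1) * ?h (n + i)) = (- 1) ^ (n + 1) * (\<Sum>i = 1..n. fls_X ^ (i - 1) * fls_const (c i))"
    unfolding sum_distrib_left by (intro sum.cong refl) (simp only: upper mult.left_commute)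
  finally have "lam ^ (n + 1) * (\<Sum>k\<le>2 * n + 1. fls_X ^ k * ?h k) = lam ^ (n + 1)
       + (\<Sum>i = 1..n. lam ^ i * fls_const (c i))
       + (- 1) ^ (n + 1) * (\<Sum>i = 1..n. fls_X ^ (i - 1) * fls_const (c i))
       + (- 1) ^ (n + 1) * fls_X ^ n"
    unfolding top H(2) c_def by (simp only: fls_const_1 mult_1_right mult.commute[of "fls_X ^ n"])
  then have "det Mhat = (lam - 1) ^ (n - 1) *
      (lam ^ (n + 1)
       + (\<Sum>i = 1..n. lam ^ i * fls_const (c i))
       + (- 1) ^ (n + 1) * (\<Sum>i = 1..n. fls_X ^ (i - 1) * fls_const (c i))
       + (- 1) ^ (n + 1) * fls_X ^ n)"
    using det_Mhat_generating_poly[OF H(1) deg] unfolding assms(1)[symmetric] by simp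
  moreover have "\<forall>i\<in>{1..n}. central B (c i)"
    unfolding c_def using central_coeff[OF assms(4) H(1)] by blast
  moreover have "alg_indep {1..n} c"
  proof (rule alg_indep_if_surjective)
    fix t
    show "\<exists>x. \<forall>i\<in>{1..n}. peval x (c i) = t i"
      unfolding c_def assms(1) by (rule generating_coefficients_surjective[OF H pal deg])
  qed
  moreover have "\<forall>m (d :: nat \<Rightarrow> ('n \<times> 'n) cpoly).
       (\<forall>i\<in>{1..m}. central B (d i)) \<and> alg_indep {1..m} d \<longrightarrow> m \<le> n"
    unfolding assms(1) using central_alg_indep_le by blast
  ultimately show ?thesis by blast
qed

end
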